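(* Let $n\ge 1$ and, for each $i\in\{1,\dots,n\}$, let $D_i$ be the (finite) node set of a rooted tree $T_i$ with root $r_i$, where each $T_i$ is binary, i.e. every node has at most two children. Let $\mathcal D=D_1\times\dots\times D_n$ and let $f:\mathcal D\to\mathbb R$ be strongly tree-submodular (defined in the context). Then, given $f$ by a value oracle (together with the trees $T_i$), a minimizer of $f$ over $\mathcal D$ can be computed in time polynomial in $n$ and $\max_i |D_i|$.
   Context: For $a,b\in D_i$: $a\preceq b$ means $a$ is an ancestor of $b$ in $T_i$ (i.e. $a$ lies on the path from $b$ to $r_i$; every node is an ancestor of itself). $\mathcal P[a\to b]$ is the unique path from $a$ to $b$ in $T_i$, $\rho(a,b)$ its number of edges, and for an integer $d\ge 0$, $\mathcal P[a\to b,d]$ is the $d$-th node of this path (so $\mathcal P[a\to b,0]=a$, $\mathcal P[a\to b,\rho(a,b)]=b$), with $\mathcal P[a\to b,d]=b$ if $d>\rho(a,b)$. Define $a\sqcap b, a\sqcup b\in D_i$ as the unique pair of labels with $\{a\sqcap b,a\sqcup b\}=\{\mathcal P[a\to b,\lfloor d/2\rfloor],\mathcal P[a\to b,\lceil d/2\rceil]\}$ where $d=\rho(a,b)$, and $a\sqcap b\preceq a\sqcup b$. Extend $\sqcap,\sqcup$ to $\mathcal D$ componentwise. A function $f:\mathcal D\to\mathbb R$ is strongly tree-submodular if $f(x)+f(y)\ge f(x\sqcap y)+f(x\sqcup y)$ for all $x,y\in\mathcal D$. In the value oracle model, $f$ is accessible only through an oracle returning $f(x)$ for a queried $x\in\mathcal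 D$. *)

theory Defs
  imports
    Complex_Main
    "HOL-Library.FuncSet"
    "HOL-Computational_Algebra.Polynomial"
begin

section \<open>Rooted trees\<close>

record 'a rtree =
  nodes :: "'a set"
  edges :: "'a set set"
  root :: 'a

definition adj :: "('a, 'z) rtree_scheme \<Rightarrow> 'a \<Rightarrow> 'a \<Rightarrow> bool" where
  "adj T u v \<longleftrightarrow> {u, v} \<in> edges T"

text \<open>Paths are simple and are represented by their node sequence.\<close>

definition is_path :: "('a, 'z) rtree_scheme \<Rightarrow> 'a \<Rightarrow> 'a \<Rightarrow> 'a list \<Rightarrow> bool" where
  "is_path T a b p \<longleftrightarrow>
     p \<noteq> [] \<and> hd p = a \<and> last p = b \<and> set p \<subseteq> nodes T \<and> distinct p \<and> successively (adj T) p"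

definition is_cycle :: "('a, 'z) rtree_scheme \<Rightarrow> 'a list \<Rightarrow> bool" where
  "is_cycle T p \<longleftrightarrow>
     length p \<ge> 3 \<and> set p \<subseteq> nodes T \<and> distinct p \<and> successively (adj T) p \<and> adj T (last p) (hd p)"

text \<open>A finite simple graph that is connected and has no cycle, with a distinguished node.\<close>

definition rooted_tree :: "('a, 'z) rtree_scheme \<Rightarrow> bool" where
  "rooted_tree T \<longleftrightarrow>
     finite (nodes T) \<and> root T \<in> nodes T \<and>
     edges T \<subseteq> {{u, v} | u v. u \<in> nodes T \<and> v \<in> nodes T \<and> u \<noteq> v} \<and>
     (\<forall>a\<in>nodes T. \<forall>b\<in>nodes T. \<exists>p. is_path T a b p) \<and>
     (\<nexists>p. is_cycle T p)"

definition tree_path :: "('a, 'z) rtree_scheme \<Rightarrow> 'a \<Rightarrow> 'a \<Rightarrow> 'a list" where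
  "tree_path T a b = (THE p. is_path T a b p)"

definition tree_dist :: "('a, 'z) rtree_scheme \<Rightarrow> 'a \<Rightarrow> 'a \<Rightarrow> nat" where
  "tree_dist T a b = length (tree_path T a b) - 1"

definition path_node :: "('a, 'z) rtree_scheme \<Rightarrow> 'a \<Rightarrow> 'a \<Rightarrow> nat \<Rightarrow> 'a" where
  "path_node T a b d = (if d > tree_dist T a b then b else tree_path T a b ! d)"

definition ancestor :: "('a, 'z) rtree_scheme \<Rightarrow> 'a \<Rightarrow> 'a \<Rightarrow> bool" where
  "ancestor T a b \<longleftrightarrow> a \<in> set (tree_path T b (root T))"

definition children :: "('a, 'z) rtree_scheme \<Rightarrow> 'a \<Rightarrow> 'a set" where
  "children T v = {w \<in> nodes T. adj T v w \<and> ancestor T v w}"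

definition binary_tree :: "('a, 'z) rtree_scheme \<Rightarrow> bool" where
  "binary_tree T \<longleftrightarrow> (\<forall>v\<in>nodes T. card (children T v) \<le> 2)"

text \<open>For the root this is the root itself.\<close>

definition parent :: "('a, 'z) rtree_scheme \<Rightarrow> 'a \<Rightarrow> 'a" where
  "parent T v = path_node T v (root T) 1"


section \<open>Strong tree-submodularity\<close>

text \<open>The middle pair of the path from a to b, ordered by the ancestor relation; it consists of
  two copies of the same node if the distance is even. The rounded-up half of \<open>d\<close> is
  \<open>(d + 1) div 2\<close>.\<close>

definition meet_join :: "('a, 'z) rtree_scheme \<Rightarrow> 'a \<Rightarrow> 'a \<Rightarrow> 'a \<times> 'a" where
  "meet_join T a b = (let d = tree_dist T a b in
     THE st. {fst st, snd st} = {path_node T a b (d div 2), path_node T a b ((d + 1) div 2)} \<and>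
             ancestor T (fst st) (snd st))"

definition tmeet :: "('a, 'z) rtree_scheme \<Rightarrow> 'a \<Rightarrow> 'a \<Rightarrow> 'a" where
  "tmeet T a b = fst (meet_join T a b)"

definition tjoin :: "('a, 'z) rtree_scheme \<Rightarrow> 'a \<Rightarrow> 'a \<Rightarrow> 'a" where
  "tjoin T a b = snd (meet_join T a b)"

definition labelings :: "nat \<Rightarrow> (nat \<Rightarrow> ('a, 'z) rtree_scheme) \<Rightarrow> (nat \<Rightarrow> 'a) set" where
  "labelings n T = (\<Pi>\<^sub>E i\<in>{1..n}. nodes (T i))"

definition strongly_tree_submodular ::
    "nat \<Rightarrow> (nat \<Rightarrow> ('a, 'z) rtree_scheme) \<Rightarrow> ((nat \<Rightarrow> 'a) \<Rightarrow> real) \<Rightarrow> bool" where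
  "strongly_tree_submodular n T f \<longleftrightarrow>
     (\<forall>x\<in>labelings n T. \<forall>y\<in>labelings n T.
        f x + f y \<ge> f (\<lambda>i\<in>{1..n}. tmeet (T i) (x i) (y i)) + f (\<lambda>i\<in>{1..n}. tjoin (T i) (x i) (y i)))"


section \<open>Random access machines with real arithmetic and a value oracle\<close>

text \<open>
  Programs work on named multi-dimensional arrays (scalars have the empty index list) of natural
  numbers and of real numbers. The model is the usual unit-cost real RAM:
  \<^item> Natural numbers only have constants, addition and truncated subtraction. There is no
    multiplication, so that a computation of \<open>t\<close> steps only produces numbers whose bit length is
    bounded by the input bit length plus \<open>O(t)\<close>.
  \<^item> Real numbers have the field operations and comparisons, but no rounding. The only
    real constants are natural numbers, so a program cannot contain encoded advice.
  \<^item> Expressions in a fixed program have bounded size, so each assignment, oracle call and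
    evaluation of a condition is charged one time unit.
\<close>

datatype nexp =
    NConst nat
  | NLoad string "nexp list"
  | NAdd nexp nexp
  | NSub nexp nexp

datatype rexp =
    ROfNat nexp
  | RLoad string "nexp list"
  | RAdd rexp rexp
  | RSub rexp rexp
  | RMul rexp rexp
  | RDiv rexp rexp

datatype bexp =
    NLess nexp nexp
  | RLess rexp rexp
  | BNot bexp
  | BAnd bexp bexp

datatype com =
    NAssign string "nexp list" nexp
  | RAssign string "nexp list" rexp
  | Query string "nexp list" string
  | Seq com com
  | Cond bexp com com
  | While bexp com

record store =
  nmem :: "string \<Rightarrow> nat list \<Rightarrow> nat"
  rmem :: "string \<Rightarrow> nat list \<Rightarrow> real"

fun nval :: "store \<Rightarrow> nexp \<Rightarrow> nat" where
  "nval s (NConst k) = k"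
| "nval s (NLoad x es) = nmem s x (map (nval s) es)"
| "nval s (NAdd a b) = nval s a + nval s b"
| "nval s (NSub a b) = nval s a - nval s b"

text \<open>Division by zero yields zero, as usual in HOL.\<close>

fun rval :: "store \<Rightarrow> rexp \<Rightarrow> real" where
  "rval s (ROfNat e) = real (nval s e)"
| "rval s (RLoad x es) = rmem s x (map (nval s) es)"
| "rval s (RAdd a b) = rval s a + rval s b"
| "rval s (RSub a b) = rval s a - rval s b"
| "rval s (RMul a b) = rval s a * rval s b"
| "rval s (RDiv a b) = rval s a / rval s b"

fun bval :: "store \<Rightarrow> bexp \<Rightarrow> bool" where
  "bval s (NLess a b) \<longleftrightarrow> nval s a < nval s b"
| "bval s (RLess a b) \<longleftrightarrow> rval s a < rval s b"
| "bval s (BNot b) \<longleftrightarrow> \<not> bval s b"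
| "bval s (BAnd b c) \<longleftrightarrow> bval s b \<and> bval s c"

definition nupdate :: "string \<Rightarrow> nat list \<Rightarrow> nat \<Rightarrow> store \<Rightarrow> store" where
  "nupdate x ks k s = s\<lparr>nmem := (nmem s)(x := (nmem s x)(ks := k))\<rparr>"

definition rupdate :: "string \<Rightarrow> nat list \<Rightarrow> real \<Rightarrow> store \<Rightarrow> store" where
  "rupdate x ks r s = s\<lparr>rmem := (rmem s)(x := (rmem s x)(ks := r))\<rparr>"

text \<open>\<open>exec orac c s t s'\<close>: with oracle \<open>orac\<close>, the program \<open>c\<close> started in \<open>s\<close> terminates in \<open>s'\<close>
  after exactly \<open>t\<close> time units. \<open>Query x es a\<close> passes the one-dimensional array \<open>a\<close> to the oracle
  and stores the answer.\<close>

inductive exec :: "((nat \<Rightarrow> nat) \<Rightarrow> real) \<Rightarrow> com \<Rightarrow> store \<Rightarrow> nat \<Rightarrow> store \<Rightarrow> bool"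
  for orac :: "(nat \<Rightarrow> nat) \<Rightarrow> real" where
  NAssign: "exec orac (NAssign x es e) s 1 (nupdate x (map (nval s) es) (nval s e) s)"
| RAssign: "exec orac (RAssign x es e) s 1 (rupdate x (map (nval s) es) (rval s e) s)"
| Query: "exec orac (Query x es a) s 1 (rupdate x (map (nval s) es) (orac (\<lambda>i. nmem s a [i])) s)"
| Seq: "exec orac c1 s t1 s1 \<Longrightarrow> exec orac c2 s1 t2 s2 \<Longrightarrow> exec orac (Seq c1 c2) s (t1 + t2) s2"
| CondTrue: "bval s b \<Longrightarrow> exec orac c1 s t s' \<Longrightarrow> exec orac (Cond b c1 c2) s (1 + t) s'"
| CondFalse: "\<not> bval s b \<Longrightarrow> exec orac c2 s t s' \<Longrightarrow> exec orac (Cond b c1 c2) s (1 + t) s'"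
| WhileFalse: "\<not> bval s b \<Longrightarrow> exec orac (While b c) s 1 s"
| WhileTrue: "bval s b \<Longrightarrow> exec orac c s t1 s1 \<Longrightarrow> exec orac (While b c) s1 t2 s2 \<Longrightarrow>
    exec orac (While b c) s (1 + t1 + t2) s2"

inductive_cases exec_NAssignE: "exec orac (NAssign x es e) s t s'"
inductive_cases exec_RAssignE: "exec orac (RAssign x es e) s t s'"
inductive_cases exec_QueryE: "exec orac (Query x es a) s t s'"
inductive_cases exec_SeqE: "exec orac (Seq c1 c2) s t s'"
inductive_cases exec_CondE: "exec orac (Cond b c1 c2) s t s'"
inductive_cases exec_WhileE: "exec orac (While b c) s t s'"

lemma exec_deterministic:
  "exec orac c s t s' \<Longrightarrow> exec orac c s u s'' \<Longrightarrow> u = t \<and> s'' = s'"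
proof (induction arbitrary: u s'' rule: exec.induct)
  case (Seq c1 s t1 s1 c2 t2 s2)
  from Seq.prems obtain u1 r u2 where *: "u = u1 + u2" "exec orac c1 s u1 r" "exec orac c2 r u2 s''"
    by (rule exec_SeqE)
  from Seq.IH(1)[OF *(2)] Seq.IH(2)[of u2 s''] * show ?case by simp
next
  case (CondTrue s b c1 t s' c2)
  from CondTrue.prems show ?case
    by (rule exec_CondE) (simp_all add: CondTrue.hyps CondTrue.IH)
next
  case (CondFalse s b c2 t s' c1)
  from CondFalse.prems show ?case
    by (rule exec_CondE) (simp_all add: CondFalse.hyps CondFalse.IH)
next
  case (WhileFalse s b c)
  from WhileFalse.prems show ?case by (rule exec_WhileE) (simp_all add: WhileFalse.hyps)
next
  case (WhileTrue s b c t1 s1 t2 s2)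
  from WhileTrue.prems WhileTrue.hyps(1) obtain u1 r u2 where
    *: "u = 1 + u1 + u2" "exec orac c s u1 r" "exec orac (While b c) r u2 s''"
    by (auto elim: exec_WhileE)
  from WhileTrue.IH(1)[OF *(2)] WhileTrue.IH(2)[of u2 s''] * show ?case by simp
qed (erule exec_NAssignE exec_RAssignE exec_QueryE; simp)+


section \<open>Minimization in the value oracle model\<close>

text \<open>
  The nodes of \<open>T i\<close> are numbered \<open>0, 1, \<dots>\<close> in an arbitrary order. The machine is given \<open>n\<close>
  and, for each \<open>i\<close> in \<open>{1..n}\<close>, the number of nodes, the root and the parent array
  of \<open>T i\<close>; all other memory cells are zero.
\<close>

definition numbered :: "(nat, 'z) rtree_scheme \<Rightarrow> bool" where
  "numbered T \<longleftrightarrow> nodes T = {..<card (nodes T)}"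

definition input_nmem :: "nat \<Rightarrow> (nat \<Rightarrow> nat rtree) \<Rightarrow> string \<Rightarrow> nat list \<Rightarrow> nat" where
  "input_nmem n T x ks =
     (if x = ''n'' \<and> ks = [] then n
      else if x = ''size'' \<and> (\<exists>i\<in>{1..n}. ks = [i]) then card (nodes (T (ks ! 0)))
      else if x = ''root'' \<and> (\<exists>i\<in>{1..n}. ks = [i]) then root (T (ks ! 0))
      else if x = ''parent'' \<and> (\<exists>i\<in>{1..n}. \<exists>v\<in>nodes (T i). ks = [i, v])
        then parent (T (ks ! 0)) (ks ! 1)
      else 0)"

definition input_store :: "nat \<Rightarrow> (nat \<Rightarrow> nat rtree) \<Rightarrow> store" where
  "input_store n T = \<lparr>nmem = input_nmem n T, rmem = (\<lambda>_ _. 0)\<rparr>"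

text \<open>On arguments outside \<open>labelings n T\<close> the oracle returns values of \<open>f\<close> that
  \<open>strongly_tree_submodular\<close> does not constrain, so such calls carry no information.\<close>

definition value_oracle :: "nat \<Rightarrow> ((nat \<Rightarrow> nat) \<Rightarrow> real) \<Rightarrow> (nat \<Rightarrow> nat) \<Rightarrow> real" where
  "value_oracle n f v = f (restrict v {1..n})"

definition output_labeling :: "nat \<Rightarrow> store \<Rightarrow> nat \<Rightarrow> nat" where
  "output_labeling n s = (\<lambda>i\<in>{1..n}. nmem s ''out'' [i])"

text \<open>A bivariate polynomial, as a polynomial in the second variable whose coefficients are
  polynomials in the first one.\<close>

definition poly2 :: "nat poly poly \<Rightarrow> nat \<Rightarrow> nat \<Rightarrow> nat" where
  "poly2 q a b = poly (poly q [:b:]) a"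

end

theory Submission
  imports Defs
begin

text \<open>
  The labeling of roots lies above every minimizer. If \<open>x\<close> does, consider the labelings obtained
  from \<open>x\<close> by moving some coordinates to a child: among those with least value, the one that moves
  the fewest coordinates again lies above every minimizer, and \<open>x\<close> is a minimizer if nothing moves.
  Both facts follow by summing the submodular inequality along the levels of a tree. Each move
  shrinks the set of descendants of a coordinate, so there are at most \<open>n * m\<close> phases.

  Since trees are binary, one phase is the minimization of a bisubmodular function on the consistent
  sets of literals, two for each coordinate (``move to the first child'' and ``move to the second
  child''). A relation of implications between literals, valid for all minimizers, is maintained.
  A round finds a skew vector with small Frank-Wolfe gap, where the linear subproblem is solved by a
  greedy chain of implication-closed sets; an entry that is far below zero shows that every
  minimizer contains a literal, or contains it as soon as it contains another one. Measuring
  precision relative to the current range of the function makes the number of Frank-Wolfe steps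
  polynomial in \<open>n\<close> alone, and each round adds an implication, so there are at most
  quadratically many rounds. When the range is zero, the literals implied by truth form the least
  minimizer.
\<close>

section \<open>Ancestors and short paths\<close>

text \<open>Values of \<open>f\<close> are arbitrary reals and the machine cannot round, so the
  running time may not depend on their size: every threshold is a fixed fraction of a scale
  recomputed from queried values, and progress is counted in combinatorial facts only. These facts
  must be implications, not only forced literals. A search among all sets may find nothing although
  \<open>f\<close> still varies; the variation then comes from the closure of some literal
  \<open>l0\<close> with a large value, and a search among the sets containing \<open>l0\<close>
  finds a consequence of \<open>l0\<close> or shows that no minimizer contains it. Implications
  spoil the linear subproblem. On implication-closed sets the constraints
  \<open>z(A) <= f(A) - f(B)\<close> define an unbounded polyhedron, and the greedy order must
  respect implications while the direction \<open>-z\<close> need not. So the direction is lowered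
  to a monotone weight, and multiples of recession directions, one per negative literal, are added
  to the greedy vector to make up for the loss. On the trees, only middle pairs of labels at
  distance at most two are ever computed; everything else follows by adding inequalities.\<close>

lemma adj_sym: "adj T u v \<Longrightarrow> adj T v u"
  by (simp add: adj_def insert_commute)

lemma successively_rev_adj: "successively (adj T) (rev p) = successively (adj T) p"
proof -
  have "(\<lambda>x y. adj T y x) = adj T" by (intro ext) (metis adj_sym)
  then show ?thesis by (simp only: successively_rev)
qed

text \<open>Two paths that leave \<open>a\<close> along different edges meet again at the latest in
  \<open>b\<close>; the two pieces up to the meeting point close a cycle.\<close>

lemma path_unique:
  assumes T: "rooted_tree T"
  shows "is_path T a b p \<Longrightarrow> is_path T a b q \<Longrightarrow> p = q"
proof (induction p arbitrary: a q)
  case Nil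
  then show ?case by (simp add: is_path_def)
next
  case (Cons a' p')
  then have a': "a' = a" by (simp add: is_path_def)
  from Cons.prems(2) obtain q' where q: "q = a # q'" by (cases q) (auto simp: is_path_def)
  note P = Cons.prems(1)[unfolded is_path_def a'] and Q = Cons.prems(2)[unfolded is_path_def q]
  show ?case
  proof (cases "a = b")
    case True
    then have "p' = []" "q' = []" using P Q by (auto split: if_splits)
    then show ?thesis by (simp add: q a')
  next
    case False
    then have ne: "p' \<noteq> []" "q' \<noteq> []" using P Q by auto
    have P': "is_path T (hd p') b p'" and Q': "is_path T (hd q') b q'"
      and ad: "adj T a (hd p')" "adj T a (hd q')"
      using P Q ne by (auto simp: is_path_def successively_Cons)
    show ?thesis
    proof (cases "hd p' = hd q'")
      case True
      then show ?thesis using Cons.IH[OF P'] Q' by (simp add: q a')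
    next
      case hd: False
      have "b \<in> set p'" "b \<in> set q'" using P' Q' unfolding is_path_def by (metis last_in_set)+
      \<comment> \<open>Cutting \<open>p'\<close> at its first node on \<open>q'\<close> keeps the
        two pieces disjoint, so the closed walk below is simple.\<close>
      then obtain p1 u p2 where p1: "p' = p1 @ u # p2" "u \<in> set q'" "\<forall>y\<in>set p1. y \<notin> set q'"
        using split_list_first_prop[of p' "\<lambda>y. y \<in> set q'"] by blast
      from p1(2) obtain q1 q2 where q1: "q' = q1 @ u # q2" by (meson split_list)
      let ?c = "a # p1 @ u # rev q1"
      have "p1 \<noteq> [] \<or> q1 \<noteq> []" using hd p1(1) q1 by auto
      then have "length ?c \<ge> 3" by (cases p1; cases q1) auto
      moreover have "set ?c \<subseteq> nodes T" using P Q p1 q1 by auto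
      moreover have "distinct ?c" using P Q p1 q1 by auto
      moreover have "successively (adj T) ?c"
      proof -
        have 1: "successively (adj T) (a # p1 @ [u])" using P p1(1)
          by (auto simp: successively_append_iff successively_Cons hd_append split: if_splits)
        have "successively (adj T) (q1 @ [u])" using Q q1
          by (auto simp: successively_append_iff successively_Cons)
        then have 2: "successively (adj T) (u # rev q1)"
          using successively_rev_adj[of T "q1 @ [u]"] by simp
        show ?thesis using 1 2
          by (auto simp: successively_append_iff successively_Cons hd_append split: if_splits)
      qed
      moreover have "adj T (last ?c) (hd ?c)"
      proof (cases q1)
        case Nil
        then have "hd q' = u" using q1 by simp
        then show ?thesis using Nil ad adj_sym[of T a u] by auto
      next
        case (Cons v r)
        then show ?thesis using q1 ad adj_sym[of T a v] by auto
      qed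
      ultimately have "is_cycle T ?c" by (simp add: is_cycle_def)
      then show ?thesis using T by (auto simp: rooted_tree_def)
    qed
  qed
qed

lemma tree_path_eq: "rooted_tree T \<Longrightarrow> is_path T a b p \<Longrightarrow> tree_path T a b = p"
  unfolding tree_path_def by (rule the_equality) (auto intro: path_unique)

lemma tree_path_is_path:
  "rooted_tree T \<Longrightarrow> a \<in> nodes T \<Longrightarrow> b \<in> nodes T \<Longrightarrow> is_path T a b (tree_path T a b)"
  using tree_path_eq[of T a b] unfolding rooted_tree_def by auto metis

section \<open>Parents, levels and the ancestor order\<close>

abbreviation nonroot :: "('a, 'z) rtree_scheme \<Rightarrow> 'a \<Rightarrow> bool" where
  "nonroot T v \<equiv> v \<in> nodes T \<and> v \<noteq> root T"

definition level :: "('a, 'z) rtree_scheme \<Rightarrow> 'a \<Rightarrow> nat" where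
  "level T v = tree_dist T v (root T)"

lemma path_refl: "rooted_tree T \<Longrightarrow> v \<in> nodes T \<Longrightarrow> tree_path T v v = [v]"
  by (rule tree_path_eq) (auto simp: is_path_def)

lemma root_in: "rooted_tree T \<Longrightarrow> root T \<in> nodes T" by (simp add: rooted_tree_def)

lemma root_path_Cons:
  assumes T: "rooted_tree T" and v: "nonroot T v"
  shows "tree_path T v (root T) = v # tree_path T (parent T v) (root T)"
    and "parent T v \<in> nodes T" and "adj T v (parent T v)"
proof -
  have P: "is_path T v (root T) (tree_path T v (root T))"
    using tree_path_is_path[OF T] v root_in[OF T] by blast
  then obtain w r where r: "tree_path T v (root T) = v # w # r"
    using v by (cases "tree_path T v (root T)"; cases "tl (tree_path T v (root T))")
      (auto simp: is_path_def)
  have w: "parent T v = w" by (simp add: parent_def path_node_def tree_dist_def r)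
  have "is_path T w (root T) (w # r)" using P unfolding r by (auto simp: is_path_def)
  then have "tree_path T w (root T) = w # r" by (rule tree_path_eq[OF T])
  then show "tree_path T v (root T) = v # tree_path T (parent T v) (root T)" by (simp add: r w)
  show "parent T v \<in> nodes T" "adj T v (parent T v)"
    using P unfolding r w by (auto simp: is_path_def)
qed

lemma parent_root: "rooted_tree T \<Longrightarrow> parent T (root T) = root T"
  by (simp add: parent_def path_node_def tree_dist_def path_refl root_in)

lemma parent_in: "rooted_tree T \<Longrightarrow> v \<in> nodes T \<Longrightarrow> parent T v \<in> nodes T"
  using root_path_Cons(2) parent_root by metis

lemma level_root: "rooted_tree T \<Longrightarrow> level T (root T) = 0"
  by (simp add: level_def tree_dist_def path_refl root_in)

lemma level_parent: "rooted_tree T \<Longrightarrow> nonroot T v \<Longrightarrow> level T v = Suc (level T (parent T v))"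
  using root_path_Cons(1)[of T v] tree_path_is_path[of T "parent T v" "root T"] parent_in[of T v] root_in[of T]
  by (cases "tree_path T (parent T v) (root T)") (auto simp: level_def tree_dist_def is_path_def)

lemma parent_neq: "rooted_tree T \<Longrightarrow> nonroot T v \<Longrightarrow> parent T v \<noteq> v"
  using level_parent by fastforce

lemma ancestor_refl: "rooted_tree T \<Longrightarrow> v \<in> nodes T \<Longrightarrow> ancestor T v v"
  using tree_path_is_path[of T v "root T"] root_in[of T] unfolding ancestor_def is_path_def
  by (metis hd_in_set)

lemma ancestor_iff:
  assumes "rooted_tree T" "nonroot T v"
  shows "ancestor T a v \<longleftrightarrow> a = v \<or> ancestor T a (parent T v)"
  using root_path_Cons(1)[OF assms] by (auto simp: ancestor_def)

lemma ancestor_root: "rooted_tree T \<Longrightarrow> ancestor T a (root T) \<longleftrightarrow> a = root T"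
  by (simp add: ancestor_def path_refl root_in)

lemma tree_induct [consumes 2, case_names root step]:
  assumes T: "rooted_tree T" and v: "v \<in> nodes T"
    and "P (root T)" and "\<And>v. nonroot T v \<Longrightarrow> P (parent T v) \<Longrightarrow> P v"
  shows "P v"
  using v
proof (induction "level T v" arbitrary: v)
  case 0
  then show ?case using level_parent[OF T, of v] assms(3) by fastforce
next
  case (Suc k)
  then show ?case using level_parent[OF T, of v] level_root[OF T] parent_in[OF T] assms(4)
    by (metis nat.simps(3) old.nat.inject)
qed

lemma ancestor_of_root:
  assumes T: "rooted_tree T" and "v \<in> nodes T"
  shows "ancestor T (root T) v"
  using assms by (induction rule: tree_induct) (auto simp: ancestor_root[OF T] ancestor_iff[OF T])

lemma ancestor_in_level:
  assumes T: "rooted_tree T" and "v \<in> nodes T"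
  shows "ancestor T a v \<Longrightarrow> a \<in> nodes T \<and> level T a \<le> level T v \<and> (level T a = level T v \<longrightarrow> a = v)"
  using assms
  by (induction rule: tree_induct)
    (auto simp: ancestor_root[OF T] ancestor_iff[OF T] level_parent[OF T] root_in[OF T])

lemma ancestor_trans:
  assumes T: "rooted_tree T" and "c \<in> nodes T"
  shows "ancestor T a b \<Longrightarrow> ancestor T b c \<Longrightarrow> ancestor T a c"
  using assms
  by (induction rule: tree_induct) (auto simp: ancestor_root[OF T] ancestor_iff[OF T])

lemma ancestor_parent: "rooted_tree T \<Longrightarrow> nonroot T v \<Longrightarrow> ancestor T (parent T v) v"
  using ancestor_iff ancestor_refl parent_in by metis

section \<open>Middle pairs of paths with at most two edges\<close>

lemma tree_path_swap1:
  assumes "rooted_tree T" "nonroot T c"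
  shows "tree_path T (parent T c) c = [parent T c, c]" "tree_path T c (parent T c) = [c, parent T c]"
  using root_path_Cons(2,3)[OF assms] parent_neq[OF assms] assms adj_sym[OF root_path_Cons(3)[OF assms]]
  by (auto intro!: tree_path_eq simp: is_path_def)

lemma ancestor_antisym_parent:
  assumes "rooted_tree T" "nonroot T c"
  shows "\<not> ancestor T c (parent T c)"
  using ancestor_in_level[OF assms(1) parent_in[OF assms(1)], of c c] level_parent[OF assms] assms by fastforce

text \<open>With a single edge the two middle positions are the ends, and the ancestor hypotheses
  leave one way to order them, so the description in \<open>meet_join\<close> is definite.\<close>

lemma meet_join_path2:
  assumes "tree_path T a b = [a, b]" "{a, b} = {p, c}" "ancestor T p c" "\<not> ancestor T c p"
  shows "tmeet T a b = p" "tjoin T a b = c"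
proof -
  have "meet_join T a b = (p, c)"
    unfolding meet_join_def Let_def tree_dist_def path_node_def assms(1)
    using assms(2-4) by (intro the_equality) (auto simp: doubleton_eq_iff)
  then show "tmeet T a b = p" "tjoin T a b = c" by (simp_all add: tmeet_def tjoin_def)
qed

text \<open>For even length both middle positions coincide; zero and two are the only even lengths
  that occur.\<close>

lemma meet_join_path13:
  assumes "tree_path T a b = [p] \<or> tree_path T a b = [a, p, b]" "ancestor T p p"
  shows "tmeet T a b = p" "tjoin T a b = p"
proof -
  have "meet_join T a b = (p, p)"
    unfolding meet_join_def Let_def tree_dist_def path_node_def
    using assms by (intro the_equality) (auto simp: doubleton_eq_iff)
  then show "tmeet T a b = p" "tjoin T a b = p" by (simp_all add: tmeet_def tjoin_def)
qed

lemma meet_join_same: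
  assumes "rooted_tree T" "v \<in> nodes T"
  shows "tmeet T v v = v" "tjoin T v v = v"
  using meet_join_path13[of T v v v] path_refl[OF assms] ancestor_refl[OF assms] by auto

lemma meet_join_parent:
  assumes "rooted_tree T" "nonroot T c"
  shows "tmeet T (parent T c) c = parent T c" "tjoin T (parent T c) c = c"
    "tmeet T c (parent T c) = parent T c" "tjoin T c (parent T c) = c"
  using tree_path_swap1[OF assms] ancestor_parent[OF assms] ancestor_antisym_parent[OF assms]
    meet_join_path2[of T "parent T c" c "parent T c" c] meet_join_path2[of T c "parent T c" "parent T c" c]
  by (auto simp: insert_commute)

text \<open>Meet and join collapse to the middle node, unlike in a lattice. This is what makes
  inequalities telescope along a branch.\<close>

lemma meet_join_grandparent:
  assumes T: "rooted_tree T" and c: "nonroot T c" and p: "nonroot T (parent T c)"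
  shows "tmeet T (parent T (parent T c)) c = parent T c" "tjoin T (parent T (parent T c)) c = parent T c"
proof -
  have "parent T (parent T c) \<noteq> c" using level_parent[OF T c] level_parent[OF T p] by auto
  then have "tree_path T (parent T (parent T c)) c = [parent T (parent T c), parent T c, c]"
    using root_path_Cons(2,3)[OF T c] root_path_Cons(2,3)[OF T p] parent_neq[OF T c] parent_neq[OF T p] c
      adj_sym[OF root_path_Cons(3)[OF T c]] adj_sym[OF root_path_Cons(3)[OF T p]]
    by (auto intro!: tree_path_eq T simp: is_path_def)
  then show "tmeet T (parent T (parent T c)) c = parent T c" "tjoin T (parent T (parent T c)) c = parent T c"
    using meet_join_path13[of T _ c "parent T c"] ancestor_refl[OF T] p by auto
qed

lemma meet_join_siblings:
  assumes T: "rooted_tree T" and c: "nonroot T c" and d: "nonroot T d" and "parent T c = parent T d" "c \<noteq> d"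
  shows "tmeet T c d = parent T d" "tjoin T c d = parent T d"
proof -
  have "tree_path T c d = [c, parent T d, d]"
    using root_path_Cons(2,3)[OF T c] root_path_Cons(2,3)[OF T d] parent_neq[OF T c] parent_neq[OF T d] assms
      adj_sym[OF root_path_Cons(3)[OF T d]]
    by (auto intro!: tree_path_eq T simp: is_path_def)
  then show "tmeet T c d = parent T d" "tjoin T c d = parent T d"
    using meet_join_path13[of T c d "parent T d"] ancestor_refl[OF T] parent_in[OF T] d by auto
qed

lemma card_children_le_2:
  assumes T: "rooted_tree T" "binary_tree T" and v: "v \<in> nodes T"
  shows "card {w. nonroot T w \<and> parent T w = v} \<le> 2"
proof -
  have "{w. nonroot T w \<and> parent T w = v} \<subseteq> children T v"
    using adj_sym[OF root_path_Cons(3)[OF T(1)]] ancestor_parent[OF T(1)] by (auto simp: children_def)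
  moreover have "finite (children T v)" using T by (simp add: children_def rooted_tree_def)
  ultimately have "card {w. nonroot T w \<and> parent T w = v} \<le> card (children T v)" by (rule card_mono[rotated])
  then show ?thesis using T(2) v by (simp add: binary_tree_def order_trans)
qed

section \<open>Descent from the roots\<close>

locale tree_submodular =
  fixes n :: nat and T :: "nat \<Rightarrow> ('a, 'z) rtree_scheme" and f :: "(nat \<Rightarrow> 'a) \<Rightarrow> real"
  assumes tree: "i \<in> {1..n} \<Longrightarrow> rooted_tree (T i)"
    and submodular: "strongly_tree_submodular n T f"
begin

text \<open>Coordinates outside \<open>{1..n}\<close> are ignored, so a whole memory array can stand
  for a labeling.\<close>

definition F :: "(nat \<Rightarrow> 'a) \<Rightarrow> real" where
  "F u = f (restrict u {1..n})"

definition lab :: "(nat \<Rightarrow> 'a) \<Rightarrow> bool" where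
  "lab u \<longleftrightarrow> (\<forall>i\<in>{1..n}. u i \<in> nodes (T i))"

definition below :: "(nat \<Rightarrow> 'a) \<Rightarrow> (nat \<Rightarrow> 'a) \<Rightarrow> bool" where
  "below x z \<longleftrightarrow> (\<forall>i\<in>{1..n}. ancestor (T i) (x i) (z i))"

definition outward :: "(nat \<Rightarrow> 'a) \<Rightarrow> (nat \<Rightarrow> 'a) \<Rightarrow> bool" where
  "outward x y \<longleftrightarrow> (\<forall>i\<in>{1..n}. y i = x i \<or> nonroot (T i) (y i) \<and> parent (T i) (y i) = x i)"

definition minimal :: "(nat \<Rightarrow> 'a) \<Rightarrow> bool" where
  "minimal z \<longleftrightarrow> lab z \<and> (\<forall>u. lab u \<longrightarrow> F z \<le> F u)"

lemma F_cong: "(\<And>i. i \<in> {1..n} \<Longrightarrow> u i = v i) \<Longrightarrow> F u = F v"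
  unfolding F_def by (metis restrict_ext)

lemma F_submodular:
  assumes "lab u" "lab v"
    and mj: "\<And>i. i \<in> {1..n} \<Longrightarrow> tmeet (T i) (u i) (v i) = m i \<and> tjoin (T i) (u i) (v i) = j i"
  shows "F m + F j \<le> F u + F v"
proof -
  have uv: "restrict u {1..n} \<in> labelings n T" "restrict v {1..n} \<in> labelings n T"
    using assms(1,2) unfolding labelings_def lab_def by (simp_all add: restrict_PiE_iff)
  have "f (\<lambda>i\<in>{1..n}. tmeet (T i) (restrict u {1..n} i) (restrict v {1..n} i))
      + f (\<lambda>i\<in>{1..n}. tjoin (T i) (restrict u {1..n} i) (restrict v {1..n} i)) \<le> F u + F v"
    using submodular uv unfolding strongly_tree_submodular_def F_def by blast
  moreover have "(\<lambda>i\<in>{1..n}. tmeet (T i) (restrict u {1..n} i) (restrict v {1..n} i)) = restrict m {1..n}"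
    by (rule restrict_ext) (use mj in simp)
  moreover have "(\<lambda>i\<in>{1..n}. tjoin (T i) (restrict u {1..n} i) (restrict v {1..n} i)) = restrict j {1..n}"
    by (rule restrict_ext) (use mj in simp)
  ultimately show ?thesis by (simp add: F_def)
qed

lemma below_step:
  assumes i: "i \<in> {1..n}" and "lab z" and "below x z" and "z i \<noteq> x i"
  shows "nonroot (T i) (z i)" "ancestor (T i) (x i) (parent (T i) (z i))"
    "level (T i) (z i) = Suc (level (T i) (parent (T i) (z i)))"
    "level (T i) (x i) \<le> level (T i) (parent (T i) (z i))"
    "level (T i) (x i) = level (T i) (parent (T i) (z i)) \<longleftrightarrow> parent (T i) (z i) = x i"
proof -
  note T = tree[OF i]
  have a: "ancestor (T i) (x i) (z i)" and z: "z i \<in> nodes (T i)"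
    using assms(3,2) i unfolding below_def lab_def by blast+
  have "z i \<noteq> root (T i)"
  proof
    assume "z i = root (T i)"
    with a ancestor_root[OF T, of "x i"] have "x i = root (T i)" by simp
    with \<open>z i = root (T i)\<close> assms(4) show False by simp
  qed
  with z show nr: "nonroot (T i) (z i)" by simp
  show ap: "ancestor (T i) (x i) (parent (T i) (z i))"
    using a ancestor_iff[OF T nr, of "x i"] assms(4) by simp
  show "level (T i) (z i) = Suc (level (T i) (parent (T i) (z i)))" by (rule level_parent[OF T nr])
  note l = ancestor_in_level[OF T parent_in[OF T z] ap]
  show "level (T i) (x i) \<le> level (T i) (parent (T i) (z i))" using l by blast
  show "level (T i) (x i) = level (T i) (parent (T i) (z i)) \<longleftrightarrow> parent (T i) (z i) = x i"
    using l by metis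
qed

text \<open>A tree version of the translation submodularity of discrete convex analysis. On
  \<open>S\<close> the path from \<open>y i\<close> to \<open>z i\<close> passes through
  \<open>x i\<close>, and each end moves one edge towards the other; they swap if
  \<open>z i = x i\<close>. Other coordinates stay. The middle pair of distant labels is not of this
  form, hence the induction on the depth of \<open>z\<close> below \<open>x\<close>.\<close>

lemma translation_submodular:
  assumes "lab x" "lab z" "below x z" "outward x y"
    and "\<And>i. i \<in> {1..n} \<Longrightarrow> level (T i) (z i) \<le> Suc D + level (T i) (x i)"
  defines "S \<equiv> \<lambda>z i. y i \<noteq> x i \<and> \<not> ancestor (T i) (y i) (z i)"
  shows "F (\<lambda>i. if S z i then x i else y i)
    + F (\<lambda>i. if S z i then if z i = x i then y i else parent (T i) (z i) else z i) \<le> F y + F z"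
  using assms(2,3,5)
proof (induction D arbitrary: z)
  have y: "lab y" using assms(1,4) by (auto simp: lab_def outward_def)
  case 0
  show ?case
  proof (rule F_submodular[OF y 0(1)])
    fix i assume i: "i \<in> {1..n}"
    note T = tree[OF i]
    have yi: "y i \<in> nodes (T i)" and xi: "x i \<in> nodes (T i)" using y assms(1) i by (auto simp: lab_def)
    have yx: "y i \<noteq> x i \<Longrightarrow> nonroot (T i) (y i) \<and> parent (T i) (y i) = x i"
      using assms(4) i by (auto simp: outward_def)
    have zx: "nonroot (T i) (z i) \<and> parent (T i) (z i) = x i" if "z i \<noteq> x i"
      using below_step[OF i 0(1,2) that] 0(3)[OF i] by simp
    show "tmeet (T i) (y i) (z i) = (if S z i then x i else y i) \<and>
      tjoin (T i) (y i) (z i) = (if S z i then if z i = x i then y i else parent (T i) (z i) else z i)"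
    proof (cases "z i = x i")
      case zx': True
      show ?thesis
      proof (cases "y i = x i")
        case True
        then show ?thesis using zx' meet_join_same[OF T xi] by (simp add: S_def)
      next
        case False
        have "\<not> ancestor (T i) (y i) (x i)"
          using yx[OF False] ancestor_antisym_parent[OF T, of "y i"] by simp
        then show ?thesis using zx' False yx[OF False] meet_join_parent[OF T, of "y i"] by (simp add: S_def)
      qed
    next
      case zx': False
      note zx = zx[OF zx']
      show ?thesis
      proof (cases "y i = x i")
        case True
        then show ?thesis using zx' zx meet_join_parent[OF T, of "z i"] by (simp add: S_def)
      next
        case False
        note yx = yx[OF False]
        have a: "ancestor (T i) (y i) (z i) \<longleftrightarrow> y i = z i"
          using ancestor_iff[OF T, of "z i" "y i"] zx yx ancestor_antisym_parent[OF T, of "y i"] by auto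
        show ?thesis
        proof (cases "y i = z i")
          case True
          then show ?thesis using a meet_join_same[OF T yi] by (simp add: S_def)
        next
          case yz: False
          then show ?thesis using a meet_join_siblings[OF T, of "y i" "z i"] zx yx zx' False
            by (simp add: S_def)
        qed
      qed
    qed
  qed
next
  have y: "lab y" using assms(1,4) by (auto simp: lab_def outward_def)
  case (Suc D)
  \<comment> \<open>\<open>w\<close> lifts \<open>z\<close> by one edge, except where
    \<open>z i = y i\<close>: there the parent \<open>x i\<close> would no longer lie below
    \<open>y i\<close>, and the coordinate would enter \<open>S\<close>.\<close>
  define w where "w i = (if z i = x i \<or> z i = y i then z i else parent (T i) (z i))" for i
  have w: "lab w" "below x w" "\<And>i. i \<in> {1..n} \<Longrightarrow> level (T i) (w i) \<le> Suc D + level (T i) (x i)"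
    and Sw: "\<And>i. i \<in> {1..n} \<Longrightarrow> S w i = S z i"
  proof -
    show "lab w" using Suc.prems(1) parent_in[OF tree] by (auto simp: w_def lab_def)
    show "below x w" using Suc.prems(2) below_step(2)[OF _ Suc.prems(1,2)]
      by (auto simp: w_def below_def)
  next
    fix i assume i: "i \<in> {1..n}"
    note T = tree[OF i]
    have yx: "y i \<noteq> x i \<Longrightarrow> nonroot (T i) (y i) \<and> parent (T i) (y i) = x i"
      using assms(4) i by (auto simp: outward_def)
    show "level (T i) (w i) \<le> Suc D + level (T i) (x i)"
      using Suc.prems(3)[OF i] below_step(3)[OF i Suc.prems(1,2)] level_parent[OF T, of "y i"] yx
      by (cases "y i = x i") (auto simp: w_def)
    show "S w i = S z i"
    proof (cases "z i = x i \<or> z i = y i")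
      case False
      then show ?thesis using ancestor_iff[OF T, of "z i" "y i"] below_step(1)[OF i Suc.prems(1,2)]
        by (auto simp: S_def w_def)
    qed (auto simp: S_def w_def)
  qed
  let ?w' = "\<lambda>i. if S z i then if w i = x i then y i else parent (T i) (w i) else w i"
  let ?z' = "\<lambda>i. if S z i then if z i = x i then y i else parent (T i) (z i) else z i"
  have 1: "F (\<lambda>i. if S z i then x i else y i) + F ?w' \<le> F y + F w"
  proof -
    have "F (\<lambda>i. if S z i then x i else y i) = F (\<lambda>i. if S w i then x i else y i)"
      "F ?w' = F (\<lambda>i. if S w i then if w i = x i then y i else parent (T i) (w i) else w i)"
      using Sw by (auto intro!: F_cong)
    then show ?thesis using Suc.IH[OF w] by simp
  qed
  have w': "lab ?w'" using w(1) y parent_in[OF tree] by (auto simp: lab_def)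
  \<comment> \<open>Only labels at distance at most two are compared here. Adding this to the
    inequality for \<open>w\<close> cancels \<open>F w\<close> and \<open>F ?w'\<close>.\<close>
  have 2: "F w + F ?z' \<le> F ?w' + F z"
  proof (rule F_submodular[OF w' Suc.prems(1)])
    fix i assume i: "i \<in> {1..n}"
    note T = tree[OF i]
    have zi: "z i \<in> nodes (T i)" using Suc.prems(1) i by (auto simp: lab_def)
    have yx: "y i \<noteq> x i \<Longrightarrow> nonroot (T i) (y i) \<and> parent (T i) (y i) = x i"
      using assms(4) i by (auto simp: outward_def)
    note st = below_step[OF i Suc.prems(1,2)]
    show "tmeet (T i) (?w' i) (z i) = w i \<and> tjoin (T i) (?w' i) (z i) = ?z' i"
    proof (cases "S z i")
      case S: True
      then have yx': "nonroot (T i) (y i)" "parent (T i) (y i) = x i" "y i \<noteq> x i" using yx by (auto simp: S_def)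
      have zy: "z i \<noteq> y i" using S ancestor_refl[OF T zi] by (auto simp: S_def)
      show ?thesis
      proof (cases "z i = x i")
        case True
        then show ?thesis using S meet_join_parent[OF T yx'(1)] yx' by (simp add: w_def)
      next
        case False
        show ?thesis
        proof (cases "parent (T i) (z i) = x i")
          case True
          then show ?thesis using S False zy meet_join_siblings[OF T yx'(1) st(1)[OF False]] yx'
            by (simp add: w_def)
        next
          case p: False
          then have "nonroot (T i) (parent (T i) (z i))"
            using below_step(1)[OF i w(1,2)] False zy by (simp add: w_def)
          then show ?thesis using S False zy p meet_join_grandparent[OF T st(1)[OF False]]
            by (simp add: w_def)
        qed
      qed
    next
      case False
      then show ?thesis
        using meet_join_same[OF T zi] meet_join_parent[OF T, of "z i"] st(1) by (auto simp: w_def)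
    qed
  qed
  show ?case using 1 2 by simp
qed

text \<open>Let \<open>S\<close> be the coordinates where \<open>y\<close> leaves the way to
  \<open>z\<close>. Translation cannot push \<open>z\<close> below the minimum, so resetting
  \<open>y\<close> on \<open>S\<close> does not increase its value; this gives another best outward
  labeling, and leastness of \<open>y\<close> forces \<open>S\<close> to be empty.\<close>

lemma least_outward_below_minimal:
  assumes "lab x" and z: "minimal z" "below x z" and y: "outward x y"
    and ymin: "\<And>u. outward x u \<Longrightarrow> F y \<le> F u"
    and least: "\<And>u i. outward x u \<Longrightarrow> F u = F y \<Longrightarrow> i \<in> {1..n} \<Longrightarrow> y i \<noteq> x i \<Longrightarrow> u i = y i"
  shows "below y z"
proof -
  have labz: "lab z" using z by (simp add: minimal_def)
  define D where "D = Max ((\<lambda>i. level (T i) (z i)) ` {1..n})"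
  have D: "level (T i) (z i) \<le> Suc D + level (T i) (x i)" if "i \<in> {1..n}" for i
  proof -
    have "level (T i) (z i) \<le> D" unfolding D_def using that by (intro Max_ge) auto
    then show ?thesis by simp
  qed
  define S where "S i \<longleftrightarrow> y i \<noteq> x i \<and> \<not> ancestor (T i) (y i) (z i)" for i
  let ?y' = "\<lambda>i. if S i then x i else y i"
  let ?z' = "\<lambda>i. if S i then if z i = x i then y i else parent (T i) (z i) else z i"
  have *: "F ?y' + F ?z' \<le> F y + F z"
    using translation_submodular[OF assms(1) labz z(2) y D] unfolding S_def .
  have "outward x ?y'" using y by (simp add: outward_def)
  moreover have "lab ?z'"
    using labz y assms(1) parent_in[OF tree] by (auto simp: lab_def outward_def)
  then have "F z \<le> F ?z'" using z by (simp add: minimal_def)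
  ultimately have "?y' i = y i" if "i \<in> {1..n}" "y i \<noteq> x i" for i
    using least[of ?y' i] ymin[of ?y'] that * by fastforce
  then have "\<not> S i" if "i \<in> {1..n}" for i using that by (metis S_def)
  then show ?thesis using z(2) by (fastforce simp: S_def below_def)
qed

text \<open>Local optimality spreads downwards: a step at the deepest coordinates of
  \<open>z\<close> is traded for a step at \<open>x\<close>. The two resulting labelings,
  \<open>e D z\<close> next to \<open>x\<close> and the shallower \<open>lower D z\<close>, both
  have value at least \<open>F x\<close>, while their sum is at most
  \<open>F x + F z\<close>.\<close>

lemma outward_minimal_le:
  assumes "lab x" and min: "\<And>u. outward x u \<Longrightarrow> F x \<le> F u"
  shows "lab z \<Longrightarrow> below x z \<Longrightarrow> (\<And>i. i \<in> {1..n} \<Longrightarrow> level (T i) (z i) \<le> D + level (T i) (x i)) \<Longrightarrow> F x \<le> F z"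
proof (induction D arbitrary: z)
  case 0
  have "z i = x i" if "i \<in> {1..n}" for i
    using below_step(3,4)[OF that 0(1,2)] 0(3)[OF that] by force
  then have "F z = F x" by (rule F_cong)
  then show ?case by simp
next
  case (Suc D)
  define top where "top D z i \<longleftrightarrow> level (T i) (z i) = D + level (T i) (x i)" for D i and z :: "nat \<Rightarrow> 'a"
  \<comment> \<open>On coordinates of full depth, \<open>D\<close> parents above \<open>z i\<close>
    lies the child of \<open>x i\<close> towards \<open>z i\<close>; all other coordinates stay at
    \<open>x i\<close>.\<close>
  define e where "e D z i = (if top (Suc D) z i then (parent (T i) ^^ D) (z i) else x i)" for D i and z :: "nat \<Rightarrow> 'a"
  define lower where "lower D z i = (if top (Suc D) z i then parent (T i) (z i) else z i)" for D i and z :: "nat \<Rightarrow> 'a"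
  have key: "outward x (e D z) \<and> lab (lower D z) \<and> below x (lower D z) \<and>
      (\<forall>i\<in>{1..n}. level (T i) (lower D z i) \<le> D + level (T i) (x i)) \<and>
      F (e D z) + F (lower D z) \<le> F x + F z"
    if "lab z" "below x z" "\<And>i. i \<in> {1..n} \<Longrightarrow> level (T i) (z i) \<le> Suc D + level (T i) (x i)" for D z
  proof -
    have lower: "lab (lower D z)" "below x (lower D z)"
      "\<And>i. i \<in> {1..n} \<Longrightarrow> level (T i) (lower D z i) \<le> D + level (T i) (x i)"
      if z: "lab z" "below x z" and lev: "\<And>i. i \<in> {1..n} \<Longrightarrow> level (T i) (z i) \<le> Suc D + level (T i) (x i)"
      for D z
    proof -
      show "lab (lower D z)" using z(1) parent_in[OF tree] by (auto simp: lower_def lab_def)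
      show "below x (lower D z)" using z(2) below_step(2)[OF _ z]
        by (force simp: lower_def below_def top_def)
      show "level (T i) (lower D z i) \<le> D + level (T i) (x i)" if "i \<in> {1..n}" for i
        using below_step(3)[OF that z] lev[OF that] by (cases "z i = x i") (auto simp: lower_def top_def)
    qed
    have "outward x (e D z) \<and> F (e D z) + F (lower D z) \<le> F x + F z"
      using that
    proof (induction D arbitrary: z)
      case 0
      have zx: "z i \<noteq> x i \<Longrightarrow> nonroot (T i) (z i) \<and> parent (T i) (z i) = x i \<and> top (Suc 0) z i"
        "\<not> (top (Suc 0) x i)"
        if "i \<in> {1..n}" for i
        using below_step[OF that 0(1,2)] 0(3)[OF that] by (auto simp: top_def)
      have e: "e 0 z i = z i" "lower 0 z i = x i" if "i \<in> {1..n}" for i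
          using zx[OF that] by (cases "z i = x i"; auto simp: e_def lower_def top_def)+
      have "outward x (e 0 z)" using zx(1) e(1) unfolding outward_def by metis
      moreover have "F (e 0 z) = F z" "F (lower 0 z) = F x" using e by (auto intro!: F_cong)
      ultimately show ?case by simp
    next
      case (Suc D)
      \<comment> \<open>Lifting all coordinates at once lowers the depth by one and keeps the set of
        top coordinates, so \<open>e\<close> is unchanged and the inequalities for successive depths
        telescope.\<close>
      define w where "w i = (if z i = x i then z i else parent (T i) (z i))" for i
      have w: "lab w" "below x w" "\<And>i. i \<in> {1..n} \<Longrightarrow> level (T i) (w i) \<le> Suc D + level (T i) (x i)"
        and topw: "\<And>i. i \<in> {1..n} \<Longrightarrow> top (Suc D) w i = top (Suc (Suc D)) z i"
      proof -
        show "lab w" using Suc.prems(1) parent_in[OF tree] by (auto simp: w_def lab_def)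
        show "below x w" using Suc.prems(2) below_step(2)[OF _ Suc.prems(1,2)]
          by (auto simp: w_def below_def)
        fix i assume i: "i \<in> {1..n}"
        show "level (T i) (w i) \<le> Suc D + level (T i) (x i)" "top (Suc D) w i = top (Suc (Suc D)) z i"
          using Suc.prems(3)[OF i] below_step(3)[OF i Suc.prems(1,2)] by (auto simp: w_def top_def)
      qed
      have e: "e D w i = e (Suc D) z i" if "i \<in> {1..n}" for i
        using topw[OF that] by (auto simp: e_def w_def funpow_swap1 top_def)
      have 1: "F (lower D w) + F z \<ge> F w + F (lower (Suc D) z)"
      proof (rule F_submodular[OF lower(1)[OF w] Suc.prems(1)])
        fix i assume i: "i \<in> {1..n}"
        note T = tree[OF i]
        have zi: "z i \<in> nodes (T i)" using Suc.prems(1) i by (auto simp: lab_def)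
        note st = below_step[OF i Suc.prems(1,2)]
        show "tmeet (T i) (lower D w i) (z i) = w i \<and> tjoin (T i) (lower D w i) (z i) = lower (Suc D) z i"
        proof (cases "top (Suc (Suc D)) z i")
          case True
          then have zx: "z i \<noteq> x i" by (auto simp: top_def)
          have wx: "w i \<noteq> x i" using topw[OF i] True by (auto simp: top_def)
          have "nonroot (T i) (parent (T i) (z i))"
            using below_step(1)[OF i w(1,2) wx] zx by (simp add: w_def)
          then show ?thesis using True topw[OF i] zx meet_join_grandparent[OF T st(1)[OF zx]]
            by (simp add: w_def lower_def)
        next
          case False
          then show ?thesis using topw[OF i] meet_join_same[OF T zi] meet_join_parent[OF T, of "z i"] st(1)
            by (auto simp: w_def lower_def)
        qed
      qed
      have "outward x (e (Suc D) z)" using Suc.IH[OF w] e by (simp add: outward_def)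
      moreover have "F (e (Suc D) z) = F (e D w)" using e by (auto intro!: F_cong)
      ultimately show ?case using Suc.IH[OF w] 1 by simp
    qed
    then show ?thesis using lower[OF that] by blast
  qed
  have "F x \<le> F (e D z)" "F x \<le> F (lower D z)"
    using key[OF Suc.prems] min Suc.IH[of "lower D z"] by blast+
  then show ?case using key[OF Suc.prems] by linarith
qed

lemma outward_minimal_is_minimal:
  assumes x: "lab x" and "\<And>u. outward x u \<Longrightarrow> F x \<le> F u" and z: "minimal z" "below x z"
  shows "minimal x"
proof -
  define D where "D = Max ((\<lambda>i. level (T i) (z i)) ` {1..n})"
  have "level (T i) (z i) \<le> D + level (T i) (x i)" if "i \<in> {1..n}" for i
  proof -
    have "level (T i) (z i) \<le> D" unfolding D_def using that by (intro Max_ge) auto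
    then show ?thesis by simp
  qed
  then have "F x \<le> F z"
    using outward_minimal_le[OF assms(1,2), of z D] z by (auto simp: minimal_def)
  then show ?thesis using z x by (force simp: minimal_def)
qed

end

section \<open>Bisubmodular functions on sets of literals\<close>

text \<open>\<open>tt\<close> is the constant true literal, so unit facts are implications too.\<close>

locale literals =
  fixes L :: "'l set" and bar :: "'l \<Rightarrow> 'l" and tt :: 'l
  assumes finite_L: "finite L"
    and bar_in: "l \<in> L \<Longrightarrow> bar l \<in> L"
    and bar_bar: "l \<in> L \<Longrightarrow> bar (bar l) = l"
    and bar_neq: "l \<in> L \<Longrightarrow> bar l \<noteq> l"
    and tt_in: "tt \<in> L"
begin

text \<open>Contradictory pairs cancel: the second operation of bisubmodularity, with literals in
  place of signed vectors.\<close>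

definition join :: "'l set \<Rightarrow> 'l set \<Rightarrow> 'l set" where
  "join A B = {l \<in> A \<union> B. bar l \<notin> A \<union> B}"

definition ideals :: "('l \<Rightarrow> 'l \<Rightarrow> bool) \<Rightarrow> 'l set set" where
  "ideals imp = {A. A \<subseteq> L \<and> tt \<in> A \<and> (\<forall>l\<in>A. bar l \<notin> A) \<and> (\<forall>l\<in>A. \<forall>m. imp l m \<longrightarrow> m \<in> A)}"

definition least_sets :: "('l set \<Rightarrow> real) \<Rightarrow> ('l \<Rightarrow> 'l \<Rightarrow> bool) \<Rightarrow> 'l set set" where
  "least_sets f imp = {A \<in> ideals imp. \<forall>A'\<in>ideals imp. f A \<le> f A'}"

text \<open>A vector with one entry per variable, written out for both signs of the variable; sums
  of products over \<open>L\<close> therefore count every variable twice.\<close>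

definition skew :: "('l \<Rightarrow> real) \<Rightarrow> bool" where
  "skew x \<longleftrightarrow> (\<forall>l\<in>L. x (bar l) = - x l)"

lemma finite_ideals: "finite (ideals imp)"
  by (rule finite_subset[of _ "Pow L"]) (auto simp: ideals_def finite_L)

lemma ideal_finite: "A \<in> ideals imp \<Longrightarrow> finite A"
  using finite_L finite_subset by (auto simp: ideals_def)

lemma bar_inj: "l \<in> L \<Longrightarrow> m \<in> L \<Longrightarrow> bar l = bar m \<longleftrightarrow> l = m"
  by (metis bar_bar)

lemma least_sets_nonempty:
  assumes "ideals imp \<noteq> {}" shows "least_sets f imp \<noteq> {}"
proof -
  obtain A where "A \<in> ideals imp" "\<forall>A'\<in>ideals imp. f A \<le> f A'"
    using arg_min_if_finite[OF finite_ideals assms, of f] by (metis leI)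
  then show ?thesis by (auto simp: least_sets_def)
qed

text \<open>Negation flips both factors, so a literal of \<open>I\<close> and its negation
  contribute the same product.\<close>

lemma sum_skew_half:
  assumes "skew x" "skew y" "I \<subseteq> L" "\<And>l. l \<in> I \<Longrightarrow> bar l \<notin> I"
    and "\<And>l. l \<in> L \<Longrightarrow> l \<notin> I \<Longrightarrow> bar l \<notin> I \<Longrightarrow> x l * y l = 0"
  shows "(\<Sum>l\<in>L. x l * y l) = 2 * (\<Sum>l\<in>I. x l * y l)"
proof -
  have fin: "finite I" using assms(3) finite_L finite_subset by blast
  have inj: "inj_on bar I" using assms(3) by (meson bar_inj inj_onI subsetD)
  have dis: "I \<inter> bar ` I = {}" using assms(4) by auto
  have "(\<Sum>l\<in>L. x l * y l) = (\<Sum>l\<in>I \<union> bar ` I. x l * y l)"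
  proof (rule sum.mono_neutral_right[OF finite_L])
    show "I \<union> bar ` I \<subseteq> L" using assms(3) bar_in by auto
    show "\<forall>i\<in>L - (I \<union> bar ` I). x i * y i = 0"
    proof
      fix l assume l: "l \<in> L - (I \<union> bar ` I)"
      then have "bar l \<notin> I" using bar_bar by force
      then show "x l * y l = 0" using assms(5) l by auto
    qed
  qed
  also have "\<dots> = (\<Sum>l\<in>I. x l * y l) + (\<Sum>l\<in>I. x (bar l) * y (bar l))"
    using fin dis by (simp add: sum.union_disjoint sum.reindex[OF inj])
  also have "(\<Sum>l\<in>I. x (bar l) * y (bar l)) = (\<Sum>l\<in>I. x l * y l)"
    using assms(1-3) by (intro sum.cong) (auto simp: skew_def)
  finally show ?thesis by simp
qed

end

text \<open>The transitive closure of a skew-symmetric implication graph as in 2-SAT, where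
  \<open>imp_skew\<close> is contraposition. A literal that implies its own negation is thereby
  excluded from all ideals.\<close>

locale implications = literals L bar tt
  for L :: "'l set" and bar tt +
  fixes imp :: "'l \<Rightarrow> 'l \<Rightarrow> bool" and f :: "'l set \<Rightarrow> real"
  assumes imp_in: "imp l m \<Longrightarrow> l \<in> L \<and> m \<in> L"
    and imp_refl: "l \<in> L \<Longrightarrow> imp l l"
    and imp_trans: "imp l m \<Longrightarrow> imp m k \<Longrightarrow> imp l k"
    and imp_skew: "imp l m \<Longrightarrow> imp (bar m) (bar l)"
    and imp_tt: "l \<in> L \<Longrightarrow> imp l tt"
    and ideals_nonempty: "ideals imp \<noteq> {}"
    and bisubmodular: "A \<in> ideals imp \<Longrightarrow> B \<in> ideals imp \<Longrightarrow> f (A \<inter> B) + f (join A B) \<le> f A + f B"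
begin

section \<open>Closures of single literals and their union with ideals\<close>

definition cl :: "'l \<Rightarrow> 'l set" where
  "cl l = {m. imp l m}"

text \<open>These are exactly the literals that occur in some ideal, by \<open>ideal_alive\<close>
  and \<open>cl_ideal\<close>.\<close>

definition alive :: "'l \<Rightarrow> bool" where
  "alive l \<longleftrightarrow> l \<in> L \<and> \<not> imp l (bar l)"

lemma ideal_alive: "A \<in> ideals imp \<Longrightarrow> l \<in> A \<Longrightarrow> alive l"
  by (auto simp: ideals_def alive_def)

lemma alive_tt: "alive tt"
  using ideals_nonempty ideal_alive by (auto simp: ideals_def)

lemma cl_self: "l \<in> L \<Longrightarrow> l \<in> cl l"
  by (simp add: cl_def imp_refl)

lemma cl_subset: "A \<in> ideals imp \<Longrightarrow> l \<in> A \<Longrightarrow> cl l \<subseteq> A"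
  by (auto simp: ideals_def cl_def)

text \<open>If \<open>l\<close> implied both \<open>m\<close> and \<open>bar m\<close>,
  contraposition would give \<open>imp m (bar l)\<close>, and \<open>l\<close> would imply its own
  negation.\<close>

lemma cl_ideal:
  assumes "alive l" shows "cl l \<in> ideals imp"
proof -
  have "\<not> (imp l m \<and> imp l (bar m))" for m
  proof
    assume a: "imp l m \<and> imp l (bar m)"
    then have "imp m (bar l)" using imp_skew[of l "bar m"] bar_bar imp_in by metis
    then show False using a assms imp_trans by (auto simp: alive_def)
  qed
  then show ?thesis using assms imp_in imp_tt imp_trans by (fastforce simp: ideals_def cl_def alive_def)
qed

lemma cl_subset_iff: "A \<in> ideals imp \<Longrightarrow> alive l \<Longrightarrow> cl l \<subseteq> A \<longleftrightarrow> l \<in> A"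
  using cl_subset cl_self by (auto simp: alive_def)

lemma Int_ideal: "A \<in> ideals imp \<Longrightarrow> B \<in> ideals imp \<Longrightarrow> A \<inter> B \<in> ideals imp"
  by (auto simp: ideals_def)

lemma join_ideal:
  assumes A: "A \<in> ideals imp" and B: "B \<in> ideals imp"
  shows "join A B \<in> ideals imp"
proof -
  have "bar tt \<notin> A \<union> B" using assms by (auto simp: ideals_def)
  moreover have "m \<in> join A B" if l: "l \<in> join A B" and lm: "imp l m" for l m
  proof -
    have "m \<in> A \<union> B" using l lm A B by (auto simp: join_def ideals_def)
    moreover have "bar m \<notin> A \<union> B"
      using l imp_skew[OF lm] A B by (auto simp: join_def ideals_def)
    ultimately show ?thesis by (simp add: join_def)
  qed
  ultimately show ?thesis using A B unfolding ideals_def join_def by blast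
qed

text \<open>A clash between \<open>m\<close> in \<open>cl l\<close> and \<open>bar m\<close> in
  \<open>I\<close> would, by contraposition, bring \<open>bar l\<close> into
  \<open>I\<close>.\<close>

lemma extend_ideal:
  assumes I: "I \<in> ideals imp" and l: "alive l" "bar l \<notin> I"
  shows "I \<union> cl l \<in> ideals imp" "join I (cl l) = I \<union> cl l"
proof -
  have c: "cl l \<in> ideals imp" by (rule cl_ideal[OF l(1)])
  have "bar m \<notin> I" if "m \<in> cl l" for m
    using that imp_skew[of l m] I l(2) by (auto simp: cl_def ideals_def)
  moreover from this have "bar m \<notin> cl l" if "m \<in> I" for m
    using that I bar_bar by (metis (no_types, lifting) ideals_def mem_Collect_eq subsetD)
  ultimately have con: "\<forall>m \<in> I \<union> cl l. bar m \<notin> I \<union> cl l" using I c by (auto simp: ideals_def)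
  then show "I \<union> cl l \<in> ideals imp" using I c by (auto simp: ideals_def)
  show "join I (cl l) = I \<union> cl l" using con by (auto simp: join_def)
qed

section \<open>Greedy chains and the vectors they produce\<close>

definition candidate :: "'l set \<Rightarrow> 'l \<Rightarrow> bool" where
  "candidate I l \<longleftrightarrow> alive l \<and> l \<notin> I \<and> bar l \<notin> I"

text \<open>Ties are broken towards strictly implied literals, so that the closure of a best
  candidate adds nothing but literals equivalent to it.\<close>

definition better :: "('l \<Rightarrow> real) \<Rightarrow> 'l \<Rightarrow> 'l \<Rightarrow> bool" where
  "better p m l \<longleftrightarrow> p l < p m \<or> p l = p m \<and> imp l m \<and> \<not> imp m l"

text \<open>The greedy algorithm for bisubmodular functions, run on equivalence classes of literals.
  The gain of a whole class is booked on one representative and, negated, on its negation; the other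
  members keep the entry zero.\<close>

inductive chain :: "('l \<Rightarrow> real) \<Rightarrow> 'l set \<Rightarrow> 'l set \<Rightarrow> ('l \<Rightarrow> real) \<Rightarrow> bool"
  for p :: "'l \<Rightarrow> real" and B :: "'l set" where
  base: "chain p B B (\<lambda>_. 0)"
| step: "chain p B I b \<Longrightarrow> candidate I l \<Longrightarrow> (\<And>m. candidate I m \<Longrightarrow> \<not> better p m l) \<Longrightarrow>
    chain p B (I \<union> cl l) (b(l := f (I \<union> cl l) - f I, bar l := f I - f (I \<union> cl l)))"

text \<open>The bisubmodular polyhedron of \<open>f\<close>, contracted to the sets above
  \<open>B\<close>.\<close>

definition valid :: "'l set \<Rightarrow> ('l \<Rightarrow> real) \<Rightarrow> bool" where
  "valid B z \<longleftrightarrow> skew z \<and> (\<forall>l\<in>B. z l = 0) \<and> (\<forall>A\<in>ideals imp. B \<subseteq> A \<longrightarrow> sum z A \<le> f A - f B)"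

definition monotone_weight :: "'l set \<Rightarrow> ('l \<Rightarrow> real) \<Rightarrow> bool" where
  "monotone_weight B p \<longleftrightarrow> (\<forall>l. p l \<ge> 0) \<and> (\<forall>l m. imp l m \<longrightarrow> l \<notin> B \<longrightarrow> m \<notin> B \<longrightarrow> p l \<le> p m)"

text \<open>Monotonicity gives \<open>p l \<le> p m\<close>, optimality of \<open>l\<close> the
  converse, and then the tie-break rule gives \<open>imp m l\<close>.\<close>

lemma best_candidate_class:
  assumes p: "monotone_weight B p" and I: "I \<in> ideals imp" "B \<subseteq> I"
    and l: "candidate I l" "\<And>m. candidate I m \<Longrightarrow> \<not> better p m l"
    and m: "imp l m" "m \<notin> I"
  shows "candidate I m" "p m = p l" "imp m l"
proof -
  have "bar m \<notin> I" using imp_skew[OF m(1)] I(1) l(1) by (auto simp: ideals_def candidate_def)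
  moreover have "alive m"
    using m(1) l(1) imp_skew[OF m(1)] imp_trans imp_in unfolding alive_def candidate_def by blast
  ultimately show c: "candidate I m" using m(2) by (simp add: candidate_def)
  have "m \<notin> B" "l \<notin> B" using m(2) l(1) I(2) by (auto simp: candidate_def)
  then have "p l \<le> p m" using p m(1) by (simp add: monotone_weight_def)
  then show "p m = p l" "imp m l" using l(2)[OF c] m(1) by (auto simp: better_def)
qed

lemma chain_ideal: "chain p B I b \<Longrightarrow> B \<in> ideals imp \<Longrightarrow> I \<in> ideals imp \<and> B \<subseteq> I"
  by (induction rule: chain.induct) (auto simp: candidate_def extend_ideal)

lemma chain_skew:
  "chain p B I b \<Longrightarrow> B \<in> ideals imp \<Longrightarrow>
    skew b \<and> (\<forall>l\<in>B. b l = 0) \<and> (\<forall>l. l \<notin> I \<and> bar l \<notin> I \<longrightarrow> l \<in> L \<longrightarrow> b l = 0)"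
proof (induction rule: chain.induct)
  case base
  then show ?case by (simp add: skew_def)
next
  case (step I b l)
  have I: "I \<in> ideals imp" "B \<subseteq> I" using chain_ideal[OF step(1)] step(5) by auto
  have l: "l \<in> L" "l \<notin> I" "bar l \<notin> I" using step(2) by (auto simp: candidate_def alive_def)
  have sk: "skew b" using step by blast
  have "skew (b(l := f (I \<union> cl l) - f I, bar l := f I - f (I \<union> cl l)))"
    unfolding skew_def
  proof
    fix m assume m: "m \<in> L"
    consider "m = l" | "m = bar l" | "m \<noteq> l" "m \<noteq> bar l" by blast
    then show "(b(l := f (I \<union> cl l) - f I, bar l := f I - f (I \<union> cl l))) (bar m) =
        - (b(l := f (I \<union> cl l) - f I, bar l := f I - f (I \<union> cl l))) m"
    proof cases
      case 3
      then have "bar m \<noteq> bar l" "bar m \<noteq> l" using m l bar_inj bar_bar by (metis)+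
      then show ?thesis using 3 sk m by (simp add: skew_def)
    qed (use l bar_neq[OF l(1)] bar_bar[OF l(1)] in auto)
  qed
  moreover have "l \<in> cl l" by (rule cl_self[OF l(1)])
  moreover have "\<forall>m\<in>B. m \<noteq> l \<and> m \<noteq> bar l" using I l by auto
  ultimately show ?case using step.IH[OF step(5)] l bar_bar[OF l(1)] by (auto simp del: fun_upd_apply) auto
qed

text \<open>An ideal contains the new class entirely or not at all, because its members are
  equivalent. The second alternative provides the sets to which bisubmodularity is applied in
  \<open>chain_lower\<close>.\<close>

lemma cl_inter_cases:
  assumes p: "monotone_weight B p" and I: "I \<in> ideals imp" "B \<subseteq> I"
    and l: "candidate I l" "\<And>m. candidate I m \<Longrightarrow> \<not> better p m l"
    and A: "A \<in> ideals imp"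
  shows "A \<inter> (I \<union> cl l) = A \<inter> I \<and> l \<notin> A \<or>
    l \<in> A \<and> (A \<inter> (I \<union> cl l)) \<inter> I = A \<inter> I \<and> join (A \<inter> (I \<union> cl l)) I = I \<union> cl l"
proof (cases "l \<in> A")
  case True
  then have "cl l \<subseteq> A" using cl_subset[OF A] by blast
  then have "(A \<inter> (I \<union> cl l)) \<union> I = I \<union> cl l" by blast
  then have "join (A \<inter> (I \<union> cl l)) I = join I (cl l)" unfolding join_def by (simp add: Un_commute)
  moreover have "join I (cl l) = I \<union> cl l"
    using l(1) by (intro extend_ideal I) (auto simp: candidate_def)
  ultimately show ?thesis using True by auto
next
  case False
  have "m \<in> I" if "m \<in> cl l" "m \<in> A" for m
  proof (rule ccontr)
    assume "m \<notin> I"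
    then have "imp m l" using best_candidate_class(3)[OF p I l] that by (simp add: cl_def)
    then show False using that A False by (auto simp: ideals_def)
  qed
  then show ?thesis using False by blast
qed

lemma sum_chain_step:
  assumes "A \<subseteq> L" "finite A" "bar l \<notin> A" "l \<in> A" "b l = 0"
  shows "sum (b(l := d, bar l := e)) A = sum b A + (d::real)"
proof -
  have "sum (b(l := d, bar l := e)) A = sum (\<lambda>m. b m + (if m = l then d else 0)) A"
    using assms by (intro sum.cong) auto
  then show ?thesis using assms(2,4) by (simp add: sum.distrib)
qed

lemma sum_chain_step':
  assumes "bar l \<notin> A" "l \<notin> A"
  shows "sum (b(l := d, bar l := e)) A = sum b (A :: 'l set)"
  using assms by (intro sum.cong) auto

text \<open>Diminishing returns: adding a class to \<open>A \<inter> I\<close> raises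
  \<open>f\<close> by at least as much as adding it to \<open>I\<close>, and \<open>b\<close>
  records the latter amount.\<close>

lemma chain_lower:
  assumes p: "monotone_weight B p" and B: "B \<in> ideals imp"
  shows "chain p B I b \<Longrightarrow> sum b I = f I - f B \<and>
    (\<forall>A\<in>ideals imp. B \<subseteq> A \<longrightarrow> sum b (A \<inter> I) \<le> f (A \<inter> I) - f B)"
proof (induction rule: chain.induct)
  case base
  then show ?case by (auto simp: Int_absorb1)
next
  case (step I b l)
  have I: "I \<in> ideals imp" "B \<subseteq> I" using chain_ideal[OF step(1) B] by auto
  have l: "l \<in> L" "l \<notin> I" "bar l \<notin> I" using step(2) by (auto simp: candidate_def alive_def)
  let ?I = "I \<union> cl l" let ?b = "b(l := f ?I - f I, bar l := f I - f ?I)"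
  have I': "?I \<in> ideals imp" using extend_ideal(1)[OF I(1)] step(2) by (simp add: candidate_def)
  have b0: "b m = 0" if "m \<in> ?I - I" for m
    using chain_skew[OF step(1) B] that I' I(1) bar_bar best_candidate_class(1)[OF p I step(2,3), of m]
    by (auto simp: candidate_def alive_def cl_def)
  have key: "sum ?b (A \<inter> ?I) = sum b (A \<inter> I) + (if l \<in> A then f ?I - f I else 0)" if A: "A \<in> ideals imp" for A
  proof -
    have fin: "finite (A \<inter> ?I)" using ideal_finite[OF A] by blast
    have bl: "bar l \<notin> A \<inter> ?I" using I' cl_self[OF l(1)] by (auto simp: ideals_def)
    have "sum b (A \<inter> ?I) = sum b (A \<inter> I)"
      by (rule sum.mono_neutral_right) (use fin b0 in auto)
    moreover have "b l = 0" using b0 l cl_self by blast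
    ultimately show ?thesis
      using sum_chain_step[OF _ fin bl, of b "f ?I - f I" "f I - f ?I"]
        sum_chain_step'[OF bl, of b "f ?I - f I" "f I - f ?I"] A cl_self[OF l(1)]
      by (auto simp: ideals_def)
  qed
  have "sum ?b ?I = f ?I - f B"
    using key[OF I'] step.IH cl_self[OF l(1)] by (simp add: Int_absorb1)
  moreover have "sum ?b (A \<inter> ?I) \<le> f (A \<inter> ?I) - f B" if A: "A \<in> ideals imp" "B \<subseteq> A" for A
  proof -
    have IH: "sum b (A \<inter> I) \<le> f (A \<inter> I) - f B" using step.IH A by blast
    show ?thesis
      using cl_inter_cases[OF p I step(2,3) A(1)]
    proof
      assume "A \<inter> ?I = A \<inter> I \<and> l \<notin> A"
      then show ?thesis using key[OF A(1)] IH by simp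
    next
      assume a: "l \<in> A \<and> (A \<inter> ?I) \<inter> I = A \<inter> I \<and> join (A \<inter> ?I) I = ?I"
      then have "f (A \<inter> I) + f ?I \<le> f (A \<inter> ?I) + f I"
        using bisubmodular[OF Int_ideal[OF A(1) I'] I(1)] by simp
      then show ?thesis using key[OF A(1)] IH a by simp
    qed
  qed
  ultimately show ?case by blast
qed

text \<open>\<open>A\<close> is compared with \<open>A \<inter> I\<close> and
  \<open>join A I\<close>. Maximality puts \<open>join A I\<close> inside \<open>I\<close>, where
  \<open>chain_lower\<close> applies; by skewness the literals of \<open>A - I\<close> contribute
  the negative of what \<open>I\<close> loses in the join.\<close>

lemma chain_valid:
  assumes p: "monotone_weight B p" and B: "B \<in> ideals imp" and ch: "chain p B I b"
    and max: "\<And>l. \<not> candidate I l"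
  shows "valid B b"
proof -
  have I: "I \<in> ideals imp" "B \<subseteq> I" using chain_ideal[OF ch B] by auto
  have sk: "skew b" "\<forall>l\<in>B. b l = 0" using chain_skew[OF ch B] by auto
  note low = chain_lower[OF p B ch]
  have "sum b A \<le> f A - f B" if A: "A \<in> ideals imp" "B \<subseteq> A" for A
  proof -
    let ?J = "join A I"
    have J: "?J \<in> ideals imp" by (rule join_ideal[OF A(1) I(1)])
    have AI: "bar l \<in> I" if "l \<in> A" "l \<notin> I" for l
      using max[of l] ideal_alive[OF A(1) that(1)] that(2) by (simp add: candidate_def)
    have JI: "?J \<subseteq> I" using AI by (auto simp: join_def)
    have BJ: "B \<subseteq> ?J" using A I by (auto simp: join_def ideals_def)
    have "sum b ?J \<le> f ?J - f B" using low J BJ JI by (metis Int_absorb2)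
    moreover have "sum b (A \<inter> I) \<le> f (A \<inter> I) - f B" using low A by blast
    moreover have "f (A \<inter> I) + f ?J \<le> f A + f I" by (rule bisubmodular[OF A(1) I(1)])
    moreover have "sum b I = f I - f B" using low by blast
    moreover have "sum b A = sum b (A \<inter> I) + (sum b ?J - sum b I)"
    proof -
      have 1: "sum b A = sum b (A \<inter> I) + sum b (A - I)"
        using ideal_finite[OF A(1)] by (metis sum.Int_Diff)
      have eq: "I - ?J = bar ` (A - I)"
      proof
        show "I - ?J \<subseteq> bar ` (A - I)"
        proof
          fix l assume l: "l \<in> I - ?J"
          then have lL: "l \<in> L" using I(1) by (auto simp: ideals_def)
          have "bar l \<in> A - I" using l I(1) by (auto simp: join_def ideals_def)
          then show "l \<in> bar ` (A - I)" using bar_bar[OF lL] by (metis image_eqI)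
        qed
        show "bar ` (A - I) \<subseteq> I - ?J"
        proof
          fix l assume "l \<in> bar ` (A - I)"
          then obtain m where m: "m \<in> A" "m \<notin> I" "l = bar m" by blast
          then have "m \<in> L" using A by (auto simp: ideals_def)
          then have "bar l = m" using bar_bar m by simp
          then show "l \<in> I - ?J" using AI m by (auto simp: join_def)
        qed
      qed
      have "sum b I = sum b ?J + sum b (I - ?J)"
        using ideal_finite[OF I(1)] JI by (metis add.commute sum.subset_diff)
      also have "sum b (I - ?J) = (\<Sum>l\<in>A - I. b (bar l))"
        unfolding eq using A(1) by (intro sum.reindex[unfolded o_def] inj_onI) (auto simp: ideals_def bar_inj subset_iff)
      also have "\<dots> = - sum b (A - I)"
        using sk(1) A(1) unfolding sum_negf[symmetric] by (intro sum.cong) (auto simp: skew_def ideals_def)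
      finally show ?thesis using 1 by simp
    qed
    ultimately show ?thesis by simp
  qed
  then show ?thesis using sk by (simp add: valid_def)
qed

text \<open>For the second clause: when the class of \<open>m\<close> is added, \<open>bar m\<close>
  is a candidate as well if it is alive, so a zero weight of \<open>m\<close> caps the weight of
  \<open>bar m\<close>.\<close>

lemma chain_order:
  assumes p: "monotone_weight B p" and B: "B \<in> ideals imp"
  shows "chain p B I b \<Longrightarrow> (\<forall>m\<in>I - B. (\<forall>l. candidate I l \<longrightarrow> p l \<le> p m) \<and>
    (p m = 0 \<longrightarrow> alive (bar m) \<longrightarrow> p (bar m) = 0))"
proof (induction rule: chain.induct)
  case base
  then show ?case by simp
next
  case (step I b l)
  have I: "I \<in> ideals imp" "B \<subseteq> I" using chain_ideal[OF step(1) B] by auto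
  have cand: "candidate I k" if "candidate (I \<union> cl l) k" for k using that by (auto simp: candidate_def)
  have best: "p k \<le> p l" if "candidate I k" for k using step(3)[OF that] by (auto simp: better_def)
  show ?case
  proof
    fix m assume m: "m \<in> I \<union> cl l - B"
    show "(\<forall>k. candidate (I \<union> cl l) k \<longrightarrow> p k \<le> p m) \<and> (p m = 0 \<longrightarrow> alive (bar m) \<longrightarrow> p (bar m) = 0)"
    proof (cases "m \<in> I")
      case True
      then show ?thesis using step.IH m cand by blast
    next
      case False
      then have lm: "imp l m" using m by (auto simp: cl_def)
      note c = best_candidate_class[OF p I step(2,3) lm False]
      have "p (bar m) = 0" if "p m = 0" "alive (bar m)"
      proof -
        have "bar (bar m) = m" using c(1) bar_bar by (auto simp: candidate_def alive_def)
        then have "candidate I (bar m)" using c(1) that by (auto simp: candidate_def)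
        then have "p (bar m) \<le> 0" using best c(2) that by fastforce
        then show ?thesis using p by (meson monotone_weight_def order_antisym)
      qed
      then show ?thesis using c(2) best cand by auto
    qed
  qed
qed

text \<open>Abel summation, made inductive by the threshold \<open>t\<close>. The hypothesis is used
  at \<open>p l\<close>, the weight of the class added last, and lowering the threshold from there
  to \<open>t\<close> adds a nonnegative multiple of \<open>sum b - sum y\<close>. Only upper bounds
  are asked of \<open>y\<close>, since it will be a truncated vector that is not skew.\<close>

lemma chain_greedy:
  assumes p: "monotone_weight B p" and B: "B \<in> ideals imp"
    and y: "\<forall>l\<in>B. y l = 0" "\<And>J. J \<in> ideals imp \<Longrightarrow> B \<subseteq> J \<Longrightarrow> sum y J \<le> f J - f B"
  shows "chain p B I b \<Longrightarrow> (\<forall>m\<in>I - B. t \<le> p m) \<Longrightarrow> 0 \<le> (\<Sum>m\<in>I. (p m - t) * (b m - y m))"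
proof (induction arbitrary: t rule: chain.induct)
  case base
  then show ?case using y by (simp add: sum_nonneg)
next
  case (step I b l)
  have I: "I \<in> ideals imp" "B \<subseteq> I" using chain_ideal[OF step(1) B] by auto
  let ?I = "I \<union> cl l" let ?b = "b(l := f ?I - f I, bar l := f I - f ?I)"
  have l: "l \<in> L" "l \<notin> I" "bar l \<notin> I" using step(2) by (auto simp: candidate_def alive_def)
  have ch: "chain p B ?I ?b" by (rule chain.step[OF step(1-3)])
  have I': "?I \<in> ideals imp" "B \<subseteq> ?I" using chain_ideal[OF ch B] by auto
  have fin: "finite ?I" using ideal_finite[OF I'(1)] .
  have "0 \<le> (\<Sum>m\<in>I. (p m - p l) * (b m - y m))"
    using chain_order[OF p B step(1)] step(2) by (intro step.IH) blast
  also have "\<dots> = (\<Sum>m\<in>I. (p m - p l) * (?b m - y m))"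
    using l by (intro sum.cong) auto
  also have "\<dots> = (\<Sum>m\<in>?I. (p m - p l) * (?b m - y m))"
    using fin best_candidate_class(2)[OF p I step(2,3)]
    by (intro sum.mono_neutral_left) (auto simp: cl_def)
  also have "\<dots> = (\<Sum>m\<in>?I. (p m - t) * (?b m - y m)) - (p l - t) * (\<Sum>m\<in>?I. ?b m - y m)"
    unfolding sum_distrib_left sum_subtractf[symmetric] by (intro sum.cong) (auto simp: algebra_simps)
  also have "\<dots> \<le> (\<Sum>m\<in>?I. (p m - t) * (?b m - y m))"
  proof -
    have "l \<in> ?I - B" using l I cl_self by auto
    then have "t \<le> p l" using step.prems by blast
    moreover have "(\<Sum>m\<in>?I. ?b m - y m) \<ge> 0"
      using chain_lower[OF p B ch] y(2)[OF I'] by (simp add: sum_subtractf)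
    ultimately show ?thesis by simp
  qed
  finally show ?case .
qed

text \<open>\<open>u\<close> has to dominate the closures \<open>cl l\<close> only, which can be
  queried one by one. Bisubmodularity bounds an increase by
  \<open>f (cl l) - f (I \<inter> cl l)\<close>, and a decrease is bounded because the increases
  made before it were.\<close>

lemma chain_bound:
  fixes u lo :: real
  assumes p: "monotone_weight B p" and B: "B \<in> ideals imp"
    and u: "\<And>l. alive l \<Longrightarrow> f (cl l) \<le> u" "f B \<le> u" and lo: "\<And>A. A \<in> ideals imp \<Longrightarrow> lo \<le> f A"
  shows "chain p B I b \<Longrightarrow> f I \<le> u + card I * (u - lo) \<and> (\<forall>l\<in>L. \<bar>b l\<bar> \<le> (card L + 1) * (u - lo))"
proof (induction rule: chain.induct)
  case base
  have "lo \<le> u" using lo[OF B] u(2) by simp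
  then show ?case using u by (simp add: mult_nonneg_nonneg add_increasing2)
next
  case (step I b l)
  have I: "I \<in> ideals imp" "B \<subseteq> I" using chain_ideal[OF step(1) B] by auto
  let ?I = "I \<union> cl l"
  have l: "l \<in> L" "l \<notin> I" "bar l \<notin> I" "alive l" using step(2) by (auto simp: candidate_def alive_def)
  note J = extend_ideal[OF I(1) l(4,3)]
  have w: "lo \<le> u" using lo[OF B] u(2) by simp
  have c: "card I + 1 \<le> card ?I"
    using psubset_card_mono[OF ideal_finite[OF J(1)], of I] l(2) cl_self[OF l(1)] by fastforce
  have cI: "card I \<le> card L" using I finite_L by (auto simp: ideals_def card_mono)
  have "f (I \<inter> cl l) + f ?I \<le> f I + f (cl l)"
    using bisubmodular[OF I(1) cl_ideal[OF l(4)]] J(2) by simp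
  then have up: "f ?I - f I \<le> u - lo" using lo[OF Int_ideal[OF I(1) cl_ideal[OF l(4)]]] u(1)[OF l(4)] by simp
  have fI: "f I \<le> u + card I * (u - lo)" using step.IH by blast
  have "f ?I \<le> u + (card I + 1) * (u - lo)" using up fI by (simp add: algebra_simps)
  also have "\<dots> \<le> u + card ?I * (u - lo)" using c w by (intro add_mono mult_right_mono) auto
  finally have 1: "f ?I \<le> u + card ?I * (u - lo)" .
  have "card I * (u - lo) \<le> card L * (u - lo)" using cI w by (intro mult_right_mono) auto
  then have "f I - f ?I \<le> (card L + 1) * (u - lo)" using fI lo[OF J(1)] by (simp add: algebra_simps)
  moreover have "1 * (u - lo) \<le> (card L + 1) * (u - lo)" using w by (intro mult_right_mono) auto
  ultimately have "\<bar>f ?I - f I\<bar> \<le> (card L + 1) * (u - lo)"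
    using up unfolding mult_1 by (intro abs_leI) auto
  then show ?case using 1 step.IH by (auto simp: abs_minus_commute)
qed

end

context literals begin

section \<open>Small Frank-Wolfe gaps fix literals\<close>

text \<open>A recession direction of the polyhedron: if \<open>k\<close> implies
  \<open>mi k\<close>, its sum over any ideal is at most zero.\<close>

definition arc_vector :: "('l \<Rightarrow> 'l) \<Rightarrow> 'l \<Rightarrow> 'l \<Rightarrow> real" where
  "arc_vector mi k l = of_bool (l = k) - of_bool (l = bar k) - of_bool (l = mi k) + of_bool (l = bar (mi k))"

definition flow :: "('l \<Rightarrow> real) \<Rightarrow> ('l \<Rightarrow> 'l) \<Rightarrow> real \<Rightarrow> 'l \<Rightarrow> real" where
  "flow z mi K l = (\<Sum>k\<in>L. if z k < 0 then K * arc_vector mi k l else 0)"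

end

context implications begin

text \<open>\<open>mi l\<close> is a bottleneck: among the literals that enter together with
  \<open>l\<close> it has the largest \<open>z\<close>, and thus limits the weight that
  \<open>l\<close> may carry. Literals of \<open>B\<close> are left out because they are present
  anyway.\<close>

definition blocking :: "'l set \<Rightarrow> ('l \<Rightarrow> real) \<Rightarrow> ('l \<Rightarrow> 'l) \<Rightarrow> bool" where
  "blocking B z mi \<longleftrightarrow> (\<forall>l\<in>L. imp l (mi l) \<and> (mi l = l \<or> mi l \<notin> B) \<and> z l \<le> z (mi l) \<and>
     (\<forall>m. imp l m \<longrightarrow> m \<notin> B \<longrightarrow> z m \<le> z (mi l)))"

text \<open>Outside \<open>B\<close> this is the pointwise largest monotone function below
  \<open>max 0 (- z)\<close>.\<close>

definition weight :: "('l \<Rightarrow> real) \<Rightarrow> ('l \<Rightarrow> 'l) \<Rightarrow> 'l \<Rightarrow> real" where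
  "weight z mi l = max 0 (- z (mi l))"

lemma monotone_weight:
  assumes "blocking B z mi" shows "monotone_weight B (weight z mi)"
proof -
  have "weight z mi l \<le> weight z mi m" if "imp l m" "l \<notin> B" "m \<notin> B" for l m
  proof -
    have "m \<in> L" using imp_in[OF that(1)] by simp
    then have m: "imp m (mi m)" "mi m \<notin> B" using assms that(3) unfolding blocking_def by metis+
    then have "z (mi m) \<le> z (mi l)" using assms imp_in[OF that(1)] imp_trans[OF that(1) m(1)]
      by (auto simp: blocking_def)
    then show ?thesis by (auto simp: weight_def)
  qed
  then show ?thesis by (auto simp: monotone_weight_def weight_def)
qed

lemma valid_convex:
  assumes "valid B z" "valid B q" "0 \<le> t" "t \<le> 1"
  shows "valid B (\<lambda>l. z l + t * (q l - z l))"
proof -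
  have "(\<Sum>l\<in>A. z l + t * (q l - z l)) \<le> f A - f B" if "A \<in> ideals imp" "B \<subseteq> A" for A
  proof -
    have "(\<Sum>l\<in>A. z l + t * (q l - z l)) = (1 - t) * sum z A + t * sum q A"
      unfolding sum_distrib_left sum.distrib[symmetric] by (intro sum.cong) (auto simp: algebra_simps)
    also have "\<dots> \<le> (1 - t) * (f A - f B) + t * (f A - f B)"
      using assms that by (intro add_mono mult_left_mono) (auto simp: valid_def)
    finally show ?thesis by (simp add: algebra_simps)
  qed
  then show ?thesis using assms by (auto simp: valid_def skew_def algebra_simps)
qed

lemma flow_skew:
  assumes "blocking B z mi" shows "skew (flow z mi K)"
proof -
  have "flow z mi K (bar l) = - flow z mi K l" if l: "l \<in> L" for l
  proof -
    have *: "(bar l = k \<longleftrightarrow> l = bar k) \<and> (bar l = bar k \<longleftrightarrow> l = k)" if "k \<in> L" for k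
      using that l bar_bar by metis
    have "arc_vector mi k (bar l) = - arc_vector mi k l" if "k \<in> L" for k
    proof -
      have "mi k \<in> L" using assms that imp_in by (auto simp: blocking_def)
      then show ?thesis unfolding arc_vector_def using *[OF that] *[of "mi k"] by simp
    qed
    then show ?thesis unfolding flow_def sum_negf[symmetric]
      by (intro sum.cong) auto
  qed
  then show ?thesis by (simp add: skew_def)
qed

text \<open>An ideal with \<open>k\<close> contains \<open>mi k\<close>, and one with
  \<open>bar (mi k)\<close> contains \<open>bar k\<close>, so no arc raises a sum over an ideal. No
  arc touches \<open>B\<close>, since \<open>z\<close> vanishes on \<open>B\<close> and on the
  negations of its literals.\<close>

lemma valid_add_flow:
  assumes B: "B \<in> ideals imp" and z: "valid B z" and b: "valid B b" and mi: "blocking B z mi" and K: "K \<ge> 0"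
  shows "valid B (\<lambda>l. b l + flow z mi K l)"
proof -
  have zB: "z l = 0" "z (bar l) = 0" if "l \<in> B" for l
  proof -
    have "skew z" "\<forall>l\<in>B. z l = 0" "l \<in> L" using z B that by (auto simp: valid_def ideals_def)
    then show "z l = 0" "z (bar l) = 0" using that by (simp_all add: skew_def)
  qed
  have mi': "imp k (mi k)" "mi k = k \<or> mi k \<notin> B" "mi k \<in> L" if "k \<in> L" for k
    using mi that imp_in by (auto simp: blocking_def)
  have f0: "flow z mi K l = 0" if l: "l \<in> B" for l
  proof -
    have "arc_vector mi k l = 0" if k: "k \<in> L" "z k < 0" for k
    proof -
      have 1: "l \<noteq> k" using zB(1)[OF l] k by auto
      have 2: "l \<noteq> bar k"
      proof
        assume "l = bar k"
        then show False using zB(2)[OF l] bar_bar[OF k(1)] k by simp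
      qed
      have 3: "l \<noteq> mi k" using mi'(2)[OF k(1)] 1 l by auto
      have "l \<noteq> bar (mi k)"
      proof
        assume "l = bar (mi k)"
        then have "imp l (bar k)" using imp_skew[OF mi'(1)[OF k(1)]] by simp
        then have "bar k \<in> B" using B l by (auto simp: ideals_def)
        then show False using zB(2)[of "bar k"] bar_bar[OF k(1)] k by simp
      qed
      then show ?thesis using 1 2 3 by (simp add: arc_vector_def)
    qed
    then show ?thesis unfolding flow_def by (intro sum.neutral) auto
  qed
  have flow_le: "sum (flow z mi K) A \<le> 0" if A: "A \<in> ideals imp" for A
  proof -
    have AL: "finite A" using A ideal_finite by auto
    have "sum (flow z mi K) A = (\<Sum>k\<in>L. \<Sum>l\<in>A. if z k < 0 then K * arc_vector mi k l else 0)"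
      unfolding flow_def by (rule sum.swap)
    also have "\<dots> \<le> 0"
    proof (rule sum_nonpos)
      fix k assume k: "k \<in> L"
      have "sum (arc_vector mi k) A
        = of_bool (k \<in> A) - of_bool (bar k \<in> A) - of_bool (mi k \<in> A) + of_bool (bar (mi k) \<in> A)"
        unfolding arc_vector_def using AL by (simp add: sum.distrib sum_subtractf of_bool_def)
      also have "\<dots> \<le> 0"
      proof -
        have "k \<in> A \<Longrightarrow> mi k \<in> A" "bar (mi k) \<in> A \<Longrightarrow> bar k \<in> A" "mi k \<in> A \<Longrightarrow> bar (mi k) \<notin> A"
          using mi'(1)[OF k] imp_skew[OF mi'(1)[OF k]] A unfolding ideals_def by blast+
        then show ?thesis by (cases "k \<in> A"; cases "mi k \<in> A"; cases "bar k \<in> A") auto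
      qed
      finally have "K * sum (arc_vector mi k) A \<le> 0" using K by (simp add: mult_nonneg_nonpos)
      then show "(\<Sum>l\<in>A. if z k < 0 then K * arc_vector mi k l else 0) \<le> 0"
        by (cases "z k < 0") (simp_all add: sum_distrib_left)
    qed
    finally show ?thesis .
  qed
  have "(\<Sum>l\<in>A. b l + flow z mi K l) \<le> f A - f B" if "A \<in> ideals imp" "B \<subseteq> A" for A
  proof -
    have "sum b A \<le> f A - f B" using that b by (simp add: valid_def)
    moreover have "sum (flow z mi K) A \<le> 0" by (rule flow_le[OF that(1)])
    ultimately show ?thesis by (simp add: sum.distrib)
  qed
  then show ?thesis using b f0 flow_skew[OF mi, of K] by (auto simp: valid_def skew_def)
qed

lemma flow_bound:
  assumes "K \<ge> 0" shows "\<bar>flow z mi K l\<bar> \<le> 2 * K * card L"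
proof -
  have "\<bar>of_bool a - of_bool b - of_bool c + of_bool d\<bar> \<le> (2::real)" for a b c d
    by (cases a; cases b; cases c; cases d) auto
  then have 1: "\<bar>arc_vector mi k l\<bar> \<le> 2" for k unfolding arc_vector_def .
  have "\<bar>if z k < 0 then K * arc_vector mi k l else 0\<bar> \<le> 2 * K" for k
    using assms mult_left_mono[OF 1 assms, of k] by (simp add: abs_mult)
  then have "(\<Sum>k\<in>L. \<bar>if z k < 0 then K * arc_vector mi k l else 0\<bar>) \<le> (\<Sum>k\<in>L. 2 * K)"
    by (intro sum_mono)
  then have "\<bar>flow z mi K l\<bar> \<le> (\<Sum>k\<in>L. 2 * K)"
    unfolding flow_def by (rule order_trans[OF sum_abs])
  then show ?thesis by (simp add: mult_ac)
qed

text \<open>Each arc consists of two skew pairs, whence the factor two.\<close>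

lemma sum_flow:
  assumes z: "skew z" and mi: "blocking B z mi"
  shows "(\<Sum>l\<in>L. z l * flow z mi K l) = 2 * K * (\<Sum>k\<in>L. if z k < 0 then z k - z (mi k) else 0)"
proof -
  have "(\<Sum>l\<in>L. z l * flow z mi K l) = (\<Sum>l\<in>L. \<Sum>k\<in>L. z l * (if z k < 0 then K * arc_vector mi k l else 0))"
    unfolding flow_def sum_distrib_left ..
  also have "\<dots> = (\<Sum>k\<in>L. \<Sum>l\<in>L. z l * (if z k < 0 then K * arc_vector mi k l else 0))"
    by (rule sum.swap)
  also have "\<dots> = (\<Sum>k\<in>L. 2 * K * (if z k < 0 then z k - z (mi k) else 0))"
  proof (rule sum.cong[OF refl])
    fix k assume k: "k \<in> L"
    have mk: "mi k \<in> L" using mi k imp_in by (auto simp: blocking_def)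
    have *: "(\<Sum>l\<in>L. z l * of_bool (l = m)) = z m" if "m \<in> L" for m
    proof -
      have "(\<Sum>l\<in>L. z l * of_bool (l = m)) = (\<Sum>l\<in>L. if l = m then z l else 0)"
        by (intro sum.cong) auto
      then show ?thesis using that finite_L by simp
    qed
    have "(\<Sum>l\<in>L. z l * arc_vector mi k l) = z k - z (bar k) - z (mi k) + z (bar (mi k))"
      unfolding arc_vector_def distrib_left right_diff_distrib sum.distrib sum_subtractf
      using k mk bar_in by (simp add: *)
    also have "\<dots> = 2 * (z k - z (mi k))" using z k mk by (simp add: skew_def)
    finally have "(\<Sum>l\<in>L. K * (z l * arc_vector mi k l)) = 2 * K * (z k - z (mi k))"
      by (simp add: sum_distrib_left[symmetric])
    then show "(\<Sum>l\<in>L. z l * (if z k < 0 then K * arc_vector mi k l else 0)) = 2 * K * (if z k < 0 then z k - z (mi k) else 0)"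
      by (cases "z k < 0") (simp_all add: mult.left_commute)
  qed
  finally show ?thesis by (simp add: sum_distrib_left)
qed

text \<open>The flow term pays for replacing \<open>-z\<close> by the weight, which respects the implications.\<close>

lemma oracle_inner:
  assumes B: "B \<in> ideals imp" and z: "valid B z" and mi: "blocking B z mi"
    and ch: "chain (weight z mi) B I b" and max: "\<And>l. \<not> candidate I l"
    and K: "\<And>l. l \<in> L \<Longrightarrow> \<bar>b l\<bar> \<le> K"
  shows "(\<Sum>l\<in>L. z l * (b l + flow z mi K l)) \<le> - 2 * (\<Sum>l\<in>I. weight z mi l * b l)"
proof -
  let ?p = "weight z mi"
  have p: "monotone_weight B ?p" by (rule monotone_weight[OF mi])
  have I: "I \<in> ideals imp" "B \<subseteq> I" using chain_ideal[OF ch B] by auto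
  have IL: "I \<subseteq> L" "finite I" "\<And>l. l \<in> I \<Longrightarrow> bar l \<notin> I" using I ideal_finite by (auto simp: ideals_def)
  have sk: "skew z" "skew b" and b0: "\<forall>l\<in>B. b l = 0" "\<And>l. l \<notin> I \<and> bar l \<notin> I \<longrightarrow> l \<in> L \<longrightarrow> b l = 0"
    using z chain_skew[OF ch B] by (auto simp: valid_def)
  have K0: "K \<ge> 0" using K[OF tt_in] by simp
  \<comment> \<open>\<open>d l\<close> is at once the error of replacing \<open>- z l\<close> by the
    weight and the rise of \<open>z\<close> along the arc of \<open>l\<close>.\<close>
  define d where "d l = (if z l < 0 then z (mi l) - z l else 0)" for l
  have d0: "d l \<ge> 0" if "l \<in> L" for l using mi that by (auto simp: d_def blocking_def)
  have pz: "z l < 0 \<Longrightarrow> \<bar>z l + ?p l\<bar> \<le> d l" if "l \<in> L" for l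
    using mi that by (auto simp: weight_def d_def blocking_def)
  \<comment> \<open>If \<open>z l\<close> is positive the error is charged to \<open>bar l\<close>.
    Either \<open>bar l\<close> is alive and the greedy order gives it weight zero, or it is dead
    and implies \<open>l\<close>; in both cases \<open>z (mi (bar l))\<close> is nonnegative, so its
    arc rises by at least \<open>z l\<close>.\<close>
  have key: "\<bar>z l + ?p l\<bar> \<le> d l + d (bar l)" if l: "l \<in> I - B" for l
  proof -
    have lL: "l \<in> L" "bar l \<in> L" "bar (bar l) = l" using l IL bar_in bar_bar by auto
    have mil: "z l \<le> z (mi l)" using mi lL by (auto simp: blocking_def)
    show ?thesis
    proof (cases "z l < 0")
      case True
      then show ?thesis using pz[OF lL(1)] d0[OF lL(2)] by simp
    next
      case False
      then have p0: "?p l = 0" using mil by (simp add: weight_def)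
      have zb: "z (bar l) = - z l" using sk(1) lL by (simp add: skew_def)
      have "?p (bar l) = 0"
      proof (cases "alive (bar l)")
        case True
        then show ?thesis using chain_order[OF p B ch] l p0 by blast
      next
        case d: False
        then have "imp (bar l) l" using lL by (auto simp: alive_def)
        then have "z l \<le> z (mi (bar l))" using mi lL l by (auto simp: blocking_def)
        then show ?thesis using False by (simp add: weight_def)
      qed
      then have "z (mi (bar l)) \<ge> 0" by (simp add: weight_def)
      then show ?thesis using False p0 zb d0[OF lL(1)] by (auto simp: d_def)
    qed
  qed
  have "(\<Sum>l\<in>I. \<bar>z l + ?p l\<bar> * \<bar>b l\<bar>) \<le> (\<Sum>l\<in>I. (d l + d (bar l)) * K)"
  proof (rule sum_mono)
    fix l assume l: "l \<in> I"
    show "\<bar>z l + ?p l\<bar> * \<bar>b l\<bar> \<le> (d l + d (bar l)) * K"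
    proof (cases "l \<in> B")
      case True
      then show ?thesis using b0 d0 l IL bar_in K0 by auto
    next
      case False
      then show ?thesis using key[of l] l K[of l] IL d0 bar_in by (intro mult_mono) auto
    qed
  qed
  also have "\<dots> = K * (sum d I + sum d (bar ` I))"
  proof -
    have "inj_on bar I" using IL(1) by (meson bar_inj inj_onI subsetD)
    then show ?thesis by (simp add: sum.reindex sum.distrib[symmetric] sum_distrib_left mult.commute)
  qed
  also have "\<dots> = K * sum d (I \<union> bar ` I)"
    using IL by (subst sum.union_disjoint) auto
  also have "\<dots> \<le> K * sum d L"
    using IL bar_in d0 K0 by (intro mult_left_mono sum_mono2 finite_L) auto
  finally have "(\<Sum>l\<in>I. (z l + ?p l) * b l) \<le> K * sum d L"
    using sum_abs[of "\<lambda>l. (z l + ?p l) * b l" I] by (simp add: abs_mult)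
  moreover have "(\<Sum>l\<in>L. z l * b l) = 2 * (\<Sum>l\<in>I. z l * b l)"
    using b0 IL by (intro sum_skew_half sk) auto
  moreover have "(\<Sum>l\<in>L. z l * flow z mi K l) = - 2 * K * sum d L"
  proof -
    have "(if z k < 0 then z k - z (mi k) else 0) = - d k" for k by (simp add: d_def)
    then show ?thesis unfolding sum_flow[OF sk(1) mi] by (simp add: sum_negf)
  qed
  ultimately show ?thesis by (simp add: ring_distribs sum.distrib)
qed

text \<open>If \<open>w\<close> is not in \<open>A\<close>, truncate \<open>z\<close> to
  \<open>A\<close>. By minimality of \<open>A\<close> the truncation still respects the upper
  bounds, so the greedy vector does at least as well against the weight. But the truncation has lost
  the entry at \<open>w\<close>, and comparing with the squared norm leaves
  \<open>2 * (z w * z w)\<close> inside the gap.\<close>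

lemma small_gap_fixes_literal:
  assumes B: "B \<in> ideals imp" and z: "valid B z" and mi: "blocking B z mi"
    and ch: "chain (weight z mi) B I b" and max: "\<And>l. \<not> candidate I l"
    and K: "\<And>l. l \<in> L \<Longrightarrow> \<bar>b l\<bar> \<le> K"
    and gap: "(\<Sum>l\<in>L. z l * (z l - (b l + flow z mi K l))) \<le> 2 * t\<^sup>2"
    and w: "w \<in> L" "z w < - t" "t \<ge> 0"
    and A: "A \<in> ideals imp" "B \<subseteq> A" "\<And>A'. A' \<in> ideals imp \<Longrightarrow> B \<subseteq> A' \<Longrightarrow> f A \<le> f A'"
  shows "w \<in> A"
proof (rule ccontr)
  assume wA: "w \<notin> A"
  let ?p = "weight z mi"
  have p: "monotone_weight B ?p" by (rule monotone_weight[OF mi])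
  have I: "I \<in> ideals imp" "B \<subseteq> I" using chain_ideal[OF ch B] by auto
  have IL: "I \<subseteq> L" "finite I" using I ideal_finite by (auto simp: ideals_def)
  have sk: "skew z" and zB: "\<forall>l\<in>B. z l = 0" using z by (auto simp: valid_def)
  define y where "y l = (if l \<in> A then z l else 0)" for l
  have "sum y J \<le> f J - f B" if J: "J \<in> ideals imp" "B \<subseteq> J" for J
  proof -
    have "sum y J = sum z (A \<inter> J)"
      unfolding y_def using ideal_finite[OF J(1)] by (simp add: sum.If_cases Int_commute)
    also have "\<dots> \<le> f (A \<inter> J) - f B" using z Int_ideal[OF A(1) J(1)] A J by (auto simp: valid_def)
    also have "f (A \<inter> J) \<le> f J"
    proof -
      have "B \<subseteq> join A J" using A(1,2) J by (auto simp: join_def ideals_def)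
      then have "f A \<le> f (join A J)" by (intro A(3) join_ideal A(1) J(1))
      then show ?thesis using bisubmodular[OF A(1) J(1)] by simp
    qed
    finally show ?thesis by simp
  qed
  then have "0 \<le> (\<Sum>m\<in>I. (?p m - 0) * (b m - y m))"
    using zB p by (intro chain_greedy[OF p B _ _ ch]) (auto simp: y_def monotone_weight_def)
  then have 1: "(\<Sum>m\<in>I. ?p m * y m) \<le> (\<Sum>m\<in>I. ?p m * b m)" by (simp add: algebra_simps sum_subtractf)
  define P where "P = {l\<in>L. z l < 0}"
  have P: "finite P" "w \<in> P" using finite_L w by (auto simp: P_def)
  \<comment> \<open>\<open>P\<close> takes the negative literal of each pair, so it carries half of
    the squared norm.\<close>
  have 2: "(\<Sum>l\<in>L. z l * z l) = 2 * (\<Sum>l\<in>P. z l * z l)"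
    using sk by (intro sum_skew_half) (auto simp: P_def skew_def bar_in intro: antisym)
  have "- (\<Sum>m\<in>P - {w}. z m * z m) \<le> - (\<Sum>m\<in>I \<inter> (P - {w}). z m * z m)"
    using P by (auto intro!: sum_mono2)
  also have "\<dots> = (\<Sum>m\<in>I. if m \<in> P - {w} then - (z m * z m) else 0)"
    using IL by (simp add: sum.If_cases sum_negf Int_def)
  also have "\<dots> \<le> (\<Sum>m\<in>I. ?p m * y m)"
  proof (rule sum_mono)
    fix m assume m: "m \<in> I"
    have zm: "z m \<le> z (mi m)" using mi m IL by (auto simp: blocking_def)
    show "(if m \<in> P - {w} then - (z m * z m) else 0) \<le> ?p m * y m"
    proof (cases "z m < 0")
      case True
      have "?p m \<le> - z m" "?p m \<ge> 0" using zm True by (auto simp: weight_def)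
      then have "- (z m * z m) \<le> ?p m * z m" using True mult_right_mono_neg[of "?p m" "- z m" "z m"] by simp
      then show ?thesis using True wA m IL by (auto simp: y_def P_def)
    next
      case False
      then have "?p m = 0" using zm by (simp add: weight_def)
      then show ?thesis using False by (simp add: P_def)
    qed
  qed
  also note 1
  also have "(\<Sum>m\<in>P - {w}. z m * z m) = (\<Sum>m\<in>P. z m * z m) - z w * z w"
    using P by (simp add: sum_diff1)
  finally have 3: "- ((\<Sum>m\<in>P. z m * z m) - z w * z w) \<le> (\<Sum>m\<in>I. ?p m * b m)" .
  have "(\<Sum>l\<in>L. z l * z l) + 2 * (\<Sum>m\<in>I. ?p m * b m) \<le> 2 * t\<^sup>2"
    using gap oracle_inner[OF B z mi ch max K] by (simp add: right_diff_distrib sum_subtractf)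
  then have "z w * z w \<le> t\<^sup>2" using 2 3 by simp
  moreover have "t * t < (- z w) * (- z w)" using w by (intro mult_strict_mono) auto
  ultimately show False by (simp add: power2_eq_square)
qed

text \<open>The opposite outcome of a search: without a strongly negative entry, \<open>z\<close>
  itself certifies that no set above \<open>B\<close> is much better than \<open>B\<close>.\<close>

lemma small_vector_bound:
  fixes t :: real
  assumes "valid B z" and z: "\<And>l. l \<in> L \<Longrightarrow> - t \<le> z l" and A: "A \<in> ideals imp" "B \<subseteq> A"
  shows "f B - card L * t \<le> f A"
proof -
  have t: "t \<ge> 0"
  proof -
    have "z (bar tt) = - z tt" using assms(1) tt_in unfolding valid_def skew_def by blast
    then show ?thesis using z[OF tt_in] z[OF bar_in[OF tt_in]] by simp
  qed
  have "- (card L * t) \<le> - (card A * t)"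
  proof -
    have "card A \<le> card L" using A finite_L by (intro card_mono) (auto simp: ideals_def)
    then show ?thesis using t by (simp add: mult_right_mono)
  qed
  also have "- (card A * t) = (\<Sum>l\<in>A. - t)" by simp
  also have "\<dots> \<le> sum z A" using z A by (intro sum_mono) (auto simp: ideals_def)
  also have "\<dots> \<le> f A - f B" using assms by (auto simp: valid_def)
  finally show ?thesis by simp
qed

end

text \<open>If \<open>imp\<close> is transitive and reflexive this is already the transitive
  closure, because one passage through the new arc suffices for any derivation.\<close>

definition add_arc :: "('l \<Rightarrow> 'l \<Rightarrow> bool) \<Rightarrow> 'l \<Rightarrow> 'l \<Rightarrow> 'l \<Rightarrow> 'l \<Rightarrow> bool" where
  "add_arc imp l w a b \<longleftrightarrow> imp a b \<or> imp a l \<and> imp w b"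

context implications begin

definition imp' :: "'l \<Rightarrow> 'l \<Rightarrow> 'l \<Rightarrow> 'l \<Rightarrow> bool" where
  "imp' l w = add_arc (add_arc imp l w) (bar w) (bar l)"

lemma ideals_imp':
  assumes "l \<in> L" "w \<in> L"
  shows "ideals (imp' l w) = {A \<in> ideals imp. (l \<in> A \<longrightarrow> w \<in> A) \<and> (bar w \<in> A \<longrightarrow> bar l \<in> A)}"
proof -
  have "imp l l" "imp w w" "imp (bar l) (bar l)" "imp (bar w) (bar w)" using assms imp_refl bar_in by auto
  then show ?thesis unfolding ideals_def imp'_def add_arc_def by blast
qed

text \<open>An implication true in all least sets removes only ideals of larger value. Hence the
  minimum and its minimizers survive, and some ideal remains.\<close>

lemma implications_imp':
  assumes lw: "l \<in> L" "w \<in> L"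
    and sound: "\<And>A. A \<in> least_sets f imp \<Longrightarrow> (l \<in> A \<longrightarrow> w \<in> A) \<and> (bar w \<in> A \<longrightarrow> bar l \<in> A)"
  shows "implications L bar tt (imp' l w) f" "least_sets f (imp' l w) = least_sets f imp"
proof -
  note id = ideals_imp'[OF lw]
  have sub: "least_sets f imp \<subseteq> ideals (imp' l w)" using sound id by (auto simp: least_sets_def)
  show "least_sets f (imp' l w) = least_sets f imp"
  proof
    show "least_sets f imp \<subseteq> least_sets f (imp' l w)" using sub id by (auto simp: least_sets_def)
    show "least_sets f (imp' l w) \<subseteq> least_sets f imp"
    proof
      fix A assume A: "A \<in> least_sets f (imp' l w)"
      obtain A0 where A0: "A0 \<in> least_sets f imp" using least_sets_nonempty[OF ideals_nonempty] by blast
      then have "f A \<le> f A0" using A sub by (auto simp: least_sets_def)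
      then show "A \<in> least_sets f imp" using A A0 id by (force simp: least_sets_def)
    qed
  qed
  have bb: "bar (bar l) = l" "bar (bar w) = w" using lw bar_bar by auto
  show "implications L bar tt (imp' l w) f"
  proof
    show "imp' l w a b \<Longrightarrow> a \<in> L \<and> b \<in> L" for a b using imp_in by (auto simp: imp'_def add_arc_def)
    show "a \<in> L \<Longrightarrow> imp' l w a a" for a using imp_refl by (auto simp: imp'_def add_arc_def)
    show "imp' l w a b \<Longrightarrow> imp' l w b c \<Longrightarrow> imp' l w a c" for a b c
      using imp_trans unfolding imp'_def add_arc_def by meson
    show "imp' l w (bar b) (bar a)" if "imp' l w a b" for a b
      using that unfolding imp'_def add_arc_def
      using imp_skew[of a b] imp_skew[of a l] imp_skew[of w b] imp_skew[of a "bar w"] imp_skew[of w "bar w"]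
        imp_skew[of "bar l" b] imp_skew[of "bar l" l] unfolding bb by metis
    show "a \<in> L \<Longrightarrow> imp' l w a tt" for a using imp_tt by (auto simp: imp'_def add_arc_def)
    show "ideals (imp' l w) \<noteq> {}" using sub least_sets_nonempty[OF ideals_nonempty] by blast
    show "A \<in> ideals (imp' l w) \<Longrightarrow> B \<in> ideals (imp' l w) \<Longrightarrow> f (A \<inter> B) + f (join A B) \<le> f A + f B" for A B
      using id bisubmodular by auto
  qed
qed

text \<open>The second half is not mere contraposition, as a set may contain neither
  \<open>l\<close> nor \<open>bar l\<close>. Suppose a minimizer \<open>A\<close> contains
  \<open>bar w\<close> but not \<open>bar l\<close>. Its join with a best set \<open>J\<close>
  containing \<open>l\<close> is again best among the sets containing \<open>l\<close>, yet
  \<open>bar w\<close> keeps \<open>w\<close> out of it.\<close>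

lemma fixed_literal_sound:
  assumes l: "alive l" and w: "w \<in> L"
    and fix_w: "\<And>A. A \<in> ideals imp \<Longrightarrow> l \<in> A \<Longrightarrow> (\<And>A'. A' \<in> ideals imp \<Longrightarrow> l \<in> A' \<Longrightarrow> f A \<le> f A') \<Longrightarrow> w \<in> A"
    and A: "A \<in> least_sets f imp"
  shows "(l \<in> A \<longrightarrow> w \<in> A) \<and> (bar w \<in> A \<longrightarrow> bar l \<in> A)"
proof
  have A': "A \<in> ideals imp" "\<And>A'. A' \<in> ideals imp \<Longrightarrow> f A \<le> f A'" using A by (auto simp: least_sets_def)
  show lw: "l \<in> A \<longrightarrow> w \<in> A" using fix_w A' by blast
  show "bar w \<in> A \<longrightarrow> bar l \<in> A"
  proof (rule impI, rule ccontr)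
    assume bw: "bar w \<in> A" and bl: "bar l \<notin> A"
    then have nw: "w \<notin> A" using A' bar_bar[OF w] by (auto simp: ideals_def)
    let ?S = "{J \<in> ideals imp. l \<in> J}"
    have S: "finite ?S" "?S \<noteq> {}" using finite_ideals cl_ideal[OF l] cl_self l by (auto simp: alive_def)
    obtain J where "is_arg_min f (\<lambda>J. J \<in> ?S) J" using ex_is_arg_min_if_finite[OF S] by blast
    then have J: "J \<in> ?S" "\<forall>J'\<in>?S. f J \<le> f J'" by (auto simp: is_arg_min_linorder)
    have JA: "join J A \<in> ideals imp" by (rule join_ideal) (use J A' in auto)
    have "f (J \<inter> A) + f (join J A) \<le> f J + f A" using J A' by (intro bisubmodular) auto
    moreover have "f A \<le> f (J \<inter> A)" using J A' by (intro A' Int_ideal) auto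
    ultimately have "f (join J A) \<le> f J" by simp
    moreover have "l \<in> join J A" using J bl by (auto simp: join_def ideals_def)
    ultimately have "w \<in> join J A" using fix_w[OF JA] J by fastforce
    then show False using bw by (simp add: join_def)
  qed
qed

end

section \<open>Total correctness with time bounds\<close>

fun writes :: "com \<Rightarrow> string set" where
  "writes (NAssign x es e) = {x}"
| "writes (RAssign x es e) = {x}"
| "writes (Query x es a) = {x}"
| "writes (Seq c1 c2) = writes c1 \<union> writes c2"
| "writes (Cond b c1 c2) = writes c1 \<union> writes c2"
| "writes (While b c) = writes c"

definition same_outside :: "string set \<Rightarrow> store \<Rightarrow> store \<Rightarrow> bool" where
  "same_outside W s s' \<longleftrightarrow> (\<forall>x. x \<notin> W \<longrightarrow> nmem s' x = nmem s x \<and> rmem s' x = rmem s x)"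

lemma nmem_nupdate [simp]: "nmem (nupdate x ks k s) = (nmem s)(x := (nmem s x)(ks := k))"
  and rmem_nupdate [simp]: "rmem (nupdate x ks k s) = rmem s"
  and nmem_rupdate [simp]: "nmem (rupdate x ks r s) = nmem s"
  and rmem_rupdate [simp]: "rmem (rupdate x ks r s) = (rmem s)(x := (rmem s x)(ks := r))"
  by (simp_all add: nupdate_def rupdate_def)

lemma same_outside_refl: "same_outside W s s"
  by (simp add: same_outside_def)

lemma same_outside_trans: "same_outside W s s1 \<Longrightarrow> same_outside W s1 s2 \<Longrightarrow> same_outside W s s2"
  by (simp add: same_outside_def)

lemma same_outside_mono: "same_outside W s s' \<Longrightarrow> W \<subseteq> W' \<Longrightarrow> same_outside W' s s'"
  by (auto simp: same_outside_def)

lemma same_outsideD: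
  "same_outside W s s' \<Longrightarrow> x \<notin> W \<Longrightarrow> nmem s' x = nmem s x"
  "same_outside W s s' \<Longrightarrow> x \<notin> W \<Longrightarrow> rmem s' x = rmem s x"
  by (simp_all add: same_outside_def)

lemma same_outside_nupdate: "x \<in> W \<Longrightarrow> same_outside W s s' \<Longrightarrow> same_outside W s (nupdate x ks k s')"
  and same_outside_rupdate: "x \<in> W \<Longrightarrow> same_outside W s s' \<Longrightarrow> same_outside W s (rupdate x ks r s')"
  by (auto simp: same_outside_def)

lemma exec_same_outside: "exec orac c s t s' \<Longrightarrow> same_outside (writes c) s s'"
  by (induction rule: exec.induct) (auto simp: same_outside_def)

definition runs :: "((nat \<Rightarrow> nat) \<Rightarrow> real) \<Rightarrow> com \<Rightarrow> store \<Rightarrow> nat \<Rightarrow> (store \<Rightarrow> bool) \<Rightarrow> bool" where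
  "runs orac c s k Q \<longleftrightarrow> (\<exists>t s'. exec orac c s t s' \<and> t \<le> k \<and> Q s')"

lemma runs_conseq:
  assumes "runs orac c s k Q" "k \<le> k'" "\<And>s'. Q s' \<Longrightarrow> same_outside (writes c) s s' \<Longrightarrow> Q' s'"
  shows "runs orac c s k' Q'"
  using assms exec_same_outside unfolding runs_def by (meson order_trans)

lemma runs_NAssign [simp]:
  "runs orac (NAssign x es e) s k Q \<longleftrightarrow> 1 \<le> k \<and> Q (nupdate x (map (nval s) es) (nval s e) s)"
  unfolding runs_def by (metis One_nat_def exec.NAssign exec_NAssignE)

lemma runs_RAssign [simp]:
  "runs orac (RAssign x es e) s k Q \<longleftrightarrow> 1 \<le> k \<and> Q (rupdate x (map (nval s) es) (rval s e) s)"
  unfolding runs_def by (metis One_nat_def exec.RAssign exec_RAssignE)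

lemma runs_Query [simp]:
  "runs orac (Query x es a) s k Q \<longleftrightarrow>
    1 \<le> k \<and> Q (rupdate x (map (nval s) es) (orac (\<lambda>i. nmem s a [i])) s)"
  unfolding runs_def by (metis One_nat_def exec.Query exec_QueryE)

lemma runs_Cond [simp]:
  "runs orac (Cond b c1 c2) s k Q \<longleftrightarrow>
    1 \<le> k \<and> (if bval s b then runs orac c1 s (k - 1) Q else runs orac c2 s (k - 1) Q)"
proof
  assume "runs orac (Cond b c1 c2) s k Q"
  then obtain t s' where t: "exec orac (Cond b c1 c2) s t s'" "t \<le> k" "Q s'" by (auto simp: runs_def)
  from t(1) show "1 \<le> k \<and> (if bval s b then runs orac c1 s (k - 1) Q else runs orac c2 s (k - 1) Q)"
    by (rule exec_CondE) (use t in \<open>auto simp: runs_def intro!: exI\<close>)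
next
  assume a: "1 \<le> k \<and> (if bval s b then runs orac c1 s (k - 1) Q else runs orac c2 s (k - 1) Q)"
  show "runs orac (Cond b c1 c2) s k Q"
  proof (cases "bval s b")
    case True
    then obtain t s' where t: "exec orac c1 s t s'" "t \<le> k - 1" "Q s'" using a by (auto simp: runs_def)
    then show ?thesis using exec.CondTrue[OF True t(1), of c2] a unfolding runs_def by fastforce
  next
    case False
    then obtain t s' where t: "exec orac c2 s t s'" "t \<le> k - 1" "Q s'" using a by (auto simp: runs_def)
    then show ?thesis using exec.CondFalse[OF False t(1), of c1] a unfolding runs_def by fastforce
  qed
qed

lemma runs_Seq:
  assumes "runs orac c1 s k1 Q1" "k1 + k2 \<le> k"
    and "\<And>s'. Q1 s' \<Longrightarrow> same_outside (writes c1) s s' \<Longrightarrow> runs orac c2 s' k2 Q"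
  shows "runs orac (Seq c1 c2) s k Q"
proof -
  obtain t1 s1 where 1: "exec orac c1 s t1 s1" "t1 \<le> k1" "Q1 s1" using assms(1) by (auto simp: runs_def)
  obtain t2 s2 where 2: "exec orac c2 s1 t2 s2" "t2 \<le> k2" "Q s2"
    using assms(3)[OF 1(3) exec_same_outside[OF 1(1)]] by (auto simp: runs_def)
  have "t1 + t2 \<le> k" using 1 2 assms(2) by simp
  then show ?thesis using exec.Seq[OF 1(1) 2(1)] 2(3) by (auto simp: runs_def)
qed

text \<open>Turns a leading assignment into a rewrite rule, so that straight-line code is executed
  by simplification.\<close>

lemma runs_Seq_step:
  assumes "\<And>s k Q. runs orac c s k Q \<longleftrightarrow> 1 \<le> k \<and> Q (g s)"
  shows "runs orac (Seq c c2) s k Q \<longleftrightarrow> 1 \<le> k \<and> runs orac c2 (g s) (k - 1) Q"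
proof
  assume "runs orac (Seq c c2) s k Q"
  then obtain t s' where t: "exec orac (Seq c c2) s t s'" "t \<le> k" "Q s'" by (auto simp: runs_def)
  from t(1) obtain t1 s1 t2 where *: "t = t1 + t2" "exec orac c s t1 s1" "exec orac c2 s1 t2 s'"
    by (rule exec_SeqE)
  have "runs orac c s t1 (\<lambda>s'. s' = s1)" using *(2) by (auto simp: runs_def)
  then have "1 \<le> t1" "g s = s1" using assms by auto
  then show "1 \<le> k \<and> runs orac c2 (g s) (k - 1) Q" using * t by (auto simp: runs_def intro!: exI)
next
  assume "1 \<le> k \<and> runs orac c2 (g s) (k - 1) Q"
  moreover have "runs orac c s 1 (\<lambda>s'. s' = g s)" using assms by simp
  ultimately show "runs orac (Seq c c2) s k Q"
    by (intro runs_Seq[of orac c s 1 "\<lambda>s'. s' = g s" "k - 1"]) auto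
qed

lemmas runs_Seq_assign [simp] =
  runs_Seq_step[OF runs_NAssign] runs_Seq_step[OF runs_RAssign] runs_Seq_step[OF runs_Query]

text \<open>The invariant carries the number of completed iterations; a bound on that number
  replaces a decreasing measure.\<close>

lemma runs_While:
  assumes "I 0 s0" and bound: "\<And>j s. I j s \<Longrightarrow> j \<le> m"
    and step: "\<And>j s. I j s \<Longrightarrow> bval s b \<Longrightarrow> same_outside (writes c) s0 s \<Longrightarrow> runs orac c s k (I (Suc j))"
  shows "runs orac (While b c) s0 (1 + m * (k + 1)) (\<lambda>s. (\<exists>j. I j s) \<and> \<not> bval s b)"
proof -
  have "runs orac (While b c) s (1 + (m - j) * (k + 1)) (\<lambda>s. (\<exists>j. I j s) \<and> \<not> bval s b)"
    if "I j s" "same_outside (writes c) s0 s" for j s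
    using that
  proof (induction "m - j" arbitrary: j s)
    \<comment> \<open>Here \<open>j = m\<close>, and one more iteration would establish the
      invariant for \<open>m + 1\<close>, against \<open>bound\<close>.\<close>
    case 0
    show ?case
    proof (cases "bval s b")
      case True
      obtain t s' where "I (Suc j) s'" using step[OF 0(2) True 0(3)] by (auto simp: runs_def)
      then show ?thesis using bound[of "Suc j"] 0 by fastforce
    next
      case False
      then show ?thesis using exec.WhileFalse[OF False, of orac c] 0 by (fastforce simp: runs_def)
    qed
  next
    case (Suc d)
    show ?case
    proof (cases "bval s b")
      case True
      obtain t1 s1 where 1: "exec orac c s t1 s1" "t1 \<le> k" "I (Suc j) s1"
        using step[OF Suc(3) True Suc(4)] by (auto simp: runs_def)
      have "same_outside (writes c) s0 s1"
        using same_outside_trans[OF Suc(4) exec_same_outside[OF 1(1)]] .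
      then have "runs orac (While b c) s1 (1 + (m - Suc j) * (k + 1)) (\<lambda>s. (\<exists>j. I j s) \<and> \<not> bval s b)"
        using Suc(2) 1(3) by (intro Suc(1)) auto
      then obtain t2 s2 where 2: "exec orac (While b c) s1 t2 s2" "t2 \<le> 1 + (m - Suc j) * (k + 1)"
        "(\<exists>j. I j s2) \<and> \<not> bval s2 b" by (auto simp: runs_def)
      have "m - j = Suc (m - Suc j)" using Suc(2) by simp
      then have "1 + t1 + t2 \<le> 1 + (m - j) * (k + 1)" using 1 2 by simp
      then show ?thesis using exec.WhileTrue[OF True 1(1) 2(1)] 2(3) unfolding runs_def by blast
    next
      case False
      have "exec orac (While b c) s 1 s" by (rule exec.WhileFalse[OF False])
      then show ?thesis using Suc False by (auto simp: runs_def intro!: exI)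
    qed
  qed
  from this[OF assms(1) same_outside_refl] show ?thesis by (auto simp: runs_def intro: le_trans)
qed

abbreviation V :: "string \<Rightarrow> nexp" where "V x \<equiv> NLoad x []"
abbreviation R :: "string \<Rightarrow> rexp" where "R x \<equiv> RLoad x []"
abbreviation Skip :: com where "Skip \<equiv> NAssign ''skip'' [] (NConst 0)"

definition For :: "string \<Rightarrow> nexp \<Rightarrow> com \<Rightarrow> com" where
  "For x e c = Seq (NAssign x [] (NConst 0))
     (While (NLess (V x) e) (Seq c (NAssign x [] (NAdd (V x) (NConst 1)))))"

lemma writes_For [simp]: "writes (For x e c) = insert x (writes c)"
  by (auto simp: For_def)

text \<open>The postcondition of the body is stated after the increment of the counter, which
  \<open>For\<close> appends to the body.\<close>

lemma runs_For:
  assumes x: "x \<notin> writes c"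
    and bound: "\<And>s. same_outside (insert x (writes c)) s0 s \<Longrightarrow> nval s e = m"
    and init: "I 0 (nupdate x [] 0 s0)"
    and step: "\<And>j s. j < m \<Longrightarrow> same_outside (insert x (writes c)) s0 s \<Longrightarrow> nmem s x [] = j \<Longrightarrow> I j s \<Longrightarrow>
      runs orac c s k (\<lambda>s'. I (Suc j) (nupdate x [] (Suc j) s'))"
  shows "runs orac (For x e c) s0 (2 + m * (k + 2)) (I m)"
proof -
  let ?W = "insert x (writes c)"
  define J where "J j s \<longleftrightarrow> j \<le> m \<and> nmem s x [] = j \<and> same_outside ?W s0 s \<and> I j s" for j s
  have "runs orac (While (NLess (V x) e) (Seq c (NAssign x [] (NAdd (V x) (NConst 1))))) (nupdate x [] 0 s0)
      (1 + m * ((k + 1) + 1)) (\<lambda>s. (\<exists>j. J j s) \<and> \<not> bval s (NLess (V x) e))"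
  proof (rule runs_While)
    show "J 0 (nupdate x [] 0 s0)"
      using init by (auto simp: J_def intro!: same_outside_nupdate same_outside_refl)
    show "J j s \<Longrightarrow> j \<le> m" for j s by (simp add: J_def)
    fix j s assume J: "J j s" and b: "bval s (NLess (V x) e)"
    then have j: "j < m" "nmem s x [] = j" "same_outside ?W s0 s" "I j s"
      using bound[of s] by (auto simp: J_def)
    show "runs orac (Seq c (NAssign x [] (NAdd (V x) (NConst 1)))) s (k + 1) (J (Suc j))"
    proof (rule runs_Seq[OF step[OF j(1,3,2,4)]])
      fix s' assume s': "I (Suc j) (nupdate x [] (Suc j) s')" "same_outside (writes c) s s'"
      have "same_outside ?W s0 s'"
        using same_outside_trans[OF j(3) same_outside_mono[OF s'(2)]] by blast
      moreover have "nmem s' x = nmem s x" using s'(2) x by (rule same_outsideD)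
      ultimately show "runs orac (NAssign x [] (NAdd (V x) (NConst 1))) s' 1 (J (Suc j))"
        using s' j by (auto simp: J_def intro!: same_outside_nupdate)
    qed simp
  qed
  then have "runs orac (For x e c) s0 (2 + m * (k + 2)) (\<lambda>s. (\<exists>j. J j s) \<and> \<not> bval s (NLess (V x) e))"
    by (simp add: For_def)
  then show ?thesis by (rule runs_conseq) (auto simp: J_def dest: bound)
qed

section \<open>Programs for one round\<close>

text \<open>For \<open>1 \<le> i \<le> n\<close> the literals \<open>i\<close> and \<open>i + (n + 1)\<close> say that coordinate \<open>i\<close> moves to its first
  and second child. The literals \<open>0\<close> and \<open>n + 1\<close> are truth and falsity.\<close>

definition nlits :: "nat \<Rightarrow> nat" where
  "nlits n = 2 * (n + 1)"

definition lbar :: "nat \<Rightarrow> nat \<Rightarrow> nat" where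
  "lbar n l = (if l \<le> n then l + (n + 1) else l - (n + 1))"

definition lvar :: "nat \<Rightarrow> nat \<Rightarrow> nat" where
  "lvar n l = (if l \<le> n then l else l - (n + 1))"

text \<open>Coordinate \<open>0\<close> is a dummy that belongs to the two constant literals. It
  keeps the arrays uniform, and no value of \<open>F\<close> depends on it.\<close>

definition labels :: "nat \<Rightarrow> (nat \<Rightarrow> nat) \<Rightarrow> (nat \<Rightarrow> nat) \<Rightarrow> nat set \<Rightarrow> nat \<Rightarrow> nat" where
  "labels n x ch A i = (if i \<in> A then ch i else if lbar n i \<in> A then ch (lbar n i) else x i)"

lemma lbar_less: "l < nlits n \<Longrightarrow> lbar n l < nlits n"
  by (auto simp: lbar_def nlits_def)

lemma literals_nat: "literals {..<nlits n} (lbar n) 0"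
  by unfold_locales (auto simp: lbar_def nlits_def)

lemma labels_insert:
  assumes "j < nlits n" "i \<le> n" "lbar n j \<notin> I"
  shows "labels n x ch (insert j I) i = (if i = lvar n j then ch j else labels n x ch I i)"
  using assms by (auto simp: labels_def lbar_def lvar_def nlits_def split: if_splits)

definition layout :: "nat \<Rightarrow> (nat \<Rightarrow> nat) \<Rightarrow> (nat \<Rightarrow> nat) \<Rightarrow> (nat \<Rightarrow> nat \<Rightarrow> bool) \<Rightarrow> store \<Rightarrow> bool" where
  "layout n x ch imp s \<longleftrightarrow> nmem s ''h'' [] = n + 1 \<and> nmem s ''L'' [] = nlits n \<and>
    (\<forall>l<nlits n. nmem s ''bar'' [l] = lbar n l \<and> nmem s ''var'' [l] = lvar n l \<and> nmem s ''ch'' [l] = ch l) \<and>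
    (\<forall>i\<le>n. nmem s ''x'' [i] = x i) \<and>
    (\<forall>l<nlits n. \<forall>m<nlits n. 0 < nmem s ''imp'' [l, m] \<longleftrightarrow> imp l m)"

lemma layout_same:
  assumes s: "same_outside W s s'" and W: "W \<inter> {''h'', ''L'', ''bar'', ''var'', ''ch'', ''x'', ''imp''} = {}"
    and l: "layout n x ch imp s"
  shows "layout n x ch imp s'"
proof -
  have "nmem s' y = nmem s y" if "y \<in> {''h'', ''L'', ''bar'', ''var'', ''ch'', ''x'', ''imp''}" for y
    using s by (rule same_outsideD) (use W that in blast)
  then show ?thesis using l unfolding layout_def by simp
qed

text \<open>The set and the labeling it describes are stored side by side, so a query needs no
  conversion.\<close>

definition holds_set :: "nat \<Rightarrow> (nat \<Rightarrow> nat) \<Rightarrow> (nat \<Rightarrow> nat) \<Rightarrow> nat set \<Rightarrow> store \<Rightarrow> bool" where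
  "holds_set n x ch I s \<longleftrightarrow> (\<forall>l<nlits n. nmem s ''in'' [l] = of_bool (l \<in> I)) \<and>
    (\<forall>i\<le>n. nmem s ''a'' [i] = labels n x ch I i)"

lemma holds_set_same:
  assumes s: "same_outside W s s'" and W: "W \<inter> {''in'', ''a''} = {}"
    and l: "holds_set n x ch I s"
  shows "holds_set n x ch I s'"
proof -
  have "nmem s' y = nmem s y" if "y \<in> {''in'', ''a''}" for y
    using s by (rule same_outsideD) (use W that in blast)
  then show ?thesis using l unfolding holds_set_def by simp
qed

abbreviation Imp :: "nexp \<Rightarrow> nexp \<Rightarrow> bexp" where
  "Imp a b \<equiv> NLess (NConst 0) (NLoad ''imp'' [a, b])"
abbreviation (input) "bar_exp e \<equiv> NLoad ''bar'' [e]"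
abbreviation "zero_r \<equiv> ROfNat (NConst 0)"

definition add_cl :: "nexp \<Rightarrow> com" where
  "add_cl e = For ''i'' (V ''L'') (Cond (Imp e (V ''i''))
     (Seq (NAssign ''in'' [V ''i''] (NConst 1)) (NAssign ''a'' [NLoad ''var'' [V ''i'']] (NLoad ''ch'' [V ''i''])))
     Skip)"

definition set_base :: "nexp \<Rightarrow> com" where
  "set_base e = Seq (For ''i'' (V ''L'') (NAssign ''in'' [V ''i''] (NConst 0)))
     (Seq (For ''i'' (V ''h'') (NAssign ''a'' [V ''i''] (NLoad ''x'' [V ''i'']))) (add_cl e))"

text \<open>The base is \<open>cl l\<close> for the program variable \<open>l\<close>; membership in
  it is read off the \<open>imp\<close> array.\<close>

definition blocking_com :: com where
  "blocking_com = For ''k'' (V ''L'') (Seq (NAssign ''mi'' [V ''k''] (V ''k'')) (For ''m'' (V ''L'')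
     (Cond (BAnd (Imp (V ''k'') (V ''m'')) (BAnd (BNot (Imp (V ''l'') (V ''m'')))
        (RLess (RLoad ''z'' [NLoad ''mi'' [V ''k'']]) (RLoad ''z'' [V ''m'']))))
      (NAssign ''mi'' [V ''k''] (V ''m'')) Skip)))"

definition weight_com :: com where
  "weight_com = For ''k'' (V ''L'') (Cond (RLess (RLoad ''z'' [NLoad ''mi'' [V ''k'']]) zero_r)
     (RAssign ''p'' [V ''k''] (RSub zero_r (RLoad ''z'' [NLoad ''mi'' [V ''k'']])))
     (RAssign ''p'' [V ''k''] zero_r))"

definition candidate_exp :: "nexp \<Rightarrow> bexp" where
  "candidate_exp e = BAnd (BNot (Imp e (bar_exp e)))
     (BAnd (BNot (NLess (NConst 0) (NLoad ''in'' [e]))) (BNot (NLess (NConst 0) (NLoad ''in'' [bar_exp e]))))"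

text \<open>Disjunction and equality of reals have to be spelled out with negation, conjunction and
  strict comparison.\<close>

definition better_exp :: "nexp \<Rightarrow> nexp \<Rightarrow> bexp" where
  "better_exp m b = BNot (BAnd (BNot (RLess (RLoad ''p'' [b]) (RLoad ''p'' [m])))
     (BNot (BAnd (BNot (RLess (RLoad ''p'' [m]) (RLoad ''p'' [b]))) (BAnd (Imp b m) (BNot (Imp m b))))))"

text \<open>The value \<open>L\<close> of \<open>best\<close> stands for the absence of a
  candidate.\<close>

definition select_com :: com where
  "select_com = Seq (NAssign ''best'' [] (V ''L'')) (For ''m'' (V ''L'')
     (Cond (BAnd (candidate_exp (V ''m'')) (BNot (BAnd (NLess (V ''best'') (V ''L''))
        (BNot (better_exp (V ''m'') (V ''best''))))))
      (NAssign ''best'' [] (V ''m'')) Skip))"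

definition grow_com :: com where
  "grow_com = Seq (add_cl (V ''best'')) (Seq (Query ''v'' [] ''a'')
     (Seq (RAssign ''q'' [V ''best''] (RSub (R ''v'') (R ''u'')))
     (Seq (RAssign ''q'' [bar_exp (V ''best'')] (RSub (R ''u'') (R ''v'')))
     (RAssign ''u'' [] (R ''v'')))))"

definition chain_com :: com where
  "chain_com = Seq (For ''k'' (V ''L'') (RAssign ''q'' [V ''k''] zero_r)) (Seq (set_base (V ''l''))
     (Seq (Query ''u'' [] ''a'')
     (For ''k'' (V ''L'') (Seq select_com (Cond (NLess (V ''best'') (V ''L'')) grow_com Skip)))))"

definition flow_com :: com where
  "flow_com = For ''k'' (V ''L'') (Cond (RLess (RLoad ''z'' [V ''k'']) zero_r)
     (Seq (RAssign ''q'' [V ''k''] (RAdd (RLoad ''q'' [V ''k'']) (R ''K'')))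
     (Seq (RAssign ''q'' [bar_exp (V ''k'')] (RSub (RLoad ''q'' [bar_exp (V ''k'')]) (R ''K'')))
     (Seq (RAssign ''q'' [NLoad ''mi'' [V ''k'']] (RSub (RLoad ''q'' [NLoad ''mi'' [V ''k'']]) (R ''K'')))
     (RAssign ''q'' [bar_exp (NLoad ''mi'' [V ''k''])] (RAdd (RLoad ''q'' [bar_exp (NLoad ''mi'' [V ''k''])]) (R ''K'')))))) Skip)"

definition gap_com :: com where
  "gap_com = Seq (RAssign ''g'' [] zero_r) (For ''k'' (V ''L'') (RAssign ''g'' [] (RAdd (R ''g'')
     (RMul (RLoad ''z'' [V ''k'']) (RSub (RLoad ''z'' [V ''k'']) (RLoad ''q'' [V ''k'']))))))"

definition oracle_com :: com where
  "oracle_com = Seq blocking_com (Seq weight_com (Seq chain_com (Seq flow_com gap_com)))"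

lemma writes_add_cl: "writes (add_cl e) \<subseteq> {''i'', ''in'', ''a'', ''skip''}"
  and writes_set_base: "writes (set_base e) \<subseteq> {''i'', ''in'', ''a'', ''skip''}"
  and writes_blocking: "writes blocking_com \<subseteq> {''k'', ''mi'', ''m'', ''skip''}"
  and writes_weight: "writes weight_com \<subseteq> {''k'', ''p''}"
  and writes_select: "writes select_com \<subseteq> {''best'', ''m'', ''skip''}"
  and writes_flow: "writes flow_com \<subseteq> {''k'', ''q'', ''skip''}"
  and writes_gap: "writes gap_com \<subseteq> {''k'', ''g''}"
  by (simp_all add: add_cl_def set_base_def blocking_com_def weight_com_def select_com_def
      flow_com_def gap_com_def)

lemma writes_chain: "writes chain_com \<subseteq> {''k'', ''q'', ''i'', ''in'', ''a'', ''skip'', ''v'', ''u'', ''best'', ''m''}"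
  by (simp add: chain_com_def set_base_def add_cl_def select_com_def grow_com_def)

lemma writes_oracle: "writes oracle_com \<subseteq>
   {''k'', ''q'', ''i'', ''in'', ''a'', ''skip'', ''v'', ''u'', ''best'', ''m'', ''mi'', ''p'', ''g''}"
  by (simp add: oracle_com_def chain_com_def set_base_def add_cl_def select_com_def grow_com_def
      blocking_com_def weight_com_def flow_com_def gap_com_def)

text \<open>The oracle is tied to \<open>f\<close> only through labelings described by sets of
  literals, so the analysis of the rounds does not mention trees.\<close>

locale machine = implications "{..<nlits n}" "lbar n" 0 imp f
  for n :: nat and imp :: "nat \<Rightarrow> nat \<Rightarrow> bool" and f :: "nat set \<Rightarrow> real" +
  fixes orac :: "(nat \<Rightarrow> nat) \<Rightarrow> real" and x ch :: "nat \<Rightarrow> nat"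
  assumes orac: "(\<And>i. i \<in> {1..n} \<Longrightarrow> u i = labels n x ch A i) \<Longrightarrow> orac u = f A"
begin

abbreviation "N \<equiv> nlits n"
abbreviation "lay \<equiv> layout n x ch imp"
abbreviation "holds \<equiv> holds_set n x ch"
abbreviation "rv s y \<equiv> (\<lambda>l. rmem s y [l])"
abbreviation "nv s y \<equiv> (\<lambda>l. nmem s y [l])"

lemma query_holds: "holds I s \<Longrightarrow> orac (\<lambda>i. nmem s ''a'' [i]) = f I"
  by (rule orac) (auto simp: holds_set_def)

text \<open>Consistency of \<open>I \<union> cl l\<close> makes the writes to \<open>a\<close>
  independent of their order: no coordinate receives both children.\<close>

lemma runs_add_cl:
  assumes lay: "lay s0" and I: "holds I s0" and l: "l < N"
    and e: "\<And>s. same_outside {''i'', ''in'', ''a'', ''skip''} s0 s \<Longrightarrow> nval s e = l"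
    and con: "\<forall>m\<in>I \<union> cl l. lbar n m \<notin> I \<union> cl l"
  shows "runs orac (add_cl e) s0 (2 + N * 5) (holds (I \<union> cl l))"
proof -
  have W: "insert ''i'' (writes (Cond (Imp e (V ''i''))
     (Seq (NAssign ''in'' [V ''i''] (NConst 1)) (NAssign ''a'' [NLoad ''var'' [V ''i'']] (NLoad ''ch'' [V ''i''])))
     Skip)) = {''i'', ''in'', ''a'', ''skip''}" by auto
  have "runs orac (add_cl e) s0 (2 + N * (3 + 2)) (holds (I \<union> {m\<in>cl l. m < N}))"
    unfolding add_cl_def
  proof (rule runs_For[where I = "\<lambda>j. holds (I \<union> {m\<in>cl l. m < j})"], unfold W)
    show "same_outside {''i'', ''in'', ''a'', ''skip''} s0 s \<Longrightarrow> nval s (V ''L'') = N" for s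
      using layout_same[OF _ _ lay] by (auto simp: layout_def)
    show "holds (I \<union> {m\<in>cl l. m < 0}) (nupdate ''i'' [] 0 s0)" using I by (simp add: holds_set_def)
    fix j s
    assume j: "j < N" and so: "same_outside {''i'', ''in'', ''a'', ''skip''} s0 s" and ij: "nmem s ''i'' [] = j"
      and h: "holds (I \<union> {m\<in>cl l. m < j}) s"
    have lay: "lay s" by (rule layout_same[OF so _ lay]) simp
    then have [simp]: "nmem s ''var'' [j] = lvar n j" "nmem s ''ch'' [j] = ch j"
      "0 < nmem s ''imp'' [l, j] \<longleftrightarrow> imp l j"
      using j l unfolding layout_def by blast+
    have [simp]: "nval s e = l" by (rule e[OF so])
    let ?I = "I \<union> {m\<in>cl l. m < j}"
    show "runs orac (Cond (Imp e (V ''i''))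
       (Seq (NAssign ''in'' [V ''i''] (NConst 1)) (NAssign ''a'' [NLoad ''var'' [V ''i'']] (NLoad ''ch'' [V ''i''])))
       Skip) s 3 (\<lambda>s'. holds (I \<union> {m \<in> cl l. m < Suc j}) (nupdate ''i'' [] (Suc j) s'))"
    proof (cases "imp l j")
      case True
      then have eq: "I \<union> {m \<in> cl l. m < Suc j} = insert j ?I" by (auto simp: cl_def less_Suc_eq)
      have "j \<in> I \<union> cl l" using True by (simp add: cl_def)
      then have "lbar n j \<notin> ?I" using con by auto
      then have ins: "labels n x ch (insert j ?I) i = (if i = lvar n j then ch j else labels n x ch ?I i)" if "i \<le> n" for i
        by (rule labels_insert[OF j that])
      then show ?thesis using h True ij j unfolding eq by (auto simp: holds_set_def)
    next
      case False
      then have "I \<union> {m \<in> cl l. m < Suc j} = ?I" by (auto simp: cl_def less_Suc_eq)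
      then show ?thesis using h False ij by (simp add: holds_set_def)
    qed
  qed simp
  moreover have "{m\<in>cl l. m < N} = cl l" using imp_in by (auto simp: cl_def)
  ultimately show ?thesis by simp
qed

lemma runs_set_base:
  assumes lay: "lay s0" and l: "alive l"
    and e: "\<And>s. same_outside {''i'', ''in'', ''a'', ''skip''} s0 s \<Longrightarrow> nval s e = l"
  shows "runs orac (set_base e) s0 (6 + N * 11) (holds (cl l))"
  unfolding set_base_def
proof (rule runs_Seq)
  show "runs orac (For ''i'' (V ''L'') (NAssign ''in'' [V ''i''] (NConst 0))) s0 (2 + N * (1 + 2))
    (\<lambda>s. \<forall>l<N. nmem s ''in'' [l] = 0)"
  proof (rule runs_For)
    fix s assume "same_outside (insert ''i'' (writes (NAssign ''in'' [V ''i''] (NConst 0)))) s0 s"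
    then have "lay s" by (rule layout_same[OF _ _ lay]) simp
    then show "nval s (V ''L'') = N" by (simp add: layout_def)
  qed (simp_all add: less_Suc_eq)
  fix s1 assume in0: "\<forall>l<N. nmem s1 ''in'' [l] = 0"
    and "same_outside (writes (For ''i'' (V ''L'') (NAssign ''in'' [V ''i''] (NConst 0)))) s0 s1"
  then have so1: "same_outside {''i'', ''in''} s0 s1" by simp
  have lay1: "lay s1" by (rule layout_same[OF so1 _ lay]) simp
  show "runs orac (Seq (For ''i'' (V ''h'') (NAssign ''a'' [V ''i''] (NLoad ''x'' [V ''i'']))) (add_cl e)) s1
      (4 + N * 8) (holds (cl l))"
  proof (rule runs_Seq)
    have "n + 1 \<le> N" by (simp add: nlits_def)
    then show "2 + (n + 1) * (1 + 2) + (2 + N * 5) \<le> 4 + N * 8" by simp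
    show "runs orac (For ''i'' (V ''h'') (NAssign ''a'' [V ''i''] (NLoad ''x'' [V ''i'']))) s1 (2 + (n + 1) * (1 + 2))
       (\<lambda>s. \<forall>i<n+1. nmem s ''a'' [i] = x i)"
    proof (rule runs_For)
      fix s assume "same_outside (insert ''i'' (writes (NAssign ''a'' [V ''i''] (NLoad ''x'' [V ''i''])))) s1 s"
      then have "lay s" by (intro layout_same[OF _ _ lay1]) auto
      then show "nval s (V ''h'') = n + 1" by (simp add: layout_def)
    next
      fix j s assume "same_outside (insert ''i'' (writes (NAssign ''a'' [V ''i''] (NLoad ''x'' [V ''i''])))) s1 s"
        "j < n + 1" "nmem s ''i'' [] = j" "\<forall>i<j. nmem s ''a'' [i] = x i"
      moreover from this have "lay s" by (intro layout_same[OF _ _ lay1]) auto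
      ultimately show "runs orac (NAssign ''a'' [V ''i''] (NLoad ''x'' [V ''i''])) s 1
          (\<lambda>s'. \<forall>i<Suc j. nmem (nupdate ''i'' [] (Suc j) s') ''a'' [i] = x i)"
        by (auto simp: layout_def less_Suc_eq)
    qed auto
    fix s2 assume a: "\<forall>i<n+1. nmem s2 ''a'' [i] = x i"
      and "same_outside (writes (For ''i'' (V ''h'') (NAssign ''a'' [V ''i''] (NLoad ''x'' [V ''i''])))) s1 s2"
    then have so2: "same_outside {''i'', ''a''} s1 s2" by simp
    have lay2: "lay s2" by (rule layout_same[OF so2 _ lay1]) simp
    have "nmem s2 ''in'' = nmem s1 ''in''" using so2 by (rule same_outsideD) simp
    then have h: "holds {} s2" using in0 a by (auto simp: holds_set_def labels_def)
    have so02: "same_outside {''i'', ''in'', ''a'', ''skip''} s0 s2"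
      using same_outside_trans[OF same_outside_mono[OF so1] same_outside_mono[OF so2]] by auto
    have c: "cl l \<in> ideals imp" by (rule cl_ideal[OF l])
    have "runs orac (add_cl e) s2 (2 + N * 5) (holds ({} \<union> cl l))"
    proof (rule runs_add_cl[OF lay2 h])
      show "l < N" using l by (simp add: alive_def)
      show "same_outside {''i'', ''in'', ''a'', ''skip''} s2 s \<Longrightarrow> nval s e = l" for s
        using e same_outside_trans[OF so02] by blast
      show "\<forall>m\<in>{} \<union> cl l. lbar n m \<notin> {} \<union> cl l" using c by (auto simp: ideals_def)
    qed
    then show "runs orac (add_cl e) s2 (2 + N * 5) (holds (cl l))" by simp
  qed
qed auto

lemma runs_blocking:
  assumes lay: "lay s0" and l: "nmem s0 ''l'' [] = l" "l < N"
  shows "runs orac blocking_com s0 (2 + N * (5 + N * 4)) (\<lambda>s. blocking (cl l) (rv s0 ''z'') (nv s ''mi''))"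
proof -
  let ?z = "rv s0 ''z''"
  \<comment> \<open>\<open>ok k j m\<close> is the condition of \<open>blocking\<close> for the
    single literal \<open>k\<close> with \<open>mi k = m\<close>, after the literals below
    \<open>j\<close> have been inspected.\<close>
  define ok where "ok k j m \<longleftrightarrow> imp k m \<and> (m = k \<or> m \<notin> cl l) \<and> ?z k \<le> ?z m \<and>
    (\<forall>m'<j. imp k m' \<longrightarrow> m' \<notin> cl l \<longrightarrow> ?z m' \<le> ?z m)" for k j m
  let ?inner = "Cond (BAnd (Imp (V ''k'') (V ''m'')) (BAnd (BNot (Imp (V ''l'') (V ''m'')))
        (RLess (RLoad ''z'' [NLoad ''mi'' [V ''k'']]) (RLoad ''z'' [V ''m'']))))
      (NAssign ''mi'' [V ''k''] (V ''m'')) Skip"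
  have pres: "lay s \<and> rmem s ''z'' = rmem s0 ''z'' \<and> nmem s ''l'' [] = l"
    if "same_outside {''k'', ''mi'', ''m'', ''skip''} s0 s" for s
  proof -
    have "lay s" by (rule layout_same[OF that _ lay]) simp
    then show ?thesis using l by (simp add: same_outsideD[OF that])
  qed
  have "runs orac blocking_com s0 (2 + N * (3 + N * 4 + 2)) (\<lambda>s. \<forall>k<N. ok k N (nmem s ''mi'' [k]))"
    unfolding blocking_com_def
  proof (rule runs_For[where I = "\<lambda>j s. \<forall>k<j. ok k N (nmem s ''mi'' [k])"])
    show "same_outside (insert ''k'' (writes (Seq (NAssign ''mi'' [V ''k''] (V ''k'')) (For ''m'' (V ''L'') ?inner)))) s0 s
      \<Longrightarrow> nval s (V ''L'') = N" for s using pres[of s] by (auto simp: layout_def insert_commute)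
    fix k s
    assume k: "k < N" "nmem s ''k'' [] = k" and IH: "\<forall>k'<k. ok k' N (nmem s ''mi'' [k'])"
      and "same_outside (insert ''k'' (writes (Seq (NAssign ''mi'' [V ''k''] (V ''k'')) (For ''m'' (V ''L'') ?inner)))) s0 s"
    then have so: "same_outside {''k'', ''mi'', ''m'', ''skip''} s0 s" by (simp add: insert_commute)
    define s1 where "s1 = nupdate ''mi'' [k] k s"
    have so1: "same_outside {''k'', ''mi'', ''m'', ''skip''} s0 s1"
      using so by (simp add: s1_def same_outside_nupdate)
    have "runs orac (For ''m'' (V ''L'') ?inner) s1 (2 + N * (2 + 2))
       (\<lambda>s'. nmem s' ''k'' [] = k \<and> (\<forall>k'<k. ok k' N (nmem s' ''mi'' [k'])) \<and> ok k N (nmem s' ''mi'' [k]))"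
    proof (rule runs_For[where I = "\<lambda>j s'. nmem s' ''k'' [] = k \<and> (\<forall>k'<k. ok k' N (nmem s' ''mi'' [k'])) \<and>
        ok k j (nmem s' ''mi'' [k])"])
      have W: "insert ''m'' (writes ?inner) \<subseteq> {''k'', ''mi'', ''m'', ''skip''}" by simp
      show "same_outside (insert ''m'' (writes ?inner)) s1 s \<Longrightarrow> nval s (V ''L'') = N" for s
        using pres[OF same_outside_trans[OF so1 same_outside_mono[OF _ W]], of s] by (auto simp: layout_def)
      show "nmem (nupdate ''m'' [] 0 s1) ''k'' [] = k \<and> (\<forall>k'<k. ok k' N (nmem (nupdate ''m'' [] 0 s1) ''mi'' [k'])) \<and>
        ok k 0 (nmem (nupdate ''m'' [] 0 s1) ''mi'' [k])"
        using k IH imp_refl by (auto simp: s1_def ok_def)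
      fix j s'
      assume j: "j < N" "nmem s' ''m'' [] = j" and so': "same_outside (insert ''m'' (writes ?inner)) s1 s'"
        and I: "nmem s' ''k'' [] = k \<and> (\<forall>k'<k. ok k' N (nmem s' ''mi'' [k'])) \<and> ok k j (nmem s' ''mi'' [k])"
      have pr: "lay s'" "rmem s' ''z'' = rmem s0 ''z''" "nmem s' ''l'' [] = l"
        using pres[OF same_outside_trans[OF so1 same_outside_mono[OF so' W]]] by auto
      have "0 < nmem s' ''imp'' [k, j] \<longleftrightarrow> imp k j" "0 < nmem s' ''imp'' [l, j] \<longleftrightarrow> imp l j"
        using pr(1) k j l unfolding layout_def by blast+
      then show "runs orac ?inner s' 2 (\<lambda>s'. nmem (nupdate ''m'' [] (Suc j) s') ''k'' [] = k \<and>
         (\<forall>k'<k. ok k' N (nmem (nupdate ''m'' [] (Suc j) s') ''mi'' [k'])) \<and>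
         ok k (Suc j) (nmem (nupdate ''m'' [] (Suc j) s') ''mi'' [k]))"
        using I j pr by (auto simp: ok_def less_Suc_eq cl_def)
    qed simp
    then have "runs orac (For ''m'' (V ''L'') ?inner) s1 (2 + N * 4)
       (\<lambda>s'. \<forall>k'<Suc k. ok k' N (nmem (nupdate ''k'' [] (Suc k) s') ''mi'' [k']))"
      by (rule runs_conseq) (auto simp: less_Suc_eq)
    then show "runs orac (Seq (NAssign ''mi'' [V ''k''] (V ''k'')) (For ''m'' (V ''L'') ?inner)) s (3 + N * 4)
       (\<lambda>s'. \<forall>k'<Suc k. ok k' N (nmem (nupdate ''k'' [] (Suc k) s') ''mi'' [k']))"
      using k by (simp add: s1_def)
  qed auto
  then show ?thesis
    by (rule runs_conseq) (auto simp: blocking_def ok_def dest: imp_in)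
qed

lemma runs_weight:
  assumes lay: "lay s0"
  shows "runs orac weight_com s0 (2 + N * (2 + 2)) (\<lambda>s. \<forall>k<N. rmem s ''p'' [k] = weight (rv s0 ''z'') (nv s0 ''mi'') k)"
  unfolding weight_com_def
proof (rule runs_For)
  let ?c = "Cond (RLess (RLoad ''z'' [NLoad ''mi'' [V ''k'']]) zero_r)
     (RAssign ''p'' [V ''k''] (RSub zero_r (RLoad ''z'' [NLoad ''mi'' [V ''k'']])))
     (RAssign ''p'' [V ''k''] zero_r)"
  fix s assume so: "same_outside (insert ''k'' (writes ?c)) s0 s"
  then have "lay s" by (rule layout_same[OF _ _ lay]) simp
  then show "nval s (V ''L'') = N" by (simp add: layout_def)
  have eq: "nmem s ''mi'' = nmem s0 ''mi''" "rmem s ''z'' = rmem s0 ''z''"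
    using so by (simp_all add: same_outsideD)
  fix j assume "nmem s ''k'' [] = j" "\<forall>k<j. rmem s ''p'' [k] = weight (rv s0 ''z'') (nv s0 ''mi'') k"
  then show "runs orac ?c s 2
    (\<lambda>s'. \<forall>k<Suc j. rmem (nupdate ''k'' [] (Suc j) s') ''p'' [k] = weight (rv s0 ''z'') (nv s0 ''mi'') k)"
    by (auto simp: weight_def less_Suc_eq eq)
qed auto

end

definition oracle_steps :: "nat \<Rightarrow> nat" where
  "oracle_steps n = 20 + nlits n * (45 + nlits n * 13)"

context machine begin

text \<open>The form of transitivity needed when a running best candidate is replaced.\<close>

lemma better_not: "\<not> better p m b \<Longrightarrow> better p b' b \<Longrightarrow> \<not> better p m b'"
  using imp_trans unfolding better_def by (metis less_trans)

lemma alive_less: "alive l \<Longrightarrow> l < N"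
  by (simp add: alive_def)

lemma candidate_less: "candidate I m \<Longrightarrow> m < N"
  by (simp add: candidate_def alive_def)

lemma lay_imp: "lay s \<Longrightarrow> l < N \<Longrightarrow> m < N \<Longrightarrow> 0 < nmem s ''imp'' [l, m] \<longleftrightarrow> imp l m"
  unfolding layout_def by blast

lemma lay_L: "lay s \<Longrightarrow> nmem s ''L'' [] = N"
  and lay_bar: "lay s \<Longrightarrow> l < N \<Longrightarrow> nmem s ''bar'' [l] = lbar n l"
  by (simp_all add: layout_def)

lemma bval_candidate:
  assumes "lay s" "holds I s" "nval s e = j" "j < N"
  shows "bval s (candidate_exp e) \<longleftrightarrow> candidate I j"
  using assms lbar_less[OF assms(4)]
  by (simp add: candidate_exp_def lay_bar lay_imp candidate_def alive_def holds_set_def)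

lemma bval_better:
  assumes "lay s" "\<forall>k<N. rmem s ''p'' [k] = p k" "nval s e = m" "m < N" "nval s e' = b" "b < N"
  shows "bval s (better_exp e e') \<longleftrightarrow> better p m b"
  using assms by (auto simp: better_exp_def better_def lay_imp)

lemma runs_select:
  assumes lay: "lay s0" and I: "holds I s0" and p: "\<forall>k<N. rmem s0 ''p'' [k] = p k"
  shows "runs orac select_com s0 (3 + N * 4) (\<lambda>s. nmem s ''best'' [] = N \<and> (\<forall>m. \<not> candidate I m) \<or>
    candidate I (nmem s ''best'' []) \<and> (\<forall>m. candidate I m \<longrightarrow> \<not> better p m (nmem s ''best'' [])))"
proof -
  let ?c = "Cond (BAnd (candidate_exp (V ''m'')) (BNot (BAnd (NLess (V ''best'') (V ''L''))
        (BNot (better_exp (V ''m'') (V ''best'')))))) (NAssign ''best'' [] (V ''m'')) Skip"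
  let ?s = "nupdate ''best'' [] N s0"
  define ok where "ok j b \<longleftrightarrow> b = N \<and> (\<forall>m<j. \<not> candidate I m) \<or>
    candidate I b \<and> (\<forall>m<j. candidate I m \<longrightarrow> \<not> better p m b)" for j b
  have so0: "same_outside {''best'', ''m'', ''skip''} s0 ?s"
    by (simp add: same_outside_nupdate same_outside_refl)
  have pres: "lay s \<and> holds I s \<and> (\<forall>k<N. rmem s ''p'' [k] = p k)"
    if "same_outside (insert ''m'' (writes ?c)) ?s s" for s
  proof -
    have so: "same_outside {''best'', ''m'', ''skip''} s0 s"
      using same_outside_trans[OF so0 same_outside_mono[OF that]] by simp
    have "lay s" by (rule layout_same[OF so _ lay]) simp
    moreover have "holds I s" by (rule holds_set_same[OF so _ I]) simp
    ultimately show ?thesis using p by (simp add: same_outsideD(2)[OF so])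
  qed
  have "runs orac (For ''m'' (V ''L'') ?c) ?s (2 + N * (2 + 2)) (\<lambda>s. ok N (nmem s ''best'' []))"
  proof (rule runs_For[where I = "\<lambda>j s. ok j (nmem s ''best'' [])"])
    show "same_outside (insert ''m'' (writes ?c)) ?s s \<Longrightarrow> nval s (V ''L'') = N" for s
      using pres[of s] by (simp add: lay_L)
    show "ok 0 (nmem (nupdate ''m'' [] 0 ?s) ''best'' [])" by (simp add: ok_def)
    fix j s
    assume j: "j < N" "nmem s ''m'' [] = j" and so: "same_outside (insert ''m'' (writes ?c)) ?s s"
      and ok: "ok j (nmem s ''best'' [])"
    let ?b = "nmem s ''best'' []"
    note pr = pres[OF so]
    have c: "bval s (candidate_exp (V ''m'')) \<longleftrightarrow> candidate I j"
      using pr j by (intro bval_candidate) auto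
    have d: "bval s (better_exp (V ''m'') (V ''best'')) \<longleftrightarrow> better p j ?b" if "?b < N"
      using pr j that by (intro bval_better) auto
    have guard: "bval s (BAnd (candidate_exp (V ''m'')) (BNot (BAnd (NLess (V ''best'') (V ''L''))
        (BNot (better_exp (V ''m'') (V ''best'')))))) \<longleftrightarrow> candidate I j \<and> (?b < N \<longrightarrow> better p j ?b)"
      using c d pr lay_L by auto
    have irr: "\<not> better p j j" by (simp add: better_def)
    show "runs orac ?c s 2 (\<lambda>s'. ok (Suc j) (nmem (nupdate ''m'' [] (Suc j) s') ''best'' []))"
    proof (cases "candidate I j \<and> (?b < N \<longrightarrow> better p j ?b)")
      case True
      have "\<not> better p m j" if "m < j" "candidate I m" for m
        using ok that True candidate_less[of I ?b] better_not[of p m ?b j] unfolding ok_def by blast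
      then have "ok (Suc j) j" using True irr unfolding ok_def by (auto simp: less_Suc_eq)
      then show ?thesis unfolding runs_Cond guard using True j by simp
    next
      case False
      then have "ok (Suc j) ?b"
        using ok candidate_less[of I ?b] unfolding ok_def by (auto simp: less_Suc_eq)
      then show ?thesis unfolding runs_Cond guard using False by auto
    qed
  qed simp
  then have "runs orac (For ''m'' (V ''L'') ?c) ?s (2 + N * 4)
    (\<lambda>s. nmem s ''best'' [] = N \<and> (\<forall>m. \<not> candidate I m) \<or>
    candidate I (nmem s ''best'' []) \<and> (\<forall>m. candidate I m \<longrightarrow> \<not> better p m (nmem s ''best'' [])))"
    by (rule runs_conseq) (use candidate_less in \<open>auto simp: ok_def\<close>)
  then show ?thesis by (simp add: select_com_def lay_L[OF lay])
qed

lemma runs_grow: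
  assumes lay: "lay s0" and I: "holds I s0" "I \<in> ideals imp" and b: "candidate I b" "nmem s0 ''best'' [] = b"
    and u: "rmem s0 ''u'' [] = f I"
  shows "runs orac grow_com s0 (6 + N * 5) (\<lambda>s. holds (I \<union> cl b) s \<and> rmem s ''u'' [] = f (I \<union> cl b) \<and>
    (\<forall>a. rmem s ''q'' [a] = ((rv s0 ''q'')(b := f (I \<union> cl b) - f I, lbar n b := f I - f (I \<union> cl b))) a))"
  unfolding grow_com_def
proof (rule runs_Seq)
  have bl: "b < N" using candidate_less[OF b(1)] .
  have J: "I \<union> cl b \<in> ideals imp" using extend_ideal(1)[OF I(2)] b(1) by (simp add: candidate_def)
  show "runs orac (add_cl (V ''best'')) s0 (2 + N * 5) (holds (I \<union> cl b))"
  proof (rule runs_add_cl[OF lay I(1) bl])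
    show "same_outside {''i'', ''in'', ''a'', ''skip''} s0 s \<Longrightarrow> nval s (V ''best'') = b" for s
      using b(2) by (simp add: same_outsideD)
    show "\<forall>m\<in>I \<union> cl b. lbar n m \<notin> I \<union> cl b" using J unfolding ideals_def by blast
  qed
  show "2 + N * 5 + 4 \<le> 6 + N * 5" by simp
  fix s assume h: "holds (I \<union> cl b) s" and "same_outside (writes (add_cl (V ''best''))) s0 s"
  then have so: "same_outside {''i'', ''in'', ''a'', ''skip''} s0 s"
    using same_outside_mono[OF _ writes_add_cl] by blast
  have l: "lay s" by (rule layout_same[OF so _ lay]) simp
  have eq: "nmem s ''best'' [] = b" "rmem s ''u'' [] = f I" "rmem s ''q'' = rmem s0 ''q''"
    using b(2) u by (simp_all add: same_outsideD[OF so])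
  have "holds (I \<union> cl b) (rupdate y ks r s')" if "holds (I \<union> cl b) s'" for y ks r s'
    using that by (simp add: holds_set_def)
  then show "runs orac (Seq (Query ''v'' [] ''a'') (Seq (RAssign ''q'' [V ''best''] (RSub (R ''v'') (R ''u'')))
     (Seq (RAssign ''q'' [bar_exp (V ''best'')] (RSub (R ''u'') (R ''v'')))
     (RAssign ''u'' [] (R ''v''))))) s 4 (\<lambda>s. holds (I \<union> cl b) s \<and> rmem s ''u'' [] = f (I \<union> cl b) \<and>
    (\<forall>a. rmem s ''q'' [a] = ((rv s0 ''q'')(b := f (I \<union> cl b) - f I, lbar n b := f I - f (I \<union> cl b))) a))"
    using h eq bl by (simp add: query_holds[OF h] lay_bar[OF l])
qed

lemma runs_chain:
  assumes lay: "lay s0" and l: "alive l" "nmem s0 ''l'' [] = l" and p: "\<forall>k<N. rmem s0 ''p'' [k] = p k"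
  shows "runs orac chain_com s0 (11 + N * (26 + N * 9))
    (\<lambda>s. \<exists>I b. chain p (cl l) I b \<and> (\<forall>m. \<not> candidate I m) \<and> (\<forall>a<N. rmem s ''q'' [a] = b a))"
proof -
  let ?W = "{''k'', ''q'', ''i'', ''in'', ''a'', ''skip'', ''v'', ''u'', ''best'', ''m''}"
  have B: "cl l \<in> ideals imp" by (rule cl_ideal[OF l(1)])
  have pres: "lay s \<and> (\<forall>k<N. rmem s ''p'' [k] = p k) \<and> nmem s ''l'' [] = l" if "same_outside ?W s0 s" for s
  proof -
    have "lay s" by (rule layout_same[OF that _ lay]) simp
    then show ?thesis using p l by (simp add: same_outsideD[OF that])
  qed
  let ?c0 = "For ''k'' (V ''L'') (RAssign ''q'' [V ''k''] zero_r)"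
  let ?step = "Seq select_com (Cond (NLess (V ''best'') (V ''L'')) grow_com Skip)"
  have Wstep: "insert ''k'' (writes ?step) \<subseteq> ?W"
    by (simp add: select_com_def grow_com_def add_cl_def)
  show ?thesis unfolding chain_com_def
  proof (rule runs_Seq)
    show "runs orac ?c0 s0 (2 + N * (1 + 2)) (\<lambda>s. \<forall>a<N. rmem s ''q'' [a] = 0)"
    proof (rule runs_For[where I = "\<lambda>j s. \<forall>a<j. rmem s ''q'' [a] = 0"])
      fix s assume "same_outside (insert ''k'' (writes (RAssign ''q'' [V ''k''] zero_r))) s0 s"
      then have "lay s" by (rule layout_same[OF _ _ lay]) simp
      then show "nval s (V ''L'') = N" by (simp add: lay_L)
    qed (simp_all add: less_Suc_eq)
    show "2 + N * (1 + 2) + (9 + N * (23 + N * 9)) \<le> 11 + N * (26 + N * 9)" by (simp add: algebra_simps)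
    fix s1 assume q1: "\<forall>a<N. rmem s1 ''q'' [a] = 0" and "same_outside (writes ?c0) s0 s1"
    then have so1: "same_outside ?W s0 s1" by (elim same_outside_mono) simp
    show "runs orac (Seq (set_base (V ''l'')) (Seq (Query ''u'' [] ''a'') (For ''k'' (V ''L'') ?step)))
       s1 (9 + N * (23 + N * 9))
       (\<lambda>s. \<exists>I b. chain p (cl l) I b \<and> (\<forall>m. \<not> candidate I m) \<and> (\<forall>a<N. rmem s ''q'' [a] = b a))"
    proof (rule runs_Seq)
      show "runs orac (set_base (V ''l'')) s1 (6 + N * 11) (holds (cl l))"
      proof (rule runs_set_base[OF _ l(1)])
        show "lay s1" using pres[OF so1] by blast
        show "same_outside {''i'', ''in'', ''a'', ''skip''} s1 s \<Longrightarrow> nval s (V ''l'') = l" for s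
          using pres[OF so1] by (simp add: same_outsideD)
      qed
      show "6 + N * 11 + (3 + N * (12 + N * 9)) \<le> 9 + N * (23 + N * 9)" by (simp add: algebra_simps)
      fix s2 assume h: "holds (cl l) s2" and "same_outside (writes (set_base (V ''l''))) s1 s2"
      then have so12: "same_outside {''i'', ''in'', ''a'', ''skip''} s1 s2"
        using same_outside_mono[OF _ writes_set_base] by blast
      define s3 where "s3 = rupdate ''u'' [] (f (cl l)) s2"
      have so3: "same_outside ?W s0 s3"
        unfolding s3_def using same_outside_trans[OF so1 same_outside_mono[OF so12]]
        by (simp add: same_outside_rupdate)
      have q3: "\<forall>a<N. rmem s3 ''q'' [a] = 0" using q1 by (simp add: s3_def same_outsideD[OF so12])
      \<comment> \<open>Each iteration that finds a candidate enlarges the set, so after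
        \<open>j\<close> iterations the chain is complete or has at least \<open>j\<close>
        elements.\<close>
      define J where "J j s \<longleftrightarrow> (\<exists>I b. holds I s \<and> chain p (cl l) I b \<and> rmem s ''u'' [] = f I \<and>
        (\<forall>a<N. rmem s ''q'' [a] = b a) \<and> ((\<forall>m. \<not> candidate I m) \<or> j \<le> card I))" for j s
      have J_k: "J j (nupdate ''k'' [] v s) = J j s" for j v s by (simp add: J_def holds_set_def)
      have "runs orac (For ''k'' (V ''L'') ?step) s3 (2 + N * ((10 + N * 9) + 2)) (J N)"
      proof (rule runs_For)
        show "''k'' \<notin> writes ?step" by (simp add: select_com_def grow_com_def add_cl_def)
        have pres3: "lay s \<and> (\<forall>k<N. rmem s ''p'' [k] = p k) \<and> nmem s ''l'' [] = l"
          if "same_outside (insert ''k'' (writes ?step)) s3 s" for s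
          by (rule pres[OF same_outside_trans[OF so3 same_outside_mono[OF that Wstep]]])
        show "same_outside (insert ''k'' (writes ?step)) s3 s \<Longrightarrow> nval s (V ''L'') = N" for s
          using pres3[of s] by (simp add: lay_L)
        have "holds (cl l) s3" using h by (simp add: s3_def holds_set_def)
        then show "J 0 (nupdate ''k'' [] 0 s3)" unfolding J_k
          unfolding J_def using q3 chain.base[of p "cl l"] by (auto simp: s3_def intro!: exI)
        fix j s
        assume "j < N" and "same_outside (insert ''k'' (writes ?step)) s3 s" and "J j s"
        then obtain I b where pr: "lay s" "\<forall>k<N. rmem s ''p'' [k] = p k" and I: "holds I s"
          and ch: "chain p (cl l) I b" and u: "rmem s ''u'' [] = f I" and q: "\<forall>a<N. rmem s ''q'' [a] = b a"
          and card: "(\<forall>m. \<not> candidate I m) \<or> j \<le> card I"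
          using pres3 unfolding J_def by blast
        have Iid: "I \<in> ideals imp" using chain_ideal[OF ch B] by blast
        show "runs orac ?step s (10 + N * 9) (\<lambda>s'. J (Suc j) (nupdate ''k'' [] (Suc j) s'))"
          unfolding J_k
        proof (rule runs_Seq[OF runs_select[OF pr(1) I pr(2)]])
          show "3 + N * 4 + (7 + N * 5) \<le> 10 + N * 9" by simp
          fix s' assume post: "nmem s' ''best'' [] = N \<and> (\<forall>m. \<not> candidate I m) \<or>
              candidate I (nmem s' ''best'' []) \<and> (\<forall>m. candidate I m \<longrightarrow> \<not> better p m (nmem s' ''best'' []))"
            and "same_outside (writes select_com) s s'"
          then have so: "same_outside {''best'', ''m'', ''skip''} s s'"
            using same_outside_mono[OF _ writes_select] by blast
          have lay': "lay s'" by (rule layout_same[OF so _ pr(1)]) simp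
          have I': "holds I s'" by (rule holds_set_same[OF so _ I]) simp
          have uq: "rmem s' ''u'' [] = f I" "\<forall>a<N. rmem s' ''q'' [a] = b a"
            using u q by (simp_all add: same_outsideD[OF so])
          show "runs orac (Cond (NLess (V ''best'') (V ''L'')) grow_com Skip) s' (7 + N * 5) (J (Suc j))"
          proof (cases "nmem s' ''best'' [] < N")
            case True
            let ?b = "nmem s' ''best'' []"
            from post True have c: "candidate I ?b" and best: "\<And>m. candidate I m \<Longrightarrow> \<not> better p m ?b" by auto
            have "runs orac grow_com s' (6 + N * 5) (J (Suc j))"
            proof (rule runs_conseq[OF runs_grow[OF lay' I' Iid c refl uq(1)]])
              fix s'' assume g: "holds (I \<union> cl ?b) s'' \<and> rmem s'' ''u'' [] = f (I \<union> cl ?b) \<and>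
                (\<forall>a. rmem s'' ''q'' [a] = ((rv s' ''q'')(?b := f (I \<union> cl ?b) - f I, lbar n ?b := f I - f (I \<union> cl ?b))) a)"
              have "\<forall>a<N. rmem s'' ''q'' [a] = (b(?b := f (I \<union> cl ?b) - f I, lbar n ?b := f I - f (I \<union> cl ?b))) a"
                using g uq(2) by simp
              moreover have "chain p (cl l) (I \<union> cl ?b) (b(?b := f (I \<union> cl ?b) - f I, lbar n ?b := f I - f (I \<union> cl ?b)))"
                by (rule chain.step[OF ch c best])
              moreover have "Suc j \<le> card (I \<union> cl ?b)"
              proof -
                have fin: "finite (I \<union> cl ?b)"
                  using extend_ideal(1)[OF Iid] c ideal_finite by (auto simp: candidate_def)
                have "?b \<in> cl ?b" using True by (intro cl_self) simp
                then have "I \<subset> I \<union> cl ?b" using c by (auto simp: candidate_def)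
                then show ?thesis using psubset_card_mono[OF fin] card c by fastforce
              qed
              ultimately show "J (Suc j) s''" unfolding J_def using g by blast
            qed simp
            then show ?thesis using True lay_L[OF lay'] by simp
          next
            case False
            then have none: "\<forall>m. \<not> candidate I m" using post candidate_less by blast
            have "J (Suc j) s'" unfolding J_def using I' ch uq none by blast
            then have "J (Suc j) (nupdate ''skip'' [] 0 s')" by (simp add: J_def holds_set_def)
            then show ?thesis using False lay_L[OF lay'] by simp
          qed
        qed
      qed
      then have "runs orac (For ''k'' (V ''L'') ?step) s3 (2 + N * (12 + N * 9))
        (\<lambda>s. \<exists>I b. chain p (cl l) I b \<and> (\<forall>m. \<not> candidate I m) \<and> (\<forall>a<N. rmem s ''q'' [a] = b a))"
      proof (rule runs_conseq)
        fix s assume "J N s"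
        then obtain I b where Ib: "chain p (cl l) I b" "\<forall>a<N. rmem s ''q'' [a] = b a"
          "(\<forall>m. \<not> candidate I m) \<or> N \<le> card I" unfolding J_def by blast
        have I: "I \<in> ideals imp" using chain_ideal[OF Ib(1) B] by blast
        \<comment> \<open>An ideal never contains the negation of truth, hence \<open>N\<close>
          iterations always complete the chain.\<close>
        then have "I \<subset> {..<N}" using bar_in[OF tt_in] unfolding ideals_def by blast
        then have "card I < N" using psubset_card_mono[of "{..<N}" I] by simp
        then show "\<exists>I b. chain p (cl l) I b \<and> (\<forall>m. \<not> candidate I m) \<and> (\<forall>a<N. rmem s ''q'' [a] = b a)"
          using Ib by auto
      qed simp
      then show "runs orac (Seq (Query ''u'' [] ''a'') (For ''k'' (V ''L'') ?step)) s2 (3 + N * (12 + N * 9))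
        (\<lambda>s. \<exists>I b. chain p (cl l) I b \<and> (\<forall>m. \<not> candidate I m) \<and> (\<forall>a<N. rmem s ''q'' [a] = b a))"
        by (simp add: query_holds[OF h] s3_def)
    qed
  qed
qed

lemma runs_flow:
  assumes lay: "lay s0" and mi: "\<forall>k<N. nmem s0 ''mi'' [k] < N"
  shows "runs orac flow_com s0 (2 + N * (5 + 2))
    (\<lambda>s. \<forall>a. rmem s ''q'' [a] = rmem s0 ''q'' [a] + flow (rv s0 ''z'') (nv s0 ''mi'') (rmem s0 ''K'' []) a)"
proof -
  let ?z = "rv s0 ''z''" and ?mi = "nv s0 ''mi''" and ?K = "rmem s0 ''K'' []"
  define g where "g k a = (if ?z k < 0 then ?K * arc_vector ?mi k a else 0)" for k a
  let ?upd = "Seq (RAssign ''q'' [V ''k''] (RAdd (RLoad ''q'' [V ''k'']) (R ''K'')))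
     (Seq (RAssign ''q'' [bar_exp (V ''k'')] (RSub (RLoad ''q'' [bar_exp (V ''k'')]) (R ''K'')))
     (Seq (RAssign ''q'' [NLoad ''mi'' [V ''k'']] (RSub (RLoad ''q'' [NLoad ''mi'' [V ''k'']]) (R ''K'')))
     (RAssign ''q'' [bar_exp (NLoad ''mi'' [V ''k''])] (RAdd (RLoad ''q'' [bar_exp (NLoad ''mi'' [V ''k''])]) (R ''K'')))))"
  let ?c = "Cond (RLess (RLoad ''z'' [V ''k'']) zero_r) ?upd Skip"
  have W: "insert ''k'' (writes ?c) \<subseteq> {''k'', ''q'', ''skip''}" by simp
  have "runs orac flow_com s0 (2 + N * (5 + 2))
    (\<lambda>s. \<forall>a. rmem s ''q'' [a] = rmem s0 ''q'' [a] + (\<Sum>k<N. g k a))"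
    unfolding flow_com_def
  proof (rule runs_For[where I = "\<lambda>j s. \<forall>a. rmem s ''q'' [a] = rmem s0 ''q'' [a] + (\<Sum>k<j. g k a)"])
    fix s assume "same_outside (insert ''k'' (writes ?c)) s0 s"
    then have so: "same_outside {''k'', ''q'', ''skip''} s0 s" using same_outside_mono[OF _ W] by blast
    have lay': "lay s" by (rule layout_same[OF so _ lay]) simp
    then show "nval s (V ''L'') = N" by (simp add: lay_L)
    fix j assume j: "j < N" "nmem s ''k'' [] = j"
      and IH: "\<forall>a. rmem s ''q'' [a] = rmem s0 ''q'' [a] + (\<Sum>k<j. g k a)"
    have eq: "nmem s ''mi'' = nmem s0 ''mi''" "rmem s ''z'' = rmem s0 ''z''" "rmem s ''K'' [] = ?K"
      by (simp_all add: same_outsideD[OF so])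
    have bars: "nmem s ''bar'' [j] = lbar n j" "nmem s ''bar'' [?mi j] = lbar n (?mi j)"
      using mi j lay_bar[OF lay'] by auto
    show "runs orac ?c s 5 (\<lambda>s'. \<forall>a. rmem (nupdate ''k'' [] (Suc j) s') ''q'' [a] = rmem s0 ''q'' [a] + (\<Sum>k<Suc j. g k a))"
    proof (cases "?z j < 0")
      case True
      \<comment> \<open>The four updates are applied in sequence, each reading the current cell;
        coincidences such as \<open>?mi j = j\<close> therefore add up as in
        \<open>arc_vector\<close>.\<close>
      define s1 where "s1 = rupdate ''q'' [j] (rmem s ''q'' [j] + ?K) s"
      define s2 where "s2 = rupdate ''q'' [lbar n j] (rmem s1 ''q'' [lbar n j] - ?K) s1"
      define s3 where "s3 = rupdate ''q'' [?mi j] (rmem s2 ''q'' [?mi j] - ?K) s2"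
      define s4 where "s4 = rupdate ''q'' [lbar n (?mi j)] (rmem s3 ''q'' [lbar n (?mi j)] + ?K) s3"
      have run: "runs orac ?upd s 4 Q \<longleftrightarrow> Q s4" for Q
        unfolding s4_def s3_def s2_def s1_def using j eq bars by simp
      have q1: "rmem s1 ''q'' [a] = rmem s ''q'' [a] + ?K * of_bool (a = j)" for a by (simp add: s1_def)
      have q2: "rmem s2 ''q'' [a] = rmem s1 ''q'' [a] - ?K * of_bool (a = lbar n j)" for a by (simp add: s2_def)
      have q3: "rmem s3 ''q'' [a] = rmem s2 ''q'' [a] - ?K * of_bool (a = ?mi j)" for a by (simp add: s3_def)
      have q4: "rmem s4 ''q'' [a] = rmem s3 ''q'' [a] + ?K * of_bool (a = lbar n (?mi j))" for a by (simp add: s4_def)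
      have "g j a = ?K * of_bool (a = j) - ?K * of_bool (a = lbar n j) - ?K * of_bool (a = ?mi j)
          + ?K * of_bool (a = lbar n (?mi j))" for a
        by (simp only: g_def arc_vector_def True if_True distrib_left right_diff_distrib)
      then have "rmem s4 ''q'' [a] = rmem s ''q'' [a] + g j a" for a
        unfolding q4 q3 q2 q1 by simp
      then have "\<forall>a. rmem s4 ''q'' [a] = rmem s0 ''q'' [a] + (\<Sum>k<Suc j. g k a)" using IH by simp
      then have "runs orac ?upd s 4 (\<lambda>s'. \<forall>a. rmem (nupdate ''k'' [] (Suc j) s') ''q'' [a] = rmem s0 ''q'' [a] + (\<Sum>k<Suc j. g k a))"
        unfolding run by simp
      moreover have "bval s (RLess (RLoad ''z'' [V ''k'']) zero_r)" using True j eq by simp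
      ultimately show ?thesis unfolding runs_Cond by simp
    next
      case False
      then show ?thesis using IH j eq by (simp add: g_def)
    qed
  qed simp_all
  then show ?thesis by (simp add: flow_def g_def)
qed

lemma runs_gap:
  assumes lay: "lay s0"
  shows "runs orac gap_com s0 (3 + N * (1 + 2))
    (\<lambda>s. rmem s ''g'' [] = (\<Sum>k<N. rmem s0 ''z'' [k] * (rmem s0 ''z'' [k] - rmem s0 ''q'' [k])))"
proof -
  let ?s = "rupdate ''g'' [] 0 s0"
  let ?c = "RAssign ''g'' [] (RAdd (R ''g'')
     (RMul (RLoad ''z'' [V ''k'']) (RSub (RLoad ''z'' [V ''k'']) (RLoad ''q'' [V ''k'']))))"
  have "runs orac (For ''k'' (V ''L'') ?c) ?s (2 + N * (1 + 2))
    (\<lambda>s. rmem s ''g'' [] = (\<Sum>k<N. rmem s0 ''z'' [k] * (rmem s0 ''z'' [k] - rmem s0 ''q'' [k])))"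
  proof (rule runs_For[where I = "\<lambda>j s. rmem s ''g'' [] = (\<Sum>k<j. rmem s0 ''z'' [k] * (rmem s0 ''z'' [k] - rmem s0 ''q'' [k]))"])
    fix s assume "same_outside (insert ''k'' (writes ?c)) ?s s"
    then have so: "same_outside {''k'', ''g''} s0 s"
      using same_outside_trans[OF same_outside_rupdate[OF _ same_outside_refl], of "''g''" "{''k'', ''g''}" "[]" 0 s0 s] by simp
    have "lay s" by (rule layout_same[OF so _ lay]) simp
    then show "nval s (V ''L'') = N" by (simp add: lay_L)
    fix j assume "nmem s ''k'' [] = j" "rmem s ''g'' [] = (\<Sum>k<j. rmem s0 ''z'' [k] * (rmem s0 ''z'' [k] - rmem s0 ''q'' [k]))"
    then show "runs orac ?c s 1 (\<lambda>s'. rmem (nupdate ''k'' [] (Suc j) s') ''g'' [] =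
        (\<Sum>k<Suc j. rmem s0 ''z'' [k] * (rmem s0 ''z'' [k] - rmem s0 ''q'' [k])))"
      by (simp add: same_outsideD[OF so])
  qed simp_all
  then show ?thesis unfolding gap_com_def
    by (intro runs_Seq[of orac _ s0 1 "\<lambda>s. s = ?s" "2 + N * (1 + 2)"]) simp_all
qed

text \<open>A relation rather than a function: how ties for \<open>mi\<close> and for the chain are
  resolved is left to the program.\<close>

definition oracle_result :: "nat \<Rightarrow> (nat \<Rightarrow> real) \<Rightarrow> real \<Rightarrow> (nat \<Rightarrow> real) \<Rightarrow> bool" where
  "oracle_result l z K q \<longleftrightarrow> (\<exists>I b mi. blocking (cl l) z mi \<and> chain (weight z mi) (cl l) I b \<and>
     (\<forall>m. \<not> candidate I m) \<and> (\<forall>a<N. q a = b a + flow z mi K a))"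

abbreviation "oracle_time \<equiv> oracle_steps n"

lemma runs_oracle:
  assumes lay: "lay s0" and l: "alive l" "nmem s0 ''l'' [] = l"
  shows "runs orac oracle_com s0 oracle_time (\<lambda>s. oracle_result l (rv s0 ''z'') (rmem s0 ''K'' []) (rv s ''q'') \<and>
    rmem s ''g'' [] = (\<Sum>k<N. rmem s0 ''z'' [k] * (rmem s0 ''z'' [k] - rmem s ''q'' [k])))"
  unfolding oracle_com_def
proof (rule runs_Seq[OF runs_blocking[OF lay l(2) alive_less[OF l(1)]]])
  show "2 + N * (5 + N * 4) + (18 + N * (40 + N * 9)) \<le> oracle_time"
    by (simp add: oracle_steps_def algebra_simps)
  fix s1 assume mi: "blocking (cl l) (rv s0 ''z'') (nv s1 ''mi'')" and "same_outside (writes blocking_com) s0 s1"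
  then have so1: "same_outside {''k'', ''mi'', ''m'', ''skip''} s0 s1"
    using same_outside_mono[OF _ writes_blocking] by blast
  have lay1: "lay s1" by (rule layout_same[OF so1 _ lay]) simp
  have eq1: "rmem s1 ''z'' = rmem s0 ''z''" "rmem s1 ''K'' = rmem s0 ''K''" "nmem s1 ''l'' = nmem s0 ''l''"
    by (simp_all add: same_outsideD[OF so1])
  have miN: "\<forall>k<N. nmem s1 ''mi'' [k] < N" using mi imp_in unfolding blocking_def by (metis lessThan_iff)
  show "runs orac (Seq weight_com (Seq chain_com (Seq flow_com gap_com))) s1 (18 + N * (40 + N * 9))
   (\<lambda>s. oracle_result l (rv s0 ''z'') (rmem s0 ''K'' []) (rv s ''q'') \<and>
    rmem s ''g'' [] = (\<Sum>k<N. rmem s0 ''z'' [k] * (rmem s0 ''z'' [k] - rmem s ''q'' [k])))"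
  proof (rule runs_Seq[OF runs_weight[OF lay1]])
    show "2 + N * (2 + 2) + (16 + N * (36 + N * 9)) \<le> 18 + N * (40 + N * 9)" by (simp add: algebra_simps)
    fix s2 assume w: "\<forall>k<N. rmem s2 ''p'' [k] = weight (rv s1 ''z'') (nv s1 ''mi'') k"
      and "same_outside (writes weight_com) s1 s2"
    then have so2: "same_outside {''k'', ''p''} s1 s2" using same_outside_mono[OF _ writes_weight] by blast
    have lay2: "lay s2" by (rule layout_same[OF so2 _ lay1]) simp
    have eq2: "rmem s2 ''z'' = rmem s0 ''z''" "rmem s2 ''K'' = rmem s0 ''K''" "nmem s2 ''l'' [] = l"
      "nmem s2 ''mi'' = nmem s1 ''mi''"
      using l eq1 by (simp_all add: same_outsideD[OF so2])
    show "runs orac (Seq chain_com (Seq flow_com gap_com)) s2 (16 + N * (36 + N * 9))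
      (\<lambda>s. oracle_result l (rv s0 ''z'') (rmem s0 ''K'' []) (rv s ''q'') \<and>
        rmem s ''g'' [] = (\<Sum>k<N. rmem s0 ''z'' [k] * (rmem s0 ''z'' [k] - rmem s ''q'' [k])))"
    proof (rule runs_Seq[OF runs_chain[OF lay2 l(1) eq2(3) w]])
      show "11 + N * (26 + N * 9) + (5 + N * 10) \<le> 16 + N * (36 + N * 9)" by (simp add: algebra_simps)
      fix s3 assume "\<exists>I b. chain (weight (rv s1 ''z'') (nv s1 ''mi'')) (cl l) I b \<and> (\<forall>m. \<not> candidate I m) \<and>
          (\<forall>a<N. rmem s3 ''q'' [a] = b a)"
        and "same_outside (writes chain_com) s2 s3"
      then obtain I b where ch: "chain (weight (rv s0 ''z'') (nv s1 ''mi'')) (cl l) I b" "\<forall>m. \<not> candidate I m"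
        "\<forall>a<N. rmem s3 ''q'' [a] = b a"
        and so3: "same_outside {''k'', ''q'', ''i'', ''in'', ''a'', ''skip'', ''v'', ''u'', ''best'', ''m''} s2 s3"
        using same_outside_mono[OF _ writes_chain] eq1 by auto
      have lay3: "lay s3" by (rule layout_same[OF so3 _ lay2]) simp
      have eq3: "rmem s3 ''z'' = rmem s0 ''z''" "rmem s3 ''K'' = rmem s0 ''K''" "nmem s3 ''mi'' = nmem s1 ''mi''"
        using eq2 by (simp_all add: same_outsideD[OF so3])
      have miN3: "\<forall>k<N. nmem s3 ''mi'' [k] < N" using miN eq3 by simp
      show "runs orac (Seq flow_com gap_com) s3 (5 + N * 10)
        (\<lambda>s. oracle_result l (rv s0 ''z'') (rmem s0 ''K'' []) (rv s ''q'') \<and>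
          rmem s ''g'' [] = (\<Sum>k<N. rmem s0 ''z'' [k] * (rmem s0 ''z'' [k] - rmem s ''q'' [k])))"
      proof (rule runs_Seq[OF runs_flow[OF lay3 miN3]])
        show "2 + N * (5 + 2) + (3 + N * (1 + 2)) \<le> 5 + N * 10" by (simp add: algebra_simps)
        fix s4 assume q: "\<forall>a. rmem s4 ''q'' [a] = rmem s3 ''q'' [a] + flow (rv s3 ''z'') (nv s3 ''mi'') (rmem s3 ''K'' []) a"
          and "same_outside (writes flow_com) s3 s4"
        then have so4: "same_outside {''k'', ''q'', ''skip''} s3 s4" using same_outside_mono[OF _ writes_flow] by blast
        have lay4: "lay s4" by (rule layout_same[OF so4 _ lay3]) simp
        have eq4: "rmem s4 ''z'' = rmem s0 ''z''" using eq3 by (simp add: same_outsideD[OF so4])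
        have "\<forall>a<N. rmem s4 ''q'' [a] = b a + flow (rv s0 ''z'') (nv s1 ''mi'') (rmem s0 ''K'' []) a"
          using q ch(3) unfolding eq3 by simp
        then have res: "oracle_result l (rv s0 ''z'') (rmem s0 ''K'' []) (rv s4 ''q'')"
          unfolding oracle_result_def using mi ch by blast
        show "runs orac gap_com s4 (3 + N * (1 + 2))
          (\<lambda>s. oracle_result l (rv s0 ''z'') (rmem s0 ''K'' []) (rv s ''q'') \<and>
            rmem s ''g'' [] = (\<Sum>k<N. rmem s0 ''z'' [k] * (rmem s0 ''z'' [k] - rmem s ''q'' [k])))"
        proof (rule runs_conseq[OF runs_gap[OF lay4]])
          fix s assume g: "rmem s ''g'' [] = (\<Sum>k<N. rmem s4 ''z'' [k] * (rmem s4 ''z'' [k] - rmem s4 ''q'' [k]))"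
            and "same_outside (writes gap_com) s4 s"
          then have so5: "same_outside {''k'', ''g''} s4 s" using same_outside_mono[OF _ writes_gap] by blast
          have "rmem s ''q'' = rmem s4 ''q''" by (simp add: same_outsideD[OF so5])
          then show "oracle_result l (rv s0 ''z'') (rmem s0 ''K'' []) (rv s ''q'') \<and>
            rmem s ''g'' [] = (\<Sum>k<N. rmem s0 ''z'' [k] * (rmem s0 ''z'' [k] - rmem s ''q'' [k]))"
            using g res eq4 by simp
        qed simp
      qed
    qed
  qed
qed

end

section \<open>The Frank-Wolfe iteration\<close>

definition clear_com :: com where
  "clear_com = For ''k'' (V ''L'') (RAssign ''z'' [V ''k''] zero_r)"

definition load_com :: com where
  "load_com = For ''k'' (V ''L'') (RAssign ''z'' [V ''k''] (RLoad ''q'' [V ''k'']))"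

definition step_com :: com where
  "step_com = For ''k'' (V ''L'') (RAssign ''z'' [V ''k''] (RAdd (RLoad ''z'' [V ''k''])
     (RMul (R ''gam'') (RSub (RLoad ''q'' [V ''k'']) (RLoad ''z'' [V ''k''])))))"

definition argmin_com :: com where
  "argmin_com = Seq (NAssign ''w'' [] (NConst 0)) (For ''k'' (V ''L'')
     (Cond (RLess (RLoad ''z'' [V ''k'']) (RLoad ''z'' [V ''w''])) (NAssign ''w'' [] (V ''k'')) Skip))"

text \<open>At \<open>z = 0\<close> weight and flow vanish, so the first oracle call merely delivers
  a valid starting vector.\<close>

definition fix_com :: com where
  "fix_com = Seq clear_com (Seq oracle_com (Seq load_com (Seq oracle_com
     (Seq (While (RLess (R ''t2'') (R ''g'')) (Seq step_com oracle_com)) argmin_com))))"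

abbreviation "fix_vars \<equiv> {''k'', ''q'', ''i'', ''in'', ''a'', ''skip'', ''v'', ''u'', ''best'', ''m'', ''mi'', ''p'', ''g'', ''z'', ''w''}"

lemma writes_fix: "writes fix_com \<subseteq> fix_vars"
  by (simp add: fix_com_def clear_com_def load_com_def step_com_def argmin_com_def
      oracle_com_def chain_com_def set_base_def add_cl_def select_com_def grow_com_def
      blocking_com_def weight_com_def flow_com_def gap_com_def)

definition fix_steps :: "nat \<Rightarrow> nat \<Rightarrow> nat" where
  "fix_steps n r = 8 + nlits n * 10 + 2 * oracle_steps n + r * r * (3 + nlits n * 3 + oracle_steps n)"

context machine begin

lemma valid_cong:
  assumes "valid B q'" "B \<subseteq> {..<N}" "\<forall>a<N. q a = q' a"
  shows "valid B q"
proof -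
  have "skew q" using assms(1,3) lbar_less[of _ n] unfolding valid_def skew_def by simp
  moreover have "\<forall>l\<in>B. q l = 0" using assms by (auto simp: valid_def)
  moreover have "sum q A = sum q' A" if "A \<in> ideals imp" for A
    using that assms(3) by (intro sum.cong) (auto simp: ideals_def)
  ultimately show ?thesis using assms(1) by (simp add: valid_def)
qed

text \<open>The bound is uniform in the weight, so one constant \<open>K\<close> serves the whole
  iteration.\<close>

definition bounded_by :: "nat \<Rightarrow> real \<Rightarrow> bool" where
  "bounded_by l K \<longleftrightarrow> (\<forall>p I b. monotone_weight (cl l) p \<longrightarrow> chain p (cl l) I b \<longrightarrow> (\<forall>a<N. \<bar>b a\<bar> \<le> K))"

lemma oracle_result_zero:
  assumes "oracle_result l z K q" "\<forall>k<N. z k = 0"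
  obtains p I b where "monotone_weight (cl l) p" "chain p (cl l) I b" "\<forall>m. \<not> candidate I m" "\<forall>a<N. q a = b a"
proof -
  obtain I b mi where *: "blocking (cl l) z mi" "chain (weight z mi) (cl l) I b"
    "\<forall>m. \<not> candidate I m" "\<forall>a<N. q a = b a + flow z mi K a"
    using assms(1) unfolding oracle_result_def by blast
  have "flow z mi K a = 0" for a using assms(2) by (simp add: flow_def)
  then show thesis using that[OF monotone_weight[OF *(1)] *(2,3)] *(4) by simp
qed

lemma cl_sub: "alive l \<Longrightarrow> cl l \<subseteq> {..<N}"
  using cl_ideal by (auto simp: ideals_def)

lemma oracle_zero_valid:
  assumes "oracle_result l z K q" "\<forall>k<N. z k = 0" "alive l" "bounded_by l K'"
  shows "valid (cl l) q \<and> (\<forall>a<N. \<bar>q a\<bar> \<le> K')"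
proof -
  obtain p I b where *: "monotone_weight (cl l) p" "chain p (cl l) I b" "\<forall>m. \<not> candidate I m" "\<forall>a<N. q a = b a"
    using oracle_result_zero[OF assms(1,2)] by blast
  have "valid (cl l) b" using *(3) by (intro chain_valid[OF *(1) cl_ideal[OF assms(3)] *(2)]) blast
  moreover have "\<forall>a<N. \<bar>b a\<bar> \<le> K'" using assms(4) * unfolding bounded_by_def by blast
  ultimately show ?thesis using valid_cong[OF _ cl_sub[OF assms(3)] *(4)] *(4) by simp
qed

text \<open>In the factor, \<open>1\<close> stands for the greedy vector and \<open>2 * N\<close>
  for the flow, by \<open>flow_bound\<close>.\<close>

lemma oracle_valid:
  fixes K :: real
  assumes "oracle_result l z K q" "valid (cl l) z" "alive l" "bounded_by l K"
  shows "valid (cl l) q \<and> (\<forall>a<N. \<bar>q a\<bar> \<le> (2 * N + 1) * K)"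
proof -
  obtain I b mi where *: "blocking (cl l) z mi" "chain (weight z mi) (cl l) I b"
    "\<forall>m. \<not> candidate I m" "\<forall>a<N. q a = b a + flow z mi K a"
    using assms(1) unfolding oracle_result_def by blast
  note B = cl_ideal[OF assms(3)]
  have p: "monotone_weight (cl l) (weight z mi)" by (rule monotone_weight[OF *(1)])
  have b: "\<forall>a<N. \<bar>b a\<bar> \<le> K" using assms(4) p * unfolding bounded_by_def by blast
  have K: "K \<ge> 0" using b alive_less[OF assms(3)] by force
  have "valid (cl l) b" using *(3) by (intro chain_valid[OF p B *(2)]) blast
  from valid_add_flow[OF B assms(2) this *(1) K]
  have "valid (cl l) (\<lambda>a. b a + flow z mi K a)" .
  then have "valid (cl l) q" by (rule valid_cong[OF _ cl_sub[OF assms(3)]]) (use *(4) in simp)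
  moreover have "\<bar>q a\<bar> \<le> (2 * N + 1) * K" if "a < N" for a
  proof -
    have "\<bar>q a\<bar> \<le> \<bar>b a\<bar> + \<bar>flow z mi K a\<bar>" using *(4) that by simp
    also have "\<dots> \<le> K + 2 * K * N" using b that flow_bound[OF K, of z mi a] by (intro add_mono) auto
    finally show ?thesis by (simp add: algebra_simps)
  qed
  ultimately show ?thesis by blast
qed

lemma oracle_fix:
  assumes res: "oracle_result l z K q" and z: "valid (cl l) z" and l: "alive l" and K: "bounded_by l K"
    and gap: "(\<Sum>k<N. z k * (z k - q k)) \<le> 2 * t\<^sup>2" and w: "w < N" "z w < - t" "t \<ge> 0"
    and A: "A \<in> ideals imp" "l \<in> A" "\<And>A'. A' \<in> ideals imp \<Longrightarrow> l \<in> A' \<Longrightarrow> f A \<le> f A'"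
  shows "w \<in> A"
proof -
  obtain I b mi where *: "blocking (cl l) z mi" "chain (weight z mi) (cl l) I b"
    "\<forall>m. \<not> candidate I m" "\<forall>a<N. q a = b a + flow z mi K a"
    using res unfolding oracle_result_def by blast
  note B = cl_ideal[OF l]
  have p: "monotone_weight (cl l) (weight z mi)" by (rule monotone_weight[OF *(1)])
  have b: "\<bar>b a\<bar> \<le> K" if "a \<in> {..<N}" for a using K p * that unfolding bounded_by_def by blast
  have "(\<Sum>k<N. z k * (z k - q k)) = (\<Sum>k<N. z k * (z k - (b k + flow z mi K k)))"
    using *(4) by (intro sum.cong) auto
  then have gap': "(\<Sum>k<N. z k * (z k - (b k + flow z mi K k))) \<le> 2 * t\<^sup>2" using gap by simp
  have max: "\<And>m. \<not> candidate I m" using *(3) by blast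
  show ?thesis
  proof (rule small_gap_fixes_literal[OF B z *(1,2) max b gap' _ w(2,3) A(1)])
    show "w \<in> {..<N}" using w by simp
    show "cl l \<subseteq> A" using cl_subset[OF A(1,2)] .
    show "A' \<in> ideals imp \<Longrightarrow> cl l \<subseteq> A' \<Longrightarrow> f A \<le> f A'" for A'
      using A(3) cl_subset_iff l by blast
  qed
qed

text \<open>The linear term gains at least \<open>4 / r\<close> times the square of
  \<open>t\<close>. The quadratic term costs at most \<open>1 / r\<close> times that square, because
  \<open>r\<close> was chosen so that \<open>r\<close> times the square of \<open>t\<close>
  dominates the squared distance from \<open>z\<close> to \<open>q\<close>. Of the remaining
  \<open>3 / r\<close> only \<open>1 / r\<close> is kept.\<close>

lemma descent:
  fixes t Q r :: real
  assumes gap: "2 * t\<^sup>2 < (\<Sum>k<N. z k * (z k - q k))"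
    and z: "\<forall>a<N. \<bar>z a\<bar> \<le> Q" and q: "\<forall>a<N. \<bar>q a\<bar> \<le> Q"
    and r: "r > 0" "r * t\<^sup>2 = 4 * N * Q\<^sup>2"
  shows "(\<Sum>k<N. (z k + 1 / r * (q k - z k))\<^sup>2) \<le> (\<Sum>k<N. (z k)\<^sup>2) - t\<^sup>2 / r"
proof -
  have "(\<Sum>k<N. (q k - z k)\<^sup>2) \<le> (\<Sum>k<N. (2 * Q)\<^sup>2)"
  proof (rule sum_mono)
    fix k assume "k \<in> {..<N}"
    then have "\<bar>q k - z k\<bar> \<le> \<bar>2 * Q\<bar>" using z q by (smt (verit) lessThan_iff)
    then show "(q k - z k)\<^sup>2 \<le> (2 * Q)\<^sup>2" by (simp only: abs_le_square_iff[symmetric])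
  qed
  also have "\<dots> = r * t\<^sup>2" using r by (simp add: power2_eq_square)
  finally have D: "(\<Sum>k<N. (q k - z k)\<^sup>2) \<le> r * t\<^sup>2" .
  have "(\<Sum>k<N. (z k + 1 / r * (q k - z k))\<^sup>2) =
      (\<Sum>k<N. (z k)\<^sup>2 - 2 / r * (z k * (z k - q k)) + (1 / r)\<^sup>2 * (q k - z k)\<^sup>2)"
    by (intro sum.cong) (auto simp: power2_eq_square algebra_simps)
  also have "\<dots> = (\<Sum>k<N. (z k)\<^sup>2) - 2 / r * (\<Sum>k<N. z k * (z k - q k)) + (1 / r)\<^sup>2 * (\<Sum>k<N. (q k - z k)\<^sup>2)"
    by (simp only: sum.distrib sum_subtractf sum_distrib_left)
  also have "\<dots> \<le> (\<Sum>k<N. (z k)\<^sup>2) - 2 / r * (2 * t\<^sup>2) + (1 / r)\<^sup>2 * (r * t\<^sup>2)"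
    using gap r D by (intro add_mono diff_mono mult_left_mono) auto
  also have "\<dots> = (\<Sum>k<N. (z k)\<^sup>2) - 3 * (t\<^sup>2 / r)" using r by (simp add: power2_eq_square field_simps)
  also have "\<dots> \<le> (\<Sum>k<N. (z k)\<^sup>2) - t\<^sup>2 / r"
  proof -
    have "0 \<le> t\<^sup>2 / r" using r by simp
    then show ?thesis by linarith
  qed
  finally show ?thesis .
qed

lemma runs_for_literals:
  assumes lay: "lay s0" and W: "''k'' \<notin> writes c" "writes c \<inter> {''h'', ''L'', ''bar'', ''var'', ''ch'', ''x'', ''imp''} = {}"
    and init: "I 0 (nupdate ''k'' [] 0 s0)"
    and step: "\<And>j s. j < N \<Longrightarrow> lay s \<Longrightarrow> same_outside (insert ''k'' (writes c)) s0 s \<Longrightarrow> nmem s ''k'' [] = j \<Longrightarrow> I j s \<Longrightarrow>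
      runs orac c s k (\<lambda>s'. I (Suc j) (nupdate ''k'' [] (Suc j) s'))"
  shows "runs orac (For ''k'' (V ''L'') c) s0 (2 + N * (k + 2)) (I N)"
proof (rule runs_For[where I = I])
  show "''k'' \<notin> writes c" "I 0 (nupdate ''k'' [] 0 s0)" by fact+
  have l: "lay s" if "same_outside (insert ''k'' (writes c)) s0 s" for s
    by (rule layout_same[OF that _ lay]) (use W in auto)
  then show "same_outside (insert ''k'' (writes c)) s0 s \<Longrightarrow> nval s (V ''L'') = N" for s
    by (simp add: lay_L)
  show "runs orac c s k (\<lambda>s'. I (Suc j) (nupdate ''k'' [] (Suc j) s'))"
    if "j < N" "same_outside (insert ''k'' (writes c)) s0 s" "nmem s ''k'' [] = j" "I j s" for j s
    using step[OF that(1) l[OF that(2)] that(2-4)] .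
qed

lemma runs_clear:
  assumes lay: "lay s0"
  shows "runs orac clear_com s0 (2 + N * (1 + 2)) (\<lambda>s. \<forall>k<N. rmem s ''z'' [k] = 0)"
  unfolding clear_com_def
  by (rule runs_for_literals[where I = "\<lambda>j s. \<forall>k<j. rmem s ''z'' [k] = 0", OF lay]) (simp_all add: less_Suc_eq)

lemma runs_load:
  assumes lay: "lay s0"
  shows "runs orac load_com s0 (2 + N * (1 + 2)) (\<lambda>s. \<forall>k<N. rmem s ''z'' [k] = rmem s0 ''q'' [k])"
  unfolding load_com_def
  by (rule runs_for_literals[where I = "\<lambda>j s. \<forall>k<j. rmem s ''z'' [k] = rmem s0 ''q'' [k]", OF lay])
    (simp_all add: less_Suc_eq same_outsideD)

lemma runs_step:
  assumes lay: "lay s0"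
  shows "runs orac step_com s0 (2 + N * (1 + 2)) (\<lambda>s. \<forall>k<N. rmem s ''z'' [k] =
    rmem s0 ''z'' [k] + rmem s0 ''gam'' [] * (rmem s0 ''q'' [k] - rmem s0 ''z'' [k]))"
proof -
  define I where "I j s \<longleftrightarrow> (\<forall>k. rmem s ''z'' [k] = (if k < j then
    rmem s0 ''z'' [k] + rmem s0 ''gam'' [] * (rmem s0 ''q'' [k] - rmem s0 ''z'' [k]) else rmem s0 ''z'' [k]))" for j and s :: store
  have "runs orac step_com s0 (2 + N * (1 + 2)) (I N)"
    unfolding step_com_def
  proof (rule runs_for_literals[OF lay])
    let ?c = "RAssign ''z'' [V ''k''] (RAdd (RLoad ''z'' [V ''k''])
     (RMul (R ''gam'') (RSub (RLoad ''q'' [V ''k'']) (RLoad ''z'' [V ''k'']))))"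
    fix j s assume so: "same_outside (insert ''k'' (writes ?c)) s0 s" and j: "nmem s ''k'' [] = j" and I: "I j s"
    have eq: "rmem s ''gam'' = rmem s0 ''gam''" "rmem s ''q'' = rmem s0 ''q''"
      using so by (simp_all add: same_outsideD)
    show "runs orac ?c s 1 (\<lambda>s'. I (Suc j) (nupdate ''k'' [] (Suc j) s'))"
      using I j eq by (simp add: I_def less_Suc_eq)
  qed (simp_all add: I_def)
  then show ?thesis by (rule runs_conseq) (simp_all add: I_def)
qed

lemma runs_argmin:
  assumes lay: "lay s0"
  shows "runs orac argmin_com s0 (3 + N * (2 + 2)) (\<lambda>s. nmem s ''w'' [] < N \<and>
    (\<forall>k<N. rmem s0 ''z'' [nmem s ''w'' []] \<le> rmem s0 ''z'' [k]))"
  unfolding argmin_com_def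
proof (rule runs_Seq[of orac _ s0 1 "\<lambda>s. s = nupdate ''w'' [] 0 s0" "2 + N * (2 + 2)"])
  fix s1 assume s1: "s1 = nupdate ''w'' [] 0 s0"
  have lay1: "lay s1" using lay by (simp add: s1 layout_def)
  let ?c = "Cond (RLess (RLoad ''z'' [V ''k'']) (RLoad ''z'' [V ''w''])) (NAssign ''w'' [] (V ''k'')) Skip"
  show "runs orac (For ''k'' (V ''L'') ?c) s1 (2 + N * (2 + 2)) (\<lambda>s. nmem s ''w'' [] < N \<and>
    (\<forall>k<N. rmem s0 ''z'' [nmem s ''w'' []] \<le> rmem s0 ''z'' [k]))"
  proof (rule runs_for_literals[where I = "\<lambda>j s. nmem s ''w'' [] < N \<and>
    (\<forall>k<j. rmem s0 ''z'' [nmem s ''w'' []] \<le> rmem s0 ''z'' [k])", OF lay1])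
    fix j s assume so: "same_outside (insert ''k'' (writes ?c)) s1 s" and j: "j < N" "nmem s ''k'' [] = j"
      and I: "nmem s ''w'' [] < N \<and> (\<forall>k<j. rmem s0 ''z'' [nmem s ''w'' []] \<le> rmem s0 ''z'' [k])"
    have eq: "rmem s ''z'' = rmem s0 ''z''" using so by (simp add: same_outsideD s1)
    show "runs orac ?c s 2 (\<lambda>s'. nmem (nupdate ''k'' [] (Suc j) s') ''w'' [] < N \<and>
      (\<forall>k<Suc j. rmem s0 ''z'' [nmem (nupdate ''k'' [] (Suc j) s') ''w'' []] \<le> rmem s0 ''z'' [k]))"
      using I j eq by (fastforce simp: less_Suc_eq)
  qed (simp_all add: s1 nlits_def)
qed simp_all

definition fix_post :: "nat \<Rightarrow> real \<Rightarrow> store \<Rightarrow> bool" where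
  "fix_post l t s \<longleftrightarrow> nmem s ''w'' [] < N \<and>
    (if rmem s ''z'' [nmem s ''w'' []] < - t
     then \<not> imp l (nmem s ''w'' []) \<and> (\<forall>A\<in>ideals imp. l \<in> A \<longrightarrow> (\<forall>A'\<in>ideals imp. l \<in> A' \<longrightarrow> f A \<le> f A') \<longrightarrow> nmem s ''w'' [] \<in> A)
     else \<forall>A\<in>ideals imp. l \<in> A \<longrightarrow> f (cl l) - real N * t \<le> f A)"

abbreviation "fix_time \<equiv> fix_steps n"

text \<open>The squared norm of \<open>z\<close> starts at no more than \<open>r * t * t\<close> and
  drops by at least \<open>t * t / r\<close> in every step, which leaves room for
  \<open>r * r\<close> steps. The loop then ends with a small gap, and the least entry of
  \<open>z\<close> decides between the two outcomes.\<close>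

lemma runs_fix:
  fixes K t :: real
  assumes lay: "lay s0" and l: "alive l" "nmem s0 ''l'' [] = l"
    and K: "rmem s0 ''K'' [] = K" "bounded_by l K"
    and t: "t > 0" "rmem s0 ''t2'' [] = 2 * t\<^sup>2"
    and r: "rmem s0 ''gam'' [] = 1 / real r" "r > 0" "real r * t\<^sup>2 = 4 * N * ((2 * N + 1) * K)\<^sup>2"
  shows "runs orac fix_com s0 (fix_time r) (fix_post l t)"
proof -
  let ?B = "cl l" and ?Q = "(2 * N + 1) * K"
  define gap where "gap s \<longleftrightarrow> rmem s ''g'' [] = (\<Sum>k<N. rmem s ''z'' [k] * (rmem s ''z'' [k] - rmem s ''q'' [k]))" for s :: store
  define ok where "ok s \<longleftrightarrow> valid ?B (rv s ''z'') \<and> (\<forall>a<N. \<bar>rmem s ''z'' [a]\<bar> \<le> ?Q)" for s :: store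
  have K0: "K \<ge> 0"
  proof -
    have "chain (\<lambda>_. 0) ?B ?B (\<lambda>_. 0)" "monotone_weight ?B (\<lambda>_. 0)"
      by (auto simp: monotone_weight_def intro: chain.base)
    then have "\<bar>0\<bar> \<le> K" using K(2) alive_less[OF l(1)] unfolding bounded_by_def by blast
    then show ?thesis by simp
  qed
  have "1 * K \<le> ?Q" using K0 by (intro mult_right_mono) auto
  then have KQ: "K \<le> ?Q" by simp
  have pres: "lay s \<and> nmem s ''l'' [] = l \<and> rmem s ''K'' [] = K \<and> rmem s ''t2'' [] = 2 * t\<^sup>2 \<and> rmem s ''gam'' [] = 1 / real r"
    if "same_outside fix_vars s0 s" for s
  proof -
    have "lay s" by (rule layout_same[OF that _ lay]) simp
    then show ?thesis using l K t r by (simp add: same_outsideD[OF that])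
  qed
  have orc: "runs orac oracle_com s oracle_time (\<lambda>s'. same_outside fix_vars s0 s' \<and> rmem s' ''z'' = rmem s ''z'' \<and>
      oracle_result l (rv s' ''z'') K (rv s' ''q'') \<and> gap s')" if so: "same_outside fix_vars s0 s" for s
  proof -
    have p: "lay s" "nmem s ''l'' [] = l" "rmem s ''K'' [] = K" using pres[OF so] by blast+
    show ?thesis
    proof (rule runs_conseq[OF runs_oracle[OF p(1) l(1) p(2)]])
      fix s' assume post: "oracle_result l (rv s ''z'') (rmem s ''K'' []) (rv s' ''q'') \<and>
        rmem s' ''g'' [] = (\<Sum>k<N. rmem s ''z'' [k] * (rmem s ''z'' [k] - rmem s' ''q'' [k]))"
        and "same_outside (writes oracle_com) s s'"
      then have so': "same_outside {''k'', ''q'', ''i'', ''in'', ''a'', ''skip'', ''v'', ''u'', ''best'', ''m'', ''mi'', ''p'', ''g''} s s'"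
        using same_outside_mono[OF _ writes_oracle] by blast
      have "same_outside fix_vars s s'" by (rule same_outside_mono[OF so']) simp
      then have "same_outside fix_vars s0 s'" by (rule same_outside_trans[OF so])
      moreover have "rmem s' ''z'' = rmem s ''z''" by (simp add: same_outsideD[OF so'])
      ultimately show "same_outside fix_vars s0 s' \<and> rmem s' ''z'' = rmem s ''z'' \<and>
        oracle_result l (rv s' ''z'') K (rv s' ''q'') \<and> gap s'" using post p(3) by (simp add: gap_def)
    qed simp
  qed
  have Wclear: "writes clear_com \<subseteq> {''k'', ''z''}" "writes load_com \<subseteq> {''k'', ''z''}" "writes step_com \<subseteq> {''k'', ''z''}"
    by (simp_all add: clear_com_def load_com_def step_com_def)
  have zsub: "{''k'', ''z''} \<subseteq> fix_vars" by simp
  have zvars: "same_outside fix_vars s0 s'" if "same_outside (writes c) s s'" "writes c \<subseteq> {''k'', ''z''}" "same_outside fix_vars s0 s" for c s s'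
    using same_outside_trans[OF that(3) same_outside_mono[OF that(1) order_trans[OF that(2) zsub]]] .
  define J where "J j s \<longleftrightarrow> same_outside fix_vars s0 s \<and> ok s \<and> oracle_result l (rv s ''z'') K (rv s ''q'') \<and> gap s \<and>
    j * (t\<^sup>2 / r) + (\<Sum>k<N. (rmem s ''z'' [k])\<^sup>2) \<le> r * t\<^sup>2" for j :: nat and s
  have argmin: "runs orac argmin_com s (3 + N * (2 + 2)) (fix_post l t)"
    if J: "J j s" and g: "\<not> bval s (RLess (R ''t2'') (R ''g''))" for j s
  proof -
    have so: "same_outside fix_vars s0 s" and v: "valid ?B (rv s ''z'')"
      and res: "oracle_result l (rv s ''z'') K (rv s ''q'')" and gap: "gap s"
      using J unfolding J_def ok_def by blast+
    have lay': "lay s" using pres[OF so] by blast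
    have gle: "(\<Sum>k<N. rmem s ''z'' [k] * (rmem s ''z'' [k] - rmem s ''q'' [k])) \<le> 2 * t\<^sup>2"
      using g gap pres[OF so] by (simp add: gap_def)
    show ?thesis
    proof (rule runs_conseq[OF runs_argmin[OF lay']])
      fix s' assume w: "nmem s' ''w'' [] < N \<and> (\<forall>k<N. rmem s ''z'' [nmem s' ''w'' []] \<le> rmem s ''z'' [k])"
        and so': "same_outside (writes argmin_com) s s'"
      have zeq: "rmem s' ''z'' = rmem s ''z''"
        by (rule same_outsideD[OF so']) (simp add: argmin_com_def)
      let ?w = "nmem s' ''w'' []"
      show "fix_post l t s'"
      proof (cases "rmem s ''z'' [?w] < - t")
        case True
        \<comment> \<open>\<open>z\<close> vanishes on the base but is negative at
          \<open>?w\<close>, so the literal found is a new consequence of \<open>l\<close>.\<close>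
        have "?w \<notin> ?B" using v True t by (auto simp: valid_def)
        then have "\<not> imp l ?w" by (simp add: cl_def)
        moreover have "?w \<in> A" if "A \<in> ideals imp" "l \<in> A" "\<forall>A'\<in>ideals imp. l \<in> A' \<longrightarrow> f A \<le> f A'" for A
          using oracle_fix[OF res v l(1) K(2) gle _ True _ that(1,2)] w t that(3) by simp
        ultimately show ?thesis using True w zeq unfolding fix_post_def by simp
      next
        case False
        have "f ?B - card {..<N} * t \<le> f A" if "A \<in> ideals imp" "l \<in> A" for A
        proof (rule small_vector_bound[OF v _ that(1) cl_subset[OF that]])
          show "- t \<le> rmem s ''z'' [k]" if "k \<in> {..<N}" for k using False w that by force
        qed
        then show ?thesis using False w zeq unfolding fix_post_def by simp
      qed
    qed simp
  qed
  have loop: "runs orac (While (RLess (R ''t2'') (R ''g'')) (Seq step_com oracle_com)) s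
      (1 + r * r * ((2 + N * (1 + 2) + oracle_time) + 1)) (\<lambda>s. (\<exists>j. J j s) \<and> \<not> bval s (RLess (R ''t2'') (R ''g'')))"
    if "J 0 s" for s
  proof (rule runs_While[where I = J, OF that])
    fix j s assume J: "J j s"
    have "(\<Sum>k<N. (rmem s ''z'' [k])\<^sup>2) \<ge> 0" by (rule sum_nonneg) simp
    then have "j * (t\<^sup>2 / r) \<le> r * t\<^sup>2" using J unfolding J_def by linarith
    then have "real j * t\<^sup>2 \<le> real (r * r) * t\<^sup>2" using r(2) by (simp add: field_simps)
    then have "real j \<le> real (r * r)" using t(1) by simp
    then show "j \<le> r * r" by (simp only: of_nat_le_iff)
    assume b: "bval s (RLess (R ''t2'') (R ''g''))"
    have so: "same_outside fix_vars s0 s" and ok: "ok s"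
      and res: "oracle_result l (rv s ''z'') K (rv s ''q'')" and gap: "gap s"
      and pot: "j * (t\<^sup>2 / r) + (\<Sum>k<N. (rmem s ''z'' [k])\<^sup>2) \<le> r * t\<^sup>2"
      using J unfolding J_def by blast+
    have v: "valid ?B (rv s ''z'')" and zQ: "\<forall>a<N. \<bar>rmem s ''z'' [a]\<bar> \<le> ?Q" using ok by (auto simp: ok_def)
    have p: "lay s" "rmem s ''t2'' [] = 2 * t\<^sup>2" "rmem s ''gam'' [] = 1 / real r" using pres[OF so] by blast+
    have q: "valid ?B (rv s ''q'')" "\<forall>a<N. \<bar>rmem s ''q'' [a]\<bar> \<le> ?Q"
      using oracle_valid[OF res v l(1) K(2)] by auto
    show "runs orac (Seq step_com oracle_com) s (2 + N * (1 + 2) + oracle_time) (J (Suc j))"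
    proof (rule runs_Seq[OF runs_step[OF p(1)]])
      fix s' assume z': "\<forall>k<N. rmem s' ''z'' [k] = rmem s ''z'' [k] + rmem s ''gam'' [] * (rmem s ''q'' [k] - rmem s ''z'' [k])"
        and so': "same_outside (writes step_com) s s'"
      have so0: "same_outside fix_vars s0 s'" by (rule zvars[OF so' Wclear(3) so])
      have zz: "\<forall>k<N. rmem s' ''z'' [k] = rmem s ''z'' [k] + 1 / real r * (rmem s ''q'' [k] - rmem s ''z'' [k])"
        using z' p(3) by simp
      have r1: "1 / real r \<le> 1" using r(2) by simp
      have v': "valid ?B (rv s' ''z'')"
        by (rule valid_cong[OF valid_convex[OF v q(1), of "1 / real r"] cl_sub[OF l(1)]]) (use zz r1 in auto)
      have "\<bar>rmem s' ''z'' [a]\<bar> \<le> ?Q" if a: "a < N" for a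
      proof -
        have "rmem s' ''z'' [a] = (1 - 1 / real r) * rmem s ''z'' [a] + 1 / real r * rmem s ''q'' [a]"
          using zz a by (simp add: algebra_simps)
        also have "\<bar>\<dots>\<bar> \<le> (1 - 1 / real r) * \<bar>rmem s ''z'' [a]\<bar> + 1 / real r * \<bar>rmem s ''q'' [a]\<bar>"
          using r1 by (intro order_trans[OF abs_triangle_ineq]) (simp add: abs_mult)
        also have "\<dots> \<le> (1 - 1 / real r) * ?Q + 1 / real r * ?Q"
          using r1 zQ q(2) a by (intro add_mono mult_left_mono) auto
        also have "\<dots> = ?Q" unfolding distrib_right[symmetric] by simp
        finally show ?thesis .
      qed
      then have ok': "ok s'" using v' by (simp add: ok_def)
      have "(\<Sum>k<N. (rmem s' ''z'' [k])\<^sup>2) = (\<Sum>k<N. (rmem s ''z'' [k] + 1 / real r * (rmem s ''q'' [k] - rmem s ''z'' [k]))\<^sup>2)"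
        using zz by (intro sum.cong) auto
      also have "\<dots> \<le> (\<Sum>k<N. (rmem s ''z'' [k])\<^sup>2) - t\<^sup>2 / r"
        by (rule descent[OF _ zQ q(2)]) (use b gap p(2) r in \<open>auto simp: gap_def\<close>)
      finally have "(\<Sum>k<N. (rmem s' ''z'' [k])\<^sup>2) \<le> (\<Sum>k<N. (rmem s ''z'' [k])\<^sup>2) - t\<^sup>2 / r" .
      note dec0 = this
      have dec: "Suc j * (t\<^sup>2 / r) + (\<Sum>k<N. (rmem s' ''z'' [k])\<^sup>2) \<le> r * t\<^sup>2"
      proof -
        have "real (Suc j) * (t\<^sup>2 / r) = t\<^sup>2 / r + real j * (t\<^sup>2 / r)"
          by (simp only: of_nat_Suc distrib_right mult_1)
        then show ?thesis using pot dec0 by linarith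
      qed
      show "runs orac oracle_com s' oracle_time (J (Suc j))"
        by (rule runs_conseq[OF orc[OF so0]]) (use ok' dec in \<open>auto simp: J_def ok_def\<close>)
    qed simp
  qed
  show ?thesis unfolding fix_com_def
  proof (rule runs_Seq[OF runs_clear[OF lay]])
    show "2 + N * (1 + 2) + (6 + N * 7 + 2 * oracle_time + r * r * (3 + N * 3 + oracle_time)) \<le> fix_time r"
      by (simp add: fix_steps_def)
    fix s1 assume z1: "\<forall>k<N. rmem s1 ''z'' [k] = 0" and "same_outside (writes clear_com) s0 s1"
    then have so1: "same_outside fix_vars s0 s1" using zvars[OF _ Wclear(1) same_outside_refl] by blast
    show "runs orac (Seq oracle_com (Seq load_com (Seq oracle_com
     (Seq (While (RLess (R ''t2'') (R ''g'')) (Seq step_com oracle_com)) argmin_com)))) s1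
     (6 + N * 7 + 2 * oracle_time + r * r * (3 + N * 3 + oracle_time)) (fix_post l t)"
    proof (rule runs_Seq[OF orc[OF so1]])
      show "oracle_time + (6 + N * 7 + oracle_time + r * r * (3 + N * 3 + oracle_time)) \<le>
        6 + N * 7 + 2 * oracle_time + r * r * (3 + N * 3 + oracle_time)" by simp
      fix s2 assume s2: "same_outside fix_vars s0 s2 \<and> rmem s2 ''z'' = rmem s1 ''z'' \<and>
        oracle_result l (rv s2 ''z'') K (rv s2 ''q'') \<and> gap s2"
      then have so2: "same_outside fix_vars s0 s2" by blast
      have z2: "\<forall>k<N. rmem s2 ''z'' [k] = 0" using s2 z1 by simp
      have q2: "valid ?B (rv s2 ''q'')" "\<forall>a<N. \<bar>rmem s2 ''q'' [a]\<bar> \<le> K"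
      proof -
        have "oracle_result l (rv s2 ''z'') K (rv s2 ''q'')" using s2 by blast
        from oracle_zero_valid[OF this z2 l(1) K(2)]
        show "valid ?B (rv s2 ''q'')" "\<forall>a<N. \<bar>rmem s2 ''q'' [a]\<bar> \<le> K" by blast+
      qed
      have lay2: "lay s2" using pres[OF so2] by blast
      show "runs orac (Seq load_com (Seq oracle_com
         (Seq (While (RLess (R ''t2'') (R ''g'')) (Seq step_com oracle_com)) argmin_com))) s2
         (6 + N * 7 + oracle_time + r * r * (3 + N * 3 + oracle_time)) (fix_post l t)"
      proof (rule runs_Seq[OF runs_load[OF lay2]])
        show "2 + N * (1 + 2) + (4 + N * 4 + oracle_time + r * r * (3 + N * 3 + oracle_time)) \<le>
          6 + N * 7 + oracle_time + r * r * (3 + N * 3 + oracle_time)" by simp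
        fix s3 assume z3: "\<forall>k<N. rmem s3 ''z'' [k] = rmem s2 ''q'' [k]" and "same_outside (writes load_com) s2 s3"
        then have so3: "same_outside fix_vars s0 s3" using zvars[OF _ Wclear(2) so2] by blast
        have "valid ?B (rv s3 ''z'')" by (rule valid_cong[OF q2(1) cl_sub[OF l(1)]]) (use z3 in simp)
        moreover have zQ: "\<forall>a<N. \<bar>rmem s3 ''z'' [a]\<bar> \<le> ?Q" using z3 q2(2) KQ by (metis order_trans)
        ultimately have ok3: "ok s3" by (simp add: ok_def)
        have "(\<Sum>k<N. (rmem s3 ''z'' [k])\<^sup>2) \<le> (\<Sum>k<N. ?Q\<^sup>2)"
        proof (rule sum_mono)
          fix k assume "k \<in> {..<N}"
          then have "\<bar>rmem s3 ''z'' [k]\<bar> \<le> \<bar>?Q\<bar>" using zQ by force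
          then show "(rmem s3 ''z'' [k])\<^sup>2 \<le> ?Q\<^sup>2" by (simp only: abs_le_square_iff)
        qed
        also have "\<dots> = N * ?Q\<^sup>2" by simp
        \<comment> \<open>A factor four is given away: \<open>r\<close> is fitted to squared
          distances between two vectors, not to the squared norm of one.\<close>
        also have "\<dots> \<le> 4 * N * ?Q\<^sup>2" by (intro mult_right_mono) auto
        finally have pot: "(\<Sum>k<N. (rmem s3 ''z'' [k])\<^sup>2) \<le> r * t\<^sup>2" using r(3) by simp
        show "runs orac (Seq oracle_com
         (Seq (While (RLess (R ''t2'') (R ''g'')) (Seq step_com oracle_com)) argmin_com)) s3
         (4 + N * 4 + oracle_time + r * r * (3 + N * 3 + oracle_time)) (fix_post l t)"
        proof (rule runs_Seq[OF orc[OF so3]])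
          show "oracle_time + (4 + N * 4 + r * r * (3 + N * 3 + oracle_time)) \<le>
            4 + N * 4 + oracle_time + r * r * (3 + N * 3 + oracle_time)" by simp
          fix s4 assume s4: "same_outside fix_vars s0 s4 \<and> rmem s4 ''z'' = rmem s3 ''z'' \<and>
            oracle_result l (rv s4 ''z'') K (rv s4 ''q'') \<and> gap s4"
          have z4: "rmem s4 ''z'' = rmem s3 ''z''" using s4 by blast
          have "ok s4" using ok3 unfolding ok_def z4 .
          moreover have "real 0 * (t\<^sup>2 / r) + (\<Sum>k<N. (rmem s4 ''z'' [k])\<^sup>2) \<le> r * t\<^sup>2"
            using pot unfolding z4 by simp
          ultimately have J4: "J 0 s4" unfolding J_def using s4 by blast
          show "runs orac (Seq (While (RLess (R ''t2'') (R ''g'')) (Seq step_com oracle_com)) argmin_com) s4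
            (4 + N * 4 + r * r * (3 + N * 3 + oracle_time)) (fix_post l t)"
          proof (rule runs_Seq[OF loop[OF J4]])
            show "1 + r * r * ((2 + N * (1 + 2) + oracle_time) + 1) + (3 + N * (2 + 2)) \<le>
              4 + N * 4 + r * r * (3 + N * 3 + oracle_time)"
            proof -
              have eq: "(2 + N * (1 + 2) + oracle_time) + 1 = 3 + N * 3 + oracle_time" by simp
              have "1 + c + (3 + N * (2 + 2)) \<le> 4 + N * 4 + c" for c by simp
              then show ?thesis unfolding eq .
            qed
          qed (use argmin in blast)
        qed
      qed
    qed
  qed
qed

end

section \<open>Rounds of new implications\<close>

text \<open>\<open>R\<close> is the largest excess of a closure over the closure of truth, and
  \<open>l0\<close> attains it. Unlike the maximum of \<open>f\<close>, this is found with one query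
  per living literal.\<close>

definition scan_com :: com where
  "scan_com = Seq (NAssign ''l'' [] (NConst 0)) (Seq (set_base (V ''l'')) (Seq (Query ''f0'' [] ''a'')
     (Seq (RAssign ''R'' [] zero_r) (Seq (NAssign ''l0'' [] (NConst 0)) (For ''k'' (V ''L'')
       (Cond (BNot (Imp (V ''k'') (bar_exp (V ''k''))))
         (Seq (set_base (V ''k'')) (Seq (Query ''v'' [] ''a'')
           (Cond (RLess (R ''R'') (RSub (R ''v'') (R ''f0'')))
             (Seq (RAssign ''R'' [] (RSub (R ''v'') (R ''f0''))) (NAssign ''l0'' [] (V ''k''))) Skip))) Skip))))))"

text \<open>A greedy vector taken at \<open>z = 0\<close> bounds \<open>f\<close> from below by
  \<open>f (cl 0)\<close> minus the sum of its absolute entries. Adding \<open>R\<close> yields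
  \<open>Lam\<close>, an upper bound for the range that enters \<open>chain_bound\<close>.\<close>

definition total_com :: com where
  "total_com = Seq clear_com (Seq oracle_com (Seq (RAssign ''Lam'' [] (R ''R''))
     (For ''k'' (V ''L'') (Cond (RLess (RLoad ''q'' [V ''k'']) zero_r)
       (RAssign ''Lam'' [] (RSub (R ''Lam'') (RLoad ''q'' [V ''k''])))
       (RAssign ''Lam'' [] (RAdd (R ''Lam'') (RLoad ''q'' [V ''k''])))))))"

definition size_exp :: rexp where
  "size_exp = RAdd (ROfNat (V ''L'')) (ROfNat (NConst 1))"

text \<open>\<open>K\<close> is the entry bound of \<open>chain_bound\<close>; the denominator of
  \<open>tau\<close> is the one required by \<open>scale_progress\<close>.\<close>

definition const_com :: com where
  "const_com = Seq (RAssign ''K'' [] (RMul size_exp (R ''Lam'')))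
     (Seq (RAssign ''tau'' [] (RDiv (R ''Lam'') (RMul (ROfNat (NConst 2)) (RMul size_exp (RMul size_exp size_exp)))))
     (RAssign ''t2'' [] (RMul (ROfNat (NConst 2)) (RMul (R ''tau'') (R ''tau'')))))"

definition scale_com :: com where
  "scale_com = Seq scan_com (Seq total_com const_com)"

definition found_exp :: bexp where
  "found_exp = RLess (RLoad ''z'' [V ''w'']) (RSub zero_r (R ''tau''))"

text \<open>A failed search from truth says that \<open>cl 0\<close> is nearly optimal, so the scale
  must come from \<open>l0\<close>. If the search from \<open>l0\<close> fails too, all sets with
  \<open>l0\<close> are worse than \<open>cl 0\<close>, and the fact recorded is that
  \<open>l0\<close> implies its own negation.\<close>

definition search_com :: com where
  "search_com = Seq (NAssign ''l'' [] (NConst 0)) (Seq fix_com (Cond found_exp Skip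
     (Seq (NAssign ''l'' [] (V ''l0'')) (Seq fix_com
       (Cond found_exp Skip (NAssign ''w'' [] (bar_exp (V ''l''))))))))"

definition add_arc_com :: "string \<Rightarrow> string \<Rightarrow> com" where
  "add_arc_com a b = For ''i'' (V ''L'') (For ''k'' (V ''L'')
     (Cond (BAnd (Imp (V ''i'') (V a)) (Imp (V b) (V ''k''))) (NAssign ''imp'' [V ''i'', V ''k''] (NConst 1)) Skip))"

definition arcs_com :: com where
  "arcs_com = Seq (NAssign ''wb'' [] (bar_exp (V ''w''))) (Seq (NAssign ''lb'' [] (bar_exp (V ''l'')))
     (Seq (add_arc_com ''l'' ''w'') (add_arc_com ''wb'' ''lb'')))"

definition round_com :: com where
  "round_com = Seq search_com (Seq arcs_com scale_com)"

definition close_com :: com where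
  "close_com = Seq scale_com (While (RLess zero_r (R ''Lam'')) round_com)"

lemma runs_add_arc:
  assumes lay: "layout n x ch imp s0" and ab: "a \<noteq> ''i''" "a \<noteq> ''k''" "a \<noteq> ''imp''" "a \<noteq> ''skip''"
      "b \<noteq> ''i''" "b \<noteq> ''k''" "b \<noteq> ''imp''" "b \<noteq> ''skip''"
    and v: "nmem s0 a [] = l" "nmem s0 b [] = w" "l < nlits n" "w < nlits n"
  shows "runs orac (add_arc_com a b) s0 (2 + nlits n * (4 + nlits n * 4)) (layout n x ch (add_arc imp l w))"
proof -
  let ?N = "nlits n"
  let ?body = "Cond (BAnd (Imp (V ''i'') (V a)) (Imp (V b) (V ''k''))) (NAssign ''imp'' [V ''i'', V ''k''] (NConst 1)) Skip"
  let ?inner = "For ''k'' (V ''L'') ?body"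
  define ok where "ok i k s \<longleftrightarrow> (\<forall>p<?N. \<forall>q<?N. 0 < nmem s ''imp'' [p, q] \<longleftrightarrow>
    imp p q \<or> (p < i \<or> p = i \<and> q < k) \<and> imp p l \<and> imp w q)" for i k and s :: store
  have pres: "nmem s y = nmem s0 y" if "same_outside {''i'', ''k'', ''imp'', ''skip''} s0 s" "y \<notin> {''i'', ''k'', ''imp'', ''skip''}" for s y
    using that by (rule same_outsideD)
  have L: "nmem s ''L'' [] = ?N" "nmem s a [] = l" "nmem s b [] = w"
    if "same_outside {''i'', ''k'', ''imp'', ''skip''} s0 s" for s
    using pres[OF that] ab v lay by (simp_all add: layout_def)
  have W: "insert ''k'' (writes ?body) \<subseteq> {''i'', ''k'', ''imp'', ''skip''}" "insert ''i'' (writes ?inner) \<subseteq> {''i'', ''k'', ''imp'', ''skip''}"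
    by simp_all
  have "runs orac (add_arc_com a b) s0 (2 + ?N * ((2 + ?N * (2 + 2)) + 2)) (ok ?N 0)"
    unfolding add_arc_com_def
  proof (rule runs_For[where I = "\<lambda>i. ok i 0"])
    show "ok 0 0 (nupdate ''i'' [] 0 s0)" using lay by (simp add: ok_def layout_def)
    show "same_outside (insert ''i'' (writes ?inner)) s0 s \<Longrightarrow> nval s (V ''L'') = ?N" for s
      using L(1)[OF same_outside_mono[OF _ W(2)]] by simp
    fix i s assume i: "i < ?N" "nmem s ''i'' [] = i" and ok: "ok i 0 s"
      and "same_outside (insert ''i'' (writes ?inner)) s0 s"
    then have so: "same_outside {''i'', ''k'', ''imp'', ''skip''} s0 s" using same_outside_mono[OF _ W(2)] by blast
    have "runs orac ?inner s (2 + ?N * (2 + 2)) (\<lambda>s'. nmem s' ''i'' [] = i \<and> ok i ?N s')"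
    proof (rule runs_For[where I = "\<lambda>k s'. nmem s' ''i'' [] = i \<and> ok i k s'"])
      show "nmem (nupdate ''k'' [] 0 s) ''i'' [] = i \<and> ok i 0 (nupdate ''k'' [] 0 s)"
        using i ok by (simp add: ok_def)
      show "same_outside (insert ''k'' (writes ?body)) s s' \<Longrightarrow> nval s' (V ''L'') = ?N" for s'
        using L(1)[OF same_outside_trans[OF so same_outside_mono[OF _ W(1)]]] by simp
      fix k s' assume k: "k < ?N" "nmem s' ''k'' [] = k" and I: "nmem s' ''i'' [] = i \<and> ok i k s'"
        and "same_outside (insert ''k'' (writes ?body)) s s'"
      then have so': "same_outside {''i'', ''k'', ''imp'', ''skip''} s0 s'"
        using same_outside_trans[OF so same_outside_mono[OF _ W(1)]] by blast
      note Ls = L[OF so']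
      \<comment> \<open>Updating in place is harmless. Only column \<open>l\<close> and row
        \<open>w\<close> are read, and a pair added there was already present.\<close>
      have g: "0 < nmem s' ''imp'' [i, l] \<longleftrightarrow> imp i l" "0 < nmem s' ''imp'' [w, k] \<longleftrightarrow> imp w k"
        using I i(1) k(1) v unfolding ok_def by blast+
      show "runs orac ?body s' 2 (\<lambda>s''. nmem (nupdate ''k'' [] (Suc k) s'') ''i'' [] = i \<and> ok i (Suc k) (nupdate ''k'' [] (Suc k) s''))"
      proof (cases "imp i l \<and> imp w k")
        case True
        then have "ok i (Suc k) (nupdate ''imp'' [i, k] 1 s')"
          using I unfolding ok_def by (auto simp: less_Suc_eq)
        then have "ok i (Suc k) (nupdate ''k'' [] (Suc k) (nupdate ''imp'' [i, k] 1 s'))" by (simp add: ok_def)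
        then show ?thesis using True g Ls k I by simp
      next
        case False
        then have "ok i (Suc k) s'" using I unfolding ok_def by (auto simp: less_Suc_eq)
        then have "ok i (Suc k) (nupdate ''k'' [] (Suc k) (nupdate ''skip'' [] 0 s'))" by (simp add: ok_def)
        then show ?thesis using False g Ls k I by (cases "imp i l") simp_all
      qed
    qed simp
    then show "runs orac ?inner s (2 + ?N * (2 + 2)) (\<lambda>s'. ok (Suc i) 0 (nupdate ''i'' [] (Suc i) s'))"
    proof (rule runs_conseq)
      fix s' assume "nmem s' ''i'' [] = i \<and> ok i ?N s'"
      then show "ok (Suc i) 0 (nupdate ''i'' [] (Suc i) s')"
        unfolding ok_def by (auto simp: less_Suc_eq)
    qed simp
  qed simp
  then show ?thesis
  proof (rule runs_conseq)
    fix s assume ok: "ok ?N 0 s" and "same_outside (writes (add_arc_com a b)) s0 s"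
    then have so: "same_outside {''i'', ''k'', ''imp'', ''skip''} s0 s"
      by (elim same_outside_mono) (simp add: add_arc_com_def)
    have "\<forall>p<?N. \<forall>q<?N. 0 < nmem s ''imp'' [p, q] \<longleftrightarrow> add_arc imp l w p q"
      using ok unfolding ok_def add_arc_def by blast
    then show "layout n x ch (add_arc imp l w) s"
      using lay by (simp add: layout_def pres[OF so])
  qed (simp add: algebra_simps)
qed

definition scale_steps :: "nat \<Rightarrow> nat" where
  "scale_steps n = 20 + nlits n * (31 + nlits n * 11) + oracle_steps n"

context machine begin

text \<open>The vector \<open>b\<close> and its chain are ghost data. The program keeps only the
  total \<open>Lam\<close>, while the chain certifies the lower bound for \<open>f\<close>.\<close>

definition scale_post :: "store \<Rightarrow> bool" where
  "scale_post s \<longleftrightarrow> (\<exists>r p I b. r \<ge> 0 \<and> (\<forall>m. alive m \<longrightarrow> f (cl m) \<le> f (cl 0) + r) \<and>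
     alive (nmem s ''l0'' []) \<and> f (cl (nmem s ''l0'' [])) = f (cl 0) + r \<and>
     monotone_weight (cl 0) p \<and> chain p (cl 0) I b \<and> (\<forall>m. \<not> candidate I m) \<and>
     rmem s ''Lam'' [] = r + (\<Sum>k<N. \<bar>b k\<bar>) \<and> rmem s ''K'' [] = (N + 1) * rmem s ''Lam'' [] \<and>
     rmem s ''tau'' [] = rmem s ''Lam'' [] / (2 * (real N + 1) ^ 3) \<and> rmem s ''t2'' [] = 2 * (rmem s ''tau'' [])\<^sup>2)"

definition scan_post :: "nat \<Rightarrow> store \<Rightarrow> bool" where
  "scan_post j s \<longleftrightarrow> rmem s ''f0'' [] = f (cl 0) \<and> nmem s ''l'' [] = 0 \<and> rmem s ''R'' [] \<ge> 0 \<and>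
     (\<forall>m<j. alive m \<longrightarrow> f (cl m) \<le> f (cl 0) + rmem s ''R'' []) \<and>
     alive (nmem s ''l0'' []) \<and> f (cl (nmem s ''l0'' [])) = f (cl 0) + rmem s ''R'' []"

lemma runs_scan:
  assumes lay: "lay s0"
  shows "runs orac scan_com s0 (12 + N * (24 + N * 11)) (scan_post N)"
proof -
  let ?s = "nupdate ''l'' [] 0 s0"
  have lay0: "lay ?s" using lay by (simp add: layout_def)
  let ?body = "Cond (BNot (Imp (V ''k'') (bar_exp (V ''k''))))
         (Seq (set_base (V ''k'')) (Seq (Query ''v'' [] ''a'')
           (Cond (RLess (R ''R'') (RSub (R ''v'') (R ''f0'')))
             (Seq (RAssign ''R'' [] (RSub (R ''v'') (R ''f0''))) (NAssign ''l0'' [] (V ''k''))) Skip))) Skip"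
  have "runs orac (Seq (set_base (V ''l'')) (Seq (Query ''f0'' [] ''a'')
     (Seq (RAssign ''R'' [] zero_r) (Seq (NAssign ''l0'' [] (NConst 0)) (For ''k'' (V ''L'') ?body))))) ?s
     (11 + N * (24 + N * 11)) (scan_post N)"
  proof (rule runs_Seq[OF runs_set_base[OF lay0 alive_tt]])
    show "same_outside {''i'', ''in'', ''a'', ''skip''} ?s s \<Longrightarrow> nval s (V ''l'') = 0" for s
      by (simp add: same_outsideD)
    show "6 + N * 11 + (5 + N * (13 + N * 11)) \<le> 11 + N * (24 + N * 11)" by (simp add: algebra_simps)
    fix s1 assume h: "holds (cl 0) s1" and "same_outside (writes (set_base (V ''l''))) ?s s1"
    then have so: "same_outside {''i'', ''in'', ''a'', ''skip''} ?s s1"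
      using same_outside_mono[OF _ writes_set_base] by blast
    have lay1: "lay s1" by (rule layout_same[OF so _ lay0]) simp
    have l1: "nmem s1 ''l'' [] = 0" by (simp add: same_outsideD[OF so])
    let ?s2 = "nupdate ''l0'' [] 0 (rupdate ''R'' [] 0 (rupdate ''f0'' [] (f (cl 0)) s1))"
    have lay2: "lay ?s2" using lay1 by (simp add: layout_def)
    have "runs orac (For ''k'' (V ''L'') ?body) ?s2 (2 + N * ((11 + N * 11) + 2)) (scan_post N)"
    proof (rule runs_for_literals[OF lay2])
      show "''k'' \<notin> writes ?body" "writes ?body \<inter> {''h'', ''L'', ''bar'', ''var'', ''ch'', ''x'', ''imp''} = {}"
        by (simp_all add: set_base_def add_cl_def)
      show "scan_post 0 (nupdate ''k'' [] 0 ?s2)" using l1 alive_tt by (simp add: scan_post_def)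
      fix j s assume j: "j < N" "nmem s ''k'' [] = j" and lay': "lay s" and P: "scan_post j s"
      have g: "bval s (BNot (Imp (V ''k'') (bar_exp (V ''k'')))) \<longleftrightarrow> alive j"
        using j lay_bar[OF lay' j(1)] lay_imp[OF lay' j(1) lbar_less[OF j(1)]] by (simp add: alive_def)
      have P_k: "scan_post i (nupdate ''k'' [] v s) = scan_post i s" for i v s by (simp add: scan_post_def)
      show "runs orac ?body s (11 + N * 11) (\<lambda>s'. scan_post (Suc j) (nupdate ''k'' [] (Suc j) s'))"
        unfolding P_k
      proof (cases "alive j")
        case False
        have "scan_post (Suc j) (nupdate ''skip'' [] 0 s)"
          using P False by (auto simp: scan_post_def less_Suc_eq)
        then show "runs orac ?body s (11 + N * 11) (scan_post (Suc j))"
          unfolding runs_Cond[of _ "BNot (Imp (V ''k'') (bar_exp (V ''k'')))"] g using False by simp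
      next
        case True
        have "runs orac (Seq (set_base (V ''k'')) (Seq (Query ''v'' [] ''a'')
           (Cond (RLess (R ''R'') (RSub (R ''v'') (R ''f0'')))
             (Seq (RAssign ''R'' [] (RSub (R ''v'') (R ''f0''))) (NAssign ''l0'' [] (V ''k''))) Skip))) s (10 + N * 11)
             (scan_post (Suc j))"
        proof (rule runs_Seq[OF runs_set_base[OF lay' True]])
          show "same_outside {''i'', ''in'', ''a'', ''skip''} s s' \<Longrightarrow> nval s' (V ''k'') = j" for s'
            using j by (simp add: same_outsideD)
          show "6 + N * 11 + 4 \<le> 10 + N * 11" by simp
          fix s' assume h': "holds (cl j) s'" and "same_outside (writes (set_base (V ''k''))) s s'"
          then have so': "same_outside {''i'', ''in'', ''a'', ''skip''} s s'"
            using same_outside_mono[OF _ writes_set_base] by blast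
          have eq: "rmem s' ''R'' = rmem s ''R''" "rmem s' ''f0'' = rmem s ''f0''" "nmem s' ''l0'' = nmem s ''l0''"
            "nmem s' ''l'' = nmem s ''l''" "nmem s' ''k'' = nmem s ''k''" by (simp_all add: same_outsideD[OF so'])
          show "runs orac (Seq (Query ''v'' [] ''a'')
           (Cond (RLess (R ''R'') (RSub (R ''v'') (R ''f0'')))
             (Seq (RAssign ''R'' [] (RSub (R ''v'') (R ''f0''))) (NAssign ''l0'' [] (V ''k''))) Skip)) s' 4 (scan_post (Suc j))"
            using P True j by (auto simp: query_holds[OF h'] scan_post_def eq less_Suc_eq)
        qed
        then show "runs orac ?body s (11 + N * 11) (scan_post (Suc j))"
          unfolding runs_Cond[of _ "BNot (Imp (V ''k'') (bar_exp (V ''k'')))"] g using True by simp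
      qed
    qed
    then have "runs orac (For ''k'' (V ''L'') ?body) ?s2 (2 + N * (13 + N * 11)) (scan_post N)"
      by (rule runs_conseq) simp_all
    then show "runs orac (Seq (Query ''f0'' [] ''a'')
     (Seq (RAssign ''R'' [] zero_r) (Seq (NAssign ''l0'' [] (NConst 0)) (For ''k'' (V ''L'') ?body)))) s1
     (5 + N * (13 + N * 11)) (scan_post N)"
      using query_holds[OF h] by simp
  qed
  then show ?thesis by (simp add: scan_com_def)
qed

abbreviation "scale_time \<equiv> scale_steps n"

lemma runs_scale:
  assumes lay: "lay s0"
  shows "runs orac scale_com s0 scale_time scale_post"
  unfolding scale_com_def
proof (rule runs_Seq[OF runs_scan[OF lay]])
  show "12 + N * (24 + N * 11) + (8 + N * 7 + oracle_time) \<le> scale_time"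
    by (simp add: scale_steps_def algebra_simps)
  fix s1 assume P: "scan_post N s1" and "same_outside (writes scan_com) s0 s1"
  then have so1: "same_outside {''l'', ''i'', ''in'', ''a'', ''skip'', ''f0'', ''R'', ''l0'', ''k'', ''v''} s0 s1"
    by (elim same_outside_mono) (simp add: scan_com_def set_base_def add_cl_def)
  have lay1: "lay s1" by (rule layout_same[OF so1 _ lay]) simp
  show "runs orac (Seq total_com const_com) s1 (8 + N * 7 + oracle_time) scale_post"
  proof (rule runs_Seq)
    let ?r = "rmem s1 ''R'' []"
    define Q where "Q s \<longleftrightarrow> (\<exists>p I b. monotone_weight (cl 0) p \<and> chain p (cl 0) I b \<and> (\<forall>m. \<not> candidate I m) \<and>
      rmem s ''Lam'' [] = ?r + (\<Sum>k<N. \<bar>b k\<bar>))" for s :: store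
    show "runs orac total_com s1 (5 + N * 7 + oracle_time) Q"
      unfolding total_com_def
    proof (rule runs_Seq[OF runs_clear[OF lay1]])
      show "2 + N * (1 + 2) + (3 + N * 4 + oracle_time) \<le> 5 + N * 7 + oracle_time" by simp
      fix s2 assume z: "\<forall>k<N. rmem s2 ''z'' [k] = 0" and "same_outside (writes clear_com) s1 s2"
      then have so2: "same_outside {''k'', ''z''} s1 s2" by (elim same_outside_mono) (simp add: clear_com_def)
      have lay2: "lay s2" by (rule layout_same[OF so2 _ lay1]) simp
      have l2: "nmem s2 ''l'' [] = 0" using P by (simp add: same_outsideD[OF so2] scan_post_def)
      let ?c = "Cond (RLess (RLoad ''q'' [V ''k'']) zero_r)
       (RAssign ''Lam'' [] (RSub (R ''Lam'') (RLoad ''q'' [V ''k''])))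
       (RAssign ''Lam'' [] (RAdd (R ''Lam'') (RLoad ''q'' [V ''k''])))"
      show "runs orac (Seq oracle_com (Seq (RAssign ''Lam'' [] (R ''R'')) (For ''k'' (V ''L'') ?c))) s2
        (3 + N * 4 + oracle_time) Q"
      proof (rule runs_Seq[OF runs_oracle[OF lay2 alive_tt l2]])
        show "oracle_time + (3 + N * 4) \<le> 3 + N * 4 + oracle_time" by simp
        fix s3 assume res: "oracle_result 0 (rv s2 ''z'') (rmem s2 ''K'' []) (rv s3 ''q'') \<and>
            rmem s3 ''g'' [] = (\<Sum>k<N. rmem s2 ''z'' [k] * (rmem s2 ''z'' [k] - rmem s3 ''q'' [k]))"
          and "same_outside (writes oracle_com) s2 s3"
        then have so3: "same_outside {''k'', ''q'', ''i'', ''in'', ''a'', ''skip'', ''v'', ''u'', ''best'', ''m'', ''mi'', ''p'', ''g''} s2 s3"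
          using same_outside_mono[OF _ writes_oracle] by blast
        have lay3: "lay s3" by (rule layout_same[OF so3 _ lay2]) simp
        have R3: "rmem s3 ''R'' [] = ?r" by (simp add: same_outsideD[OF so3] same_outsideD[OF so2])
        obtain p I b where b: "monotone_weight (cl 0) p" "chain p (cl 0) I b" "\<forall>m. \<not> candidate I m" "\<forall>a<N. rmem s3 ''q'' [a] = b a"
          using res by (blast intro: oracle_result_zero[OF _ z])
        let ?s3 = "rupdate ''Lam'' [] ?r s3"
        have lay3': "lay ?s3" using lay3 by (simp add: layout_def)
        have "runs orac (For ''k'' (V ''L'') ?c) ?s3 (2 + N * (2 + 2)) (\<lambda>s. rmem s ''Lam'' [] = ?r + (\<Sum>k<N. \<bar>b k\<bar>))"
        proof (rule runs_for_literals[where I = "\<lambda>j s. rmem s ''Lam'' [] = ?r + (\<Sum>k<j. \<bar>b k\<bar>)", OF lay3'])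
          fix j s assume so: "same_outside (insert ''k'' (writes ?c)) ?s3 s" and j: "j < N" "nmem s ''k'' [] = j"
            and I: "rmem s ''Lam'' [] = ?r + (\<Sum>k<j. \<bar>b k\<bar>)"
          have "rmem s ''q'' [j] = b j" using so b(4) j by (simp add: same_outsideD)
          then show "runs orac ?c s 2 (\<lambda>s'. rmem (nupdate ''k'' [] (Suc j) s') ''Lam'' [] = ?r + (\<Sum>k<Suc j. \<bar>b k\<bar>))"
            using j I by simp
        qed simp_all
        then have "runs orac (For ''k'' (V ''L'') ?c) ?s3 (2 + N * (2 + 2)) Q"
          by (rule runs_conseq) (use b in \<open>auto simp: Q_def\<close>)
        then show "runs orac (Seq (RAssign ''Lam'' [] (R ''R'')) (For ''k'' (V ''L'') ?c)) s3 (3 + N * 4) Q"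
          by (intro runs_Seq[of orac _ s3 1 "\<lambda>s. s = ?s3" "2 + N * (2 + 2)"]) (simp_all add: R3)
      qed
    qed
    show "5 + N * 7 + oracle_time + 3 \<le> 8 + N * 7 + oracle_time" by simp
    fix s4 assume Q: "Q s4" and "same_outside (writes total_com) s1 s4"
    then have so4: "same_outside {''k'', ''z'', ''q'', ''i'', ''in'', ''a'', ''skip'', ''v'', ''u'', ''best'', ''m'', ''mi'', ''p'', ''g'', ''Lam''} s1 s4"
      by (elim same_outside_mono) (simp add: total_com_def clear_com_def oracle_com_def chain_com_def set_base_def
          add_cl_def select_com_def grow_com_def blocking_com_def weight_com_def flow_com_def gap_com_def)
    have lay4: "lay s4" by (rule layout_same[OF so4 _ lay1]) simp
    have l0: "nmem s4 ''l0'' = nmem s1 ''l0''" by (simp add: same_outsideD[OF so4])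
    obtain p I b where b: "monotone_weight (cl 0) p" "chain p (cl 0) I b" "\<forall>m. \<not> candidate I m"
      and Lam: "rmem s4 ''Lam'' [] = ?r + (\<Sum>k<N. \<bar>b k\<bar>)" using Q unfolding Q_def by blast
    let ?tau = "rmem s4 ''Lam'' [] / (2 * (real N + 1) ^ 3)"
    let ?s5 = "rupdate ''t2'' [] (2 * (?tau * ?tau)) (rupdate ''tau'' [] ?tau (rupdate ''K'' [] ((real N + 1) * rmem s4 ''Lam'' []) s4))"
    have run: "runs orac const_com s4 3 S \<longleftrightarrow> S ?s5" for S
      by (simp add: const_com_def size_exp_def lay_L[OF lay4] power3_eq_cube mult.assoc)
    have r0: "?r \<ge> 0" "\<forall>m. alive m \<longrightarrow> f (cl m) \<le> f (cl 0) + ?r" using P alive_less by (auto simp: scan_post_def)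
    have "alive (nmem s1 ''l0'' [])" "f (cl (nmem s1 ''l0'' [])) = f (cl 0) + ?r" using P by (auto simp: scan_post_def)
    then have "scale_post ?s5"
      unfolding scale_post_def using r0 b Lam
      by (intro exI[of _ ?r] exI[of _ p] exI[of _ I] exI[of _ b]) (simp add: l0 power2_eq_square)
    then show "runs orac const_com s4 3 scale_post" unfolding run .
  qed
qed

end

text \<open>With \<open>N = nlits n\<close>, this solves the equation for \<open>r\<close> in
  \<open>runs_fix\<close>: there \<open>K = (N + 1) * Lam\<close> and
  \<open>Lam = 2 * (N + 1) ^ 3 * t\<close>, so the scale cancels. The step size depends on
  \<open>n\<close> alone and is computed once.\<close>

definition rho :: "nat \<Rightarrow> nat" where
  "rho n = 16 * nlits n * (2 * nlits n + 1)\<^sup>2 * (nlits n + 1) ^ 8"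

lemma rho_identity:
  fixes t Lam :: real
  assumes "t = Lam / (2 * (real (nlits n) + 1) ^ 3)"
  shows "rho n * t\<^sup>2 = 4 * nlits n * ((2 * nlits n + 1) * ((nlits n + 1) * Lam))\<^sup>2"
proof -
  define M where "M = real (nlits n)"
  have M: "M \<ge> 0" "real (rho n) = 16 * M * (2 * M + 1)\<^sup>2 * (M + 1) ^ 8" by (simp_all add: M_def rho_def add.commute)
  have "Lam = 2 * (M + 1) ^ 3 * t" using assms M(1) by (simp add: M_def)
  then have "(M + 1) * Lam = 2 * (M + 1) ^ 4 * t" by (simp add: power4_eq_xxxx power3_eq_cube)
  then have "4 * M * ((2 * M + 1) * ((M + 1) * Lam))\<^sup>2 = 4 * M * ((2 * M + 1) * (2 * (M + 1) ^ 4 * t))\<^sup>2" by simp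
  also have "\<dots> = 16 * M * (2 * M + 1)\<^sup>2 * (M + 1) ^ 8 * t\<^sup>2"
    by (simp add: power_mult_distrib power_mult[symmetric])
  finally have "16 * M * (2 * M + 1)\<^sup>2 * (M + 1) ^ 8 * t\<^sup>2 = 4 * M * ((2 * M + 1) * ((M + 1) * Lam))\<^sup>2" by (rule sym)
  then show ?thesis using M(2) by (simp add: M_def add.commute)
qed

lemma writes_search: "writes search_com \<subseteq> {''l''} \<union> fix_vars"
  by (simp add: search_com_def fix_com_def clear_com_def load_com_def step_com_def argmin_com_def
      oracle_com_def chain_com_def set_base_def add_cl_def select_com_def grow_com_def
      blocking_com_def weight_com_def flow_com_def gap_com_def)

lemma writes_scale: "writes scale_com \<inter> {''h'', ''L'', ''bar'', ''var'', ''ch'', ''x'', ''imp''} = {}"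
    "''gam'' \<notin> writes scale_com"
  by (simp_all add: scale_com_def scan_com_def total_com_def const_com_def clear_com_def oracle_com_def chain_com_def
      set_base_def add_cl_def select_com_def grow_com_def blocking_com_def weight_com_def flow_com_def gap_com_def)

definition round_steps :: "nat \<Rightarrow> nat" where
  "round_steps n = 11 + 2 * fix_steps n (rho n) + 2 * (nlits n * (4 + nlits n * 4)) + scale_steps n"

definition close_steps :: "nat \<Rightarrow> nat" where
  "close_steps n = scale_steps n + (1 + nlits n * nlits n * (round_steps n + 1))"

section \<open>Progress of a round relative to the scale\<close>

context machine begin

lemma lower_bound_from_chain:
  assumes "monotone_weight (cl 0) p" "chain p (cl 0) I b" "\<forall>m. \<not> candidate I m" and A: "A \<in> ideals imp"
  shows "f (cl 0) - (\<Sum>k<N. \<bar>b k\<bar>) \<le> f A"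
proof -
  have "valid (cl 0) b"
    by (rule chain_valid[OF assms(1) cl_ideal[OF alive_tt] assms(2)]) (use assms(3) in blast)
  moreover have "0 \<in> A" "A \<subseteq> {..<N}" using A by (auto simp: ideals_def)
  moreover have "cl 0 \<subseteq> A" by (rule cl_subset[OF A]) fact
  ultimately have "sum b A \<le> f A - f (cl 0)" using A by (auto simp: valid_def)
  moreover have "- (\<Sum>k<N. \<bar>b k\<bar>) \<le> sum b A"
  proof -
    have "- sum b A \<le> \<bar>sum b A\<bar>" by simp
    also have "\<dots> \<le> (\<Sum>k\<in>A. \<bar>b k\<bar>)" by (rule sum_abs)
    also have "\<dots> \<le> (\<Sum>k<N. \<bar>b k\<bar>)" using \<open>A \<subseteq> {..<N}\<close> by (intro sum_mono2) auto
    finally show ?thesis by simp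
  qed
  ultimately show ?thesis by simp
qed

text \<open>Used with two values of \<open>S\<close>: the total of the certifying vector, which
  gives the constant \<open>K\<close> of the program, and \<open>N * t\<close> after a failed search
  from truth.\<close>

lemma bounded_by_scale:
  fixes r S :: real
  assumes r: "r \<ge> 0" "\<forall>m. alive m \<longrightarrow> f (cl m) \<le> f (cl 0) + r"
    and lo: "\<And>A. A \<in> ideals imp \<Longrightarrow> f (cl 0) - S \<le> f A" and l: "alive l"
  shows "bounded_by l ((N + 1) * (r + S))"
  unfolding bounded_by_def
proof (intro allI impI)
  fix p I b a assume p: "monotone_weight (cl l) p" and ch: "chain p (cl l) I b" and a: "a < N"
  have "f I \<le> (f (cl 0) + r) + card I * ((f (cl 0) + r) - (f (cl 0) - S)) \<and>
    (\<forall>a\<in>{..<N}. \<bar>b a\<bar> \<le> (card {..<N} + 1) * ((f (cl 0) + r) - (f (cl 0) - S)))"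
    by (rule chain_bound[OF p cl_ideal[OF l] _ _ lo ch]) (use r l in auto)
  then show "\<bar>b a\<bar> \<le> (N + 1) * (r + S)" using a by simp
qed

text \<open>If \<open>f\<close> never drops more than \<open>N * t\<close> below
  \<open>f (cl 0)\<close> and \<open>r\<close> were at most \<open>N * t\<close> too, each entry of
  \<open>b\<close> would be at most \<open>(N + 1) * (2 * N * t)\<close>. Then \<open>Lam\<close>
  would stay below \<open>2 * (N + 1) ^ 3 * t\<close>, which it equals. The denominator of
  \<open>t\<close> is chosen for this comparison.\<close>

lemma scale_progress:
  fixes r t :: real
  assumes r: "r \<ge> 0" "\<forall>m. alive m \<longrightarrow> f (cl m) \<le> f (cl 0) + r"
    and p: "monotone_weight (cl 0) p" "chain p (cl 0) I b"
    and Lam: "Lam = r + (\<Sum>k<N. \<bar>b k\<bar>)" "Lam > 0" and t: "t = Lam / (2 * (real N + 1) ^ 3)"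
    and lo: "\<And>A. A \<in> ideals imp \<Longrightarrow> f (cl 0) - N * t \<le> f A"
  shows "N * t < r"
proof (rule ccontr)
  define M where "M = real N"
  assume "\<not> N * t < r"
  then have rM: "r \<le> M * t" by (simp add: M_def)
  have M: "M \<ge> 0" by (simp add: M_def)
  have t0: "t > 0" using Lam(2) unfolding t by (intro divide_pos_pos) auto
  have "bounded_by 0 ((N + 1) * (r + N * t))" by (rule bounded_by_scale[OF r lo alive_tt])
  then have "\<bar>b k\<bar> \<le> (N + 1) * (r + N * t)" if "k < N" for k
    using p that unfolding bounded_by_def by blast
  then have "(\<Sum>k<N. \<bar>b k\<bar>) \<le> (\<Sum>k<N. (N + 1) * (r + N * t))" by (intro sum_mono) auto
  also have "\<dots> = M * ((M + 1) * (r + M * t))" by (simp add: M_def)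
  also have "\<dots> \<le> M * ((M + 1) * (M * t + M * t))" using rM M by (intro mult_left_mono) auto
  finally have "Lam \<le> M * t + M * ((M + 1) * (M * t + M * t))" using Lam(1) rM by simp
  moreover have "Lam = 2 * (M + 1) ^ 3 * t" using t M by (simp add: M_def)
  ultimately have "2 * (M + 1) ^ 3 * t \<le> M * t + M * ((M + 1) * (M * t + M * t))" by simp
  moreover have "2 * (M + 1) ^ 3 * t - (M * t + M * ((M + 1) * (M * t + M * t))) = (4 * M * M + 5 * M + 2) * t"
    by (simp add: power3_eq_cube algebra_simps)
  moreover have "(4 * M * M + 5 * M + 2) * t > 0" using M t0 by (intro mult_pos_pos add_nonneg_pos) auto
  ultimately show False by linarith
qed

definition search_post :: "nat \<Rightarrow> nat \<Rightarrow> bool" where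
  "search_post l w \<longleftrightarrow> alive l \<and> w < N \<and> \<not> imp l w \<and>
    (\<forall>A\<in>least_sets f imp. (l \<in> A \<longrightarrow> w \<in> A) \<and> (lbar n w \<in> A \<longrightarrow> lbar n l \<in> A))"

lemma search_postI:
  assumes l: "alive l" and w: "w < N" "\<not> imp l w"
    and fix_w: "\<forall>A\<in>ideals imp. l \<in> A \<longrightarrow> (\<forall>A'\<in>ideals imp. l \<in> A' \<longrightarrow> f A \<le> f A') \<longrightarrow> w \<in> A"
  shows "search_post l w"
proof -
  have "(l \<in> A \<longrightarrow> w \<in> A) \<and> (lbar n w \<in> A \<longrightarrow> lbar n l \<in> A)" if "A \<in> least_sets f imp" for A
    by (rule fixed_literal_sound[OF l _ _ that]) (use w fix_w in auto)
  then show ?thesis using l w by (simp add: search_post_def)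
qed

lemma runs_search:
  assumes lay: "lay s0" and P: "scale_post s0" and pos: "0 < rmem s0 ''Lam'' []"
    and gam: "rmem s0 ''gam'' [] = 1 / real (rho n)"
  shows "runs orac search_com s0 (5 + 2 * fix_time (rho n)) (\<lambda>s. search_post (nmem s ''l'' []) (nmem s ''w'' []))"
proof -
  obtain r p I b where r: "r \<ge> 0" "\<forall>m. alive m \<longrightarrow> f (cl m) \<le> f (cl 0) + r"
    and l0: "alive (nmem s0 ''l0'' [])" "f (cl (nmem s0 ''l0'' [])) = f (cl 0) + r"
    and p: "monotone_weight (cl 0) p" "chain p (cl 0) I b" "\<forall>m. \<not> candidate I m"
    and Lam: "rmem s0 ''Lam'' [] = r + (\<Sum>k<N. \<bar>b k\<bar>)" and K: "rmem s0 ''K'' [] = (N + 1) * rmem s0 ''Lam'' []"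
    and tau: "rmem s0 ''tau'' [] = rmem s0 ''Lam'' [] / (2 * (real N + 1) ^ 3)"
    and t2: "rmem s0 ''t2'' [] = 2 * (rmem s0 ''tau'' [])\<^sup>2"
    using P unfolding scale_post_def by blast
  let ?t = "rmem s0 ''tau'' []" and ?K = "rmem s0 ''K'' []" and ?l0 = "nmem s0 ''l0'' []"
  have t0: "?t > 0" using pos unfolding tau by (intro divide_pos_pos) auto
  have bb: "bounded_by l ?K" if "alive l" for l
    unfolding K Lam by (rule bounded_by_scale[OF r lower_bound_from_chain[OF p] that])
  have rho0: "rho n > 0" by (simp add: rho_def nlits_def)
  have ident: "real (rho n) * ?t\<^sup>2 = 4 * N * ((2 * N + 1) * ?K)\<^sup>2"
    unfolding K by (rule rho_identity[OF tau])
  have fixr: "runs orac fix_com s (fix_time (rho n)) (\<lambda>s'. fix_post l ?t s' \<and> same_outside ({''l''} \<union> fix_vars) s0 s' \<and> nmem s' ''l'' [] = l)"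
    if so: "same_outside ({''l''} \<union> fix_vars) s0 s" and l: "alive l" "nmem s ''l'' [] = l" for s l
  proof -
    have lay': "lay s" by (rule layout_same[OF so _ lay]) simp
    have eq: "rmem s ''K'' [] = ?K" "rmem s ''t2'' [] = 2 * ?t\<^sup>2" "rmem s ''gam'' [] = 1 / real (rho n)"
      using t2 gam by (simp_all add: same_outsideD[OF so])
    show ?thesis
    proof (rule runs_conseq[OF runs_fix[OF lay' l eq(1) bb[OF l(1)] t0 eq(2,3) rho0 ident]])
      fix s' assume f: "fix_post l ?t s'" and "same_outside (writes fix_com) s s'"
      then have so': "same_outside fix_vars s s'" using same_outside_mono[OF _ writes_fix] by blast
      have "same_outside ({''l''} \<union> fix_vars) s s'" by (rule same_outside_mono[OF so']) blast
      then have "same_outside ({''l''} \<union> fix_vars) s0 s'" by (rule same_outside_trans[OF so])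
      moreover have "nmem s' ''l'' [] = l" using l by (simp add: same_outsideD[OF so'])
      ultimately show "fix_post l ?t s' \<and> same_outside ({''l''} \<union> fix_vars) s0 s' \<and> nmem s' ''l'' [] = l" using f by blast
    qed simp
  qed
  have found: "bval s found_exp \<longleftrightarrow> rmem s ''z'' [nmem s ''w'' []] < - ?t"
    if "same_outside ({''l''} \<union> fix_vars) s0 s" for s
    by (simp add: found_exp_def same_outsideD[OF that])
  have ok: "search_post l (nmem s ''w'' [])" if "fix_post l ?t s" "rmem s ''z'' [nmem s ''w'' []] < - ?t" "alive l" for l s
    using that unfolding fix_post_def by (intro search_postI) auto
  let ?s1 = "nupdate ''l'' [] 0 s0"
  have so1: "same_outside ({''l''} \<union> fix_vars) s0 ?s1"
    by (simp add: same_outside_nupdate same_outside_refl)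
  let ?Q = "\<lambda>s. search_post (nmem s ''l'' []) (nmem s ''w'' [])"
  let ?rest = "Seq (NAssign ''l'' [] (V ''l0'')) (Seq fix_com
       (Cond found_exp Skip (NAssign ''w'' [] (bar_exp (V ''l'')))))"
  have "runs orac (Seq fix_com (Cond found_exp Skip ?rest)) ?s1 (4 + 2 * fix_time (rho n)) ?Q"
  proof (rule runs_Seq[OF fixr[OF so1 alive_tt]])
    show "nmem ?s1 ''l'' [] = 0" by simp
    show "fix_time (rho n) + (4 + fix_time (rho n)) \<le> 4 + 2 * fix_time (rho n)" by simp
    fix s2 assume s2: "fix_post 0 ?t s2 \<and> same_outside ({''l''} \<union> fix_vars) s0 s2 \<and> nmem s2 ''l'' [] = 0"
    then have so2: "same_outside ({''l''} \<union> fix_vars) s0 s2" by blast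
    show "runs orac (Cond found_exp Skip ?rest) s2 (4 + fix_time (rho n)) ?Q"
    proof (cases "rmem s2 ''z'' [nmem s2 ''w'' []] < - ?t")
      case True
      then have "search_post 0 (nmem s2 ''w'' [])" using ok s2 alive_tt by blast
      then show ?thesis unfolding runs_Cond found[OF so2] using True s2 by simp
    next
      case False
      then have "\<forall>A\<in>ideals imp. 0 \<in> A \<longrightarrow> f (cl 0) - N * ?t \<le> f A" using s2 by (simp add: fix_post_def)
      then have lo: "f (cl 0) - N * ?t \<le> f A" if "A \<in> ideals imp" for A
        using that unfolding ideals_def by blast
      have rt: "N * ?t < r" by (rule scale_progress[OF r p(1,2) Lam pos tau lo])
      let ?s3 = "nupdate ''l'' [] ?l0 s2"
      have so3: "same_outside ({''l''} \<union> fix_vars) s0 ?s3" using so2 by (simp add: same_outside_nupdate)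
      have l0s: "nmem s2 ''l0'' [] = ?l0" by (simp add: same_outsideD[OF so2])
      have "runs orac (Seq fix_com (Cond found_exp Skip (NAssign ''w'' [] (bar_exp (V ''l''))))) ?s3 (2 + fix_time (rho n)) ?Q"
      proof (rule runs_Seq[OF fixr[OF so3 l0(1)]])
        show "nmem ?s3 ''l'' [] = ?l0" by simp
        show "fix_time (rho n) + 2 \<le> 2 + fix_time (rho n)" by simp
        fix s4 assume s4: "fix_post ?l0 ?t s4 \<and> same_outside ({''l''} \<union> fix_vars) s0 s4 \<and> nmem s4 ''l'' [] = ?l0"
        then have so4: "same_outside ({''l''} \<union> fix_vars) s0 s4" by blast
        have lay4: "lay s4" by (rule layout_same[OF so4 _ lay]) simp
        show "runs orac (Cond found_exp Skip (NAssign ''w'' [] (bar_exp (V ''l'')))) s4 2 ?Q"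
        proof (cases "rmem s4 ''z'' [nmem s4 ''w'' []] < - ?t")
          case True
          then have "search_post ?l0 (nmem s4 ''w'' [])" using ok s4 l0(1) by blast
          then show ?thesis unfolding runs_Cond found[OF so4] using True s4 by simp
        next
          case nf: False
          then have dead: "\<forall>A\<in>ideals imp. ?l0 \<in> A \<longrightarrow> f (cl ?l0) - N * ?t \<le> f A" using s4 by (simp add: fix_post_def)
          \<comment> \<open>\<open>cl ?l0\<close> exceeds \<open>cl 0\<close> by \<open>r\<close>,
            and at most \<open>N * ?t\<close> of that can be saved by adding literals, which is less
            than \<open>r\<close>.\<close>
          have no: "?l0 \<notin> A" if "A \<in> least_sets f imp" for A
          proof
            assume "?l0 \<in> A"
            then have "f (cl ?l0) - N * ?t \<le> f A" using dead that by (auto simp: least_sets_def)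
            moreover have "f A \<le> f (cl 0)" using that cl_ideal[OF alive_tt] by (auto simp: least_sets_def)
            ultimately show False using l0(2) rt by simp
          qed
          have l0N: "?l0 < N" by (rule alive_less[OF l0(1)])
          have "lbar n (lbar n ?l0) = ?l0" using bar_bar l0N by simp
          then have "search_post ?l0 (lbar n ?l0)"
            using no l0(1) lbar_less[OF l0N] by (auto simp: search_post_def alive_def)
          then show ?thesis unfolding runs_Cond found[OF so4] using nf s4 lay_bar[OF lay4 l0N] by simp
        qed
      qed
      then have "runs orac ?rest s2 (3 + fix_time (rho n)) ?Q"
        by (intro runs_Seq[of orac _ s2 1 "\<lambda>s. s = ?s3" "2 + fix_time (rho n)"]) (simp_all add: l0s)
      then show ?thesis unfolding runs_Cond found[OF so2] using False by simp
    qed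
  qed
  then show ?thesis unfolding search_com_def
    by (intro runs_Seq[of orac _ s0 1 "\<lambda>s. s = ?s1" "4 + 2 * fix_time (rho n)"]) simp_all
qed

lemma runs_arcs:
  assumes lay: "lay s0" and l: "nmem s0 ''l'' [] = l" "l < N" and w: "nmem s0 ''w'' [] = w" "w < N"
  shows "runs orac arcs_com s0 (6 + 2 * (N * (4 + N * 4))) (layout n x ch (imp' l w))"
proof -
  let ?s1 = "nupdate ''lb'' [] (lbar n l) (nupdate ''wb'' [] (lbar n w) s0)"
  have lay1: "lay ?s1" using lay by (simp add: layout_def)
  have run: "runs orac arcs_com s0 (6 + 2 * (N * (4 + N * 4))) Q" if
    "runs orac (Seq (add_arc_com ''l'' ''w'') (add_arc_com ''wb'' ''lb'')) ?s1 (4 + 2 * (N * (4 + N * 4))) Q" for Q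
  proof -
    have "runs orac (Seq (NAssign ''lb'' [] (bar_exp (V ''l''))) (Seq (add_arc_com ''l'' ''w'') (add_arc_com ''wb'' ''lb'')))
      (nupdate ''wb'' [] (lbar n w) s0) (5 + 2 * (N * (4 + N * 4))) Q"
      by (rule runs_Seq[of orac _ _ 1 "\<lambda>s. s = ?s1" "4 + 2 * (N * (4 + N * 4))"])
        (use that l lay_bar[OF lay l(2)] in simp_all)
    then show ?thesis unfolding arcs_com_def
      by (intro runs_Seq[of orac _ s0 1 "\<lambda>s. s = nupdate ''wb'' [] (lbar n w) s0" "5 + 2 * (N * (4 + N * 4))"])
        (use w lay_bar[OF lay w(2)] in simp_all)
  qed
  show ?thesis
  proof (rule run, rule runs_Seq)
    show "runs orac (add_arc_com ''l'' ''w'') ?s1 (2 + N * (4 + N * 4)) (layout n x ch (add_arc imp l w))"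
      by (rule runs_add_arc[OF lay1]) (use l w in simp_all)
    show "2 + N * (4 + N * 4) + (2 + N * (4 + N * 4)) \<le> 4 + 2 * (N * (4 + N * 4))" by simp
    fix s assume lay2: "layout n x ch (add_arc imp l w) s" and "same_outside (writes (add_arc_com ''l'' ''w'')) ?s1 s"
    then have so: "same_outside {''i'', ''k'', ''imp'', ''skip''} ?s1 s"
      by (elim same_outside_mono) (simp add: add_arc_com_def)
    show "runs orac (add_arc_com ''wb'' ''lb'') s (2 + N * (4 + N * 4)) (layout n x ch (imp' l w))"
      unfolding imp'_def
      by (rule runs_add_arc[OF lay2]) (use lbar_less[OF l(2)] lbar_less[OF w(2)] in \<open>simp_all add: same_outsideD[OF so]\<close>)
  qed
qed

abbreviation "round_time \<equiv> round_steps n"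

text \<open>The implication relation is a locale parameter but changes during execution, so the
  postcondition supplies the locale for the new relation.\<close>

lemma runs_round:
  assumes lay: "lay s0" and P: "scale_post s0" and pos: "0 < rmem s0 ''Lam'' []"
    and gam: "rmem s0 ''gam'' [] = 1 / real (rho n)"
  shows "runs orac round_com s0 round_time (\<lambda>s. \<exists>l w. l < N \<and> w < N \<and> \<not> imp l w \<and>
    machine n (imp' l w) f orac x ch \<and> least_sets f (imp' l w) = least_sets f imp \<and>
    layout n x ch (imp' l w) s \<and> machine.scale_post n (imp' l w) f s \<and> rmem s ''gam'' [] = 1 / real (rho n))"
  unfolding round_com_def
proof (rule runs_Seq[OF runs_search[OF lay P pos gam]])
  show "5 + 2 * fix_time (rho n) + (6 + 2 * (N * (4 + N * 4)) + scale_time) \<le> round_time"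
    by (simp add: round_steps_def)
  fix s1 assume sp: "search_post (nmem s1 ''l'' []) (nmem s1 ''w'' [])" and "same_outside (writes search_com) s0 s1"
  then have so1: "same_outside ({''l''} \<union> fix_vars) s0 s1"
    by (elim same_outside_mono) (rule writes_search)
  have lay1: "lay s1" by (rule layout_same[OF so1 _ lay]) simp
  have gam1: "rmem s1 ''gam'' [] = 1 / real (rho n)" using gam by (simp add: same_outsideD[OF so1])
  define l w where "l = nmem s1 ''l'' []" and "w = nmem s1 ''w'' []"
  have lw: "l < N" "w < N" "\<not> imp l w" using sp alive_less unfolding search_post_def l_def w_def by blast+
  have snd: "A \<in> least_sets f imp \<Longrightarrow> (l \<in> A \<longrightarrow> w \<in> A) \<and> (lbar n w \<in> A \<longrightarrow> lbar n l \<in> A)" for A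
    using sp unfolding search_post_def l_def w_def by blast
  have lwL: "l \<in> {..<N}" "w \<in> {..<N}" using lw by auto
  note new = implications_imp'[OF lwL snd]
  have M: "machine n (imp' l w) f orac x ch"
    by (intro machine.intro new(1) machine_axioms.intro orac) auto
  interpret M: machine n "imp' l w" f orac x ch by (rule M)
  show "runs orac (Seq arcs_com scale_com) s1 (6 + 2 * (N * (4 + N * 4)) + scale_time) (\<lambda>s. \<exists>l w. l < N \<and> w < N \<and> \<not> imp l w \<and>
    machine n (imp' l w) f orac x ch \<and> least_sets f (imp' l w) = least_sets f imp \<and>
    layout n x ch (imp' l w) s \<and> machine.scale_post n (imp' l w) f s \<and> rmem s ''gam'' [] = 1 / real (rho n))"
  proof (rule runs_Seq[OF runs_arcs[OF lay1 l_def[symmetric] lw(1) w_def[symmetric] lw(2)]])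
    fix s2 assume lay2: "layout n x ch (imp' l w) s2" and "same_outside (writes arcs_com) s1 s2"
    then have so2: "same_outside {''wb'', ''lb'', ''i'', ''k'', ''imp'', ''skip''} s1 s2"
      by (elim same_outside_mono) (simp add: arcs_com_def add_arc_com_def)
    have gam2: "rmem s2 ''gam'' [] = 1 / real (rho n)" using gam1 by (simp add: same_outsideD[OF so2])
    show "runs orac scale_com s2 scale_time (\<lambda>s. \<exists>l w. l < N \<and> w < N \<and> \<not> imp l w \<and>
      machine n (imp' l w) f orac x ch \<and> least_sets f (imp' l w) = least_sets f imp \<and>
      layout n x ch (imp' l w) s \<and> machine.scale_post n (imp' l w) f s \<and> rmem s ''gam'' [] = 1 / real (rho n))"
    proof (rule runs_conseq[OF M.runs_scale[OF lay2]])
      fix s assume sc: "M.scale_post s" and so: "same_outside (writes scale_com) s2 s"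
      have "layout n x ch (imp' l w) s" by (rule layout_same[OF so writes_scale(1) lay2])
      moreover have "rmem s ''gam'' [] = 1 / real (rho n)"
        unfolding same_outsideD(2)[OF so writes_scale(2)] by (rule gam2)
      ultimately show "\<exists>l w. l < N \<and> w < N \<and> \<not> imp l w \<and>
        machine n (imp' l w) f orac x ch \<and> least_sets f (imp' l w) = least_sets f imp \<and>
        layout n x ch (imp' l w) s \<and> machine.scale_post n (imp' l w) f s \<and> rmem s ''gam'' [] = 1 / real (rho n)"
        using sc lw M new(2) by blast
    qed simp
  qed simp
qed

text \<open>Without a positive scale the certifying vector is zero, and the lower bound it gives
  becomes exact.\<close>

lemma scale_zero_least:
  assumes "scale_post s" "\<not> 0 < rmem s ''Lam'' []"
  shows "cl 0 \<in> least_sets f imp"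
proof -
  obtain r p I b where r: "r \<ge> 0"
    and p: "monotone_weight (cl 0) p" "chain p (cl 0) I b" "\<forall>m. \<not> candidate I m"
    and Lam: "rmem s ''Lam'' [] = r + (\<Sum>k<N. \<bar>b k\<bar>)"
    using assms(1) unfolding scale_post_def by blast
  have "(\<Sum>k<N. \<bar>b k\<bar>) \<le> 0" using r Lam assms(2) by linarith
  then have "f (cl 0) \<le> f A" if "A \<in> ideals imp" for A
    using lower_bound_from_chain[OF p that] by linarith
  then show ?thesis using cl_ideal[OF alive_tt] by (simp add: least_sets_def)
qed

abbreviation "close_time \<equiv> close_steps n"

lemma runs_close:
  assumes lay: "lay s0" and gam: "rmem s0 ''gam'' [] = 1 / real (rho n)"
  shows "runs orac close_com s0 close_time (\<lambda>s. \<exists>imp'. layout n x ch imp' s \<and>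
    {m. imp' 0 m} \<in> least_sets f imp \<and> (\<forall>A\<in>least_sets f imp. {m. imp' 0 m} \<subseteq> A))"
  unfolding close_com_def
proof (rule runs_Seq[OF runs_scale[OF lay]])
  show "scale_time + (1 + N * N * (round_time + 1)) \<le> close_time" by (simp add: close_steps_def)
  fix s1 assume P1: "scale_post s1" and so1: "same_outside (writes scale_com) s0 s1"
  have lay1: "lay s1" by (rule layout_same[OF so1 writes_scale(1) lay])
  have gam1: "rmem s1 ''gam'' [] = 1 / real (rho n)"
    unfolding same_outsideD(2)[OF so1 writes_scale(2)] by (rule gam)
  define J where "J j s \<longleftrightarrow> (\<exists>i. machine n i f orac x ch \<and> layout n x ch i s \<and> machine.scale_post n i f s \<and>
    rmem s ''gam'' [] = 1 / real (rho n) \<and> least_sets f i = least_sets f imp \<and> j \<le> card {(a, b). i a b})" for j s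
  have fin: "finite {(a, b). i a b} \<and> card {(a, b). i a b} \<le> N * N" if "machine n i f orac x ch" for i
  proof -
    interpret M: machine n i f orac x ch by fact
    have sub: "{(a, b). i a b} \<subseteq> {..<N} \<times> {..<N}" using M.imp_in by auto
    then show ?thesis using card_mono[OF _ sub] finite_subset[OF sub] by simp
  qed
  have "runs orac (While (RLess zero_r (R ''Lam'')) round_com) s1 (1 + N * N * (round_time + 1))
    (\<lambda>s. (\<exists>j. J j s) \<and> \<not> bval s (RLess zero_r (R ''Lam'')))"
  proof (rule runs_While)
    show "J 0 s1" unfolding J_def using machine_axioms lay1 P1 gam1 by blast
    show "J j s \<Longrightarrow> j \<le> N * N" for j s using fin order_trans unfolding J_def by blast
    fix j s assume "J j s" and pos: "bval s (RLess zero_r (R ''Lam''))"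
    then obtain i where i: "machine n i f orac x ch" "layout n x ch i s" "machine.scale_post n i f s"
      "rmem s ''gam'' [] = 1 / real (rho n)" "least_sets f i = least_sets f imp" "j \<le> card {(a, b). i a b}"
      unfolding J_def by blast
    interpret M: machine n i f orac x ch by (rule i(1))
    show "runs orac round_com s round_time (J (Suc j))"
    proof (rule runs_conseq[OF M.runs_round[OF i(2,3) _ i(4)]])
      show "0 < rmem s ''Lam'' []" using pos by simp
      fix s' assume "\<exists>l w. l < N \<and> w < N \<and> \<not> i l w \<and>
        machine n (M.imp' l w) f orac x ch \<and> least_sets f (M.imp' l w) = least_sets f i \<and>
        layout n x ch (M.imp' l w) s' \<and> machine.scale_post n (M.imp' l w) f s' \<and> rmem s' ''gam'' [] = 1 / real (rho n)"
      then obtain l w where lw: "l < N" "w < N" "\<not> i l w" and new: "machine n (M.imp' l w) f orac x ch"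
        "least_sets f (M.imp' l w) = least_sets f i" "layout n x ch (M.imp' l w) s'"
        "machine.scale_post n (M.imp' l w) f s'" "rmem s' ''gam'' [] = 1 / real (rho n)" by blast
      have "M.imp' l w l w" using M.imp_refl lw by (simp add: M.imp'_def add_arc_def)
      then have "{(a, b). i a b} \<subset> {(a, b). M.imp' l w a b}"
        using lw by (auto simp: M.imp'_def add_arc_def)
      then have "card {(a, b). i a b} < card {(a, b). M.imp' l w a b}"
        using fin[OF new(1)] by (intro psubset_card_mono) auto
      then have "Suc j \<le> card {(a, b). M.imp' l w a b}" using i(6) by linarith
      then show "J (Suc j) s'" unfolding J_def using new i(5) by blast
    qed simp
  qed
  then show "runs orac (While (RLess zero_r (R ''Lam'')) round_com) s1 (1 + N * N * (round_time + 1))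
    (\<lambda>s. \<exists>imp'. layout n x ch imp' s \<and>
    {m. imp' 0 m} \<in> least_sets f imp \<and> (\<forall>A\<in>least_sets f imp. {m. imp' 0 m} \<subseteq> A))"
  proof (rule runs_conseq)
    fix s assume "(\<exists>j. J j s) \<and> \<not> bval s (RLess zero_r (R ''Lam''))"
    then obtain i where i: "machine n i f orac x ch" "layout n x ch i s" "machine.scale_post n i f s"
      "least_sets f i = least_sets f imp" and z: "\<not> 0 < rmem s ''Lam'' []"
      unfolding J_def by auto
    interpret M: machine n i f orac x ch by (rule i(1))
    have "M.cl 0 \<in> least_sets f imp" using M.scale_zero_least[OF i(3) z] i(4) by simp
    \<comment> \<open>The least sets are the same for the final relation as for the initial one, so
      each of them is closed under all recorded implications.\<close>
    moreover have "M.cl 0 \<subseteq> A" if "A \<in> least_sets f imp" for A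
      using that M.cl_subset[of A 0] unfolding i(4)[symmetric] by (auto simp: least_sets_def ideals_def)
    ultimately show "\<exists>imp'. layout n x ch imp' s \<and>
      {m. imp' 0 m} \<in> least_sets f imp \<and> (\<forall>A\<in>least_sets f imp. {m. imp' 0 m} \<subseteq> A)"
      using i(2) unfolding M.cl_def by blast
  qed simp
qed

end

section \<open>One phase of the descent\<close>

text \<open>A literal whose child does not exist implies its own negation, hence is in no ideal.\<close>

definition imp0 :: "nat \<Rightarrow> (nat \<Rightarrow> bool) \<Rightarrow> nat \<Rightarrow> nat \<Rightarrow> bool" where
  "imp0 n ex a b \<longleftrightarrow> a < nlits n \<and> b < nlits n \<and>
    (a = b \<or> b = 0 \<or> a = n + 1 \<or> b = lbar n a \<and> \<not> ex a)"

locale star_instance = tree_submodular n T f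
  for n :: nat and T :: "nat \<Rightarrow> (nat, 'z) rtree_scheme" and f +
  fixes x ch :: "nat \<Rightarrow> nat" and ex :: "nat \<Rightarrow> bool"
  assumes x: "lab x" and ex0: "ex 0"
    and children: "i \<in> {1..n} \<Longrightarrow>
      {w. nonroot (T i) w \<and> parent (T i) w = x i} = {ch l | l. l \<in> {i, lbar n i} \<and> ex l}"
    and children_distinct: "i \<in> {1..n} \<Longrightarrow> ex i \<Longrightarrow> ex (lbar n i) \<Longrightarrow> ch i \<noteq> ch (lbar n i)"
begin

sublocale lit: literals "{..<nlits n}" "lbar n" 0
  by (rule literals_nat)

abbreviation "I0 \<equiv> lit.ideals (imp0 n ex)"
abbreviation "g A \<equiv> F (labels n x ch A)"

lemma lbar_i: "i \<in> {1..n} \<Longrightarrow> lbar n i = i + (n + 1) \<and> lbar n (lbar n i) = i \<and> i < nlits n \<and> lbar n i < nlits n \<and>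
    i \<noteq> 0 \<and> lbar n i \<noteq> 0 \<and> i \<noteq> n + 1 \<and> lbar n i \<noteq> n + 1"
  by (auto simp: lbar_def nlits_def)

lemma ideal_ex:
  assumes "A \<in> I0" "l \<in> A" shows "ex l" "l \<noteq> n + 1"
proof -
  have l: "l < nlits n" "lbar n l \<notin> A" "\<And>m. imp0 n ex l m \<Longrightarrow> m \<in> A"
    using assms unfolding lit.ideals_def by blast+
  have lb: "lbar n l < nlits n" by (rule lbar_less[OF l(1)])
  show "ex l" using l lb unfolding imp0_def by blast
  show "l \<noteq> n + 1" using l lb unfolding imp0_def by blast
qed

lemma idealI:
  assumes "A \<subseteq> {..<nlits n}" "0 \<in> A" "\<And>l. l \<in> A \<Longrightarrow> lbar n l \<notin> A" "\<And>l. l \<in> A \<Longrightarrow> ex l"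
  shows "A \<in> I0"
proof -
  have "n + 1 \<notin> A"
  proof
    assume "n + 1 \<in> A"
    then have "lbar n (n + 1) \<notin> A" by (rule assms(3))
    moreover have "lbar n (n + 1) = 0" by (simp add: lbar_def)
    ultimately show False using assms(2) by simp
  qed
  then show ?thesis using assms unfolding lit.ideals_def imp0_def by blast
qed

lemma child:
  assumes "i \<in> {1..n}" "l \<in> {i, lbar n i}" "ex l"
  shows "nonroot (T i) (ch l) \<and> parent (T i) (ch l) = x i"
  using children[OF assms(1)] assms(2,3) by blast

lemma labels_outward:
  assumes A: "A \<in> I0" shows "outward x (labels n x ch A)"
  unfolding outward_def
proof
  fix i assume i: "i \<in> {1..n}"
  show "labels n x ch A i = x i \<or> nonroot (T i) (labels n x ch A i) \<and> parent (T i) (labels n x ch A i) = x i"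
    using child[OF i] ideal_ex[OF A] by (auto simp: labels_def)
qed

lemma outward_lab: "outward x u \<Longrightarrow> lab u"
  using x unfolding outward_def lab_def by metis

text \<open>The last clause excludes idle literals: each literal of \<open>A\<close> names the child
  that \<open>u\<close> takes. \<open>least_step\<close> reads off a coordinate of \<open>u\<close>
  from a single literal in this way.\<close>

lemma outward_labels:
  assumes u: "outward x u"
  shows "\<exists>A\<in>I0. (\<forall>i\<in>{1..n}. labels n x ch A i = u i) \<and>
    (\<forall>i\<in>{1..n}. \<forall>l\<in>A. l \<in> {i, lbar n i} \<longrightarrow> u i = ch l)"
proof -
  define A where "A = insert 0 {l. \<exists>i\<in>{1..n}. l \<in> {i, lbar n i} \<and> ex l \<and> ch l = u i}"
  have mem: "l \<in> A \<longleftrightarrow> ex l \<and> ch l = u i" if i: "i \<in> {1..n}" "l \<in> {i, lbar n i}" for i l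
  proof -
    have shift: "lbar n k = k + (n + 1)" "1 \<le> k" "k \<le> n" if "k \<in> {1..n}" for k
      using that by (simp_all add: lbar_def)
    have l: "l = i \<or> l = i + (n + 1)" "1 \<le> i" "i \<le> n" using i(2) shift[OF i(1)] by simp_all
    have uniq: "i' = i" if "i' \<in> {1..n}" "l \<in> {i', lbar n i'}" for i'
    proof -
      have "l = i' \<or> l = i' + (n + 1)" "1 \<le> i'" "i' \<le> n" using that(2) shift[OF that(1)] by simp_all
      then show ?thesis using l by linarith
    qed
    have "l \<noteq> 0" using l by linarith
    show ?thesis
    proof
      assume "l \<in> A"
      then obtain i' where "i' \<in> {1..n}" "l \<in> {i', lbar n i'}" "ex l" "ch l = u i'"
        using \<open>l \<noteq> 0\<close> unfolding A_def by blast
      then show "ex l \<and> ch l = u i" using uniq by metis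
    next
      assume "ex l \<and> ch l = u i"
      then show "l \<in> A" using i unfolding A_def by blast
    qed
  qed
  have "A \<in> I0"
  proof (rule idealI)
    show "A \<subseteq> {..<nlits n}" using lbar_i unfolding A_def by (auto simp: nlits_def)
    show "0 \<in> A" by (simp add: A_def)
    show "ex l" if "l \<in> A" for l using that ex0 unfolding A_def by blast
    show "lbar n l \<notin> A" if l: "l \<in> A" for l
    proof (cases "l = 0")
      case True
      have "lbar n 0 = n + 1" by (simp add: lbar_def)
      moreover have "n + 1 \<notin> A" using lbar_i unfolding A_def by auto
      ultimately show ?thesis using True by simp
    next
      case False
      then obtain i where i: "i \<in> {1..n}" "l \<in> {i, lbar n i}" using l unfolding A_def by blast
      then have l': "lbar n l \<in> {i, lbar n i}" using lbar_i[OF i(1)] by auto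
      show ?thesis
      proof
        assume "lbar n l \<in> A"
        then have "ex l" "ex (lbar n l)" "ch l = ch (lbar n l)" using mem[OF i] mem[OF i(1) l'] l by auto
        then show False using children_distinct[OF i(1)] i(2) lbar_i[OF i(1)] by auto
      qed
    qed
  qed
  moreover have "labels n x ch A i = u i" if i: "i \<in> {1..n}" for i
  proof (cases "u i = x i")
    case True
    then show ?thesis
      using mem[OF i, of i] mem[OF i, of "lbar n i"] by (auto simp: labels_def)
  next
    case False
    then have "u i \<in> {w. nonroot (T i) w \<and> parent (T i) w = x i}" using u i by (auto simp: outward_def)
    then obtain l where "l \<in> {i, lbar n i}" "ex l" "u i = ch l" unfolding children[OF i] by blast
    then show ?thesis using mem[OF i, of i] mem[OF i, of "lbar n i"] by (auto simp: labels_def)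
  qed
  moreover have "u i = ch l" if "i \<in> {1..n}" "l \<in> A" "l \<in> {i, lbar n i}" for i l
    using mem[OF that(1,3)] that(2) by simp
  ultimately show ?thesis by metis
qed

text \<open>On the star of \<open>x i\<close> and its children, middle pairs are intersection and
  join of literal sets: siblings have both middle nodes at \<open>x i\<close>, just as contradictory
  literals cancel.\<close>

lemma g_bisubmodular:
  assumes A: "A \<in> I0" and B: "B \<in> I0"
  shows "g (A \<inter> B) + g (lit.join A B) \<le> g A + g B"
proof (rule F_submodular)
  show "lab (labels n x ch A)" "lab (labels n x ch B)" using labels_outward outward_lab A B by blast+
  fix i assume i: "i \<in> {1..n}"
  define p q where "p = i" and "q = lbar n i"
  note T = tree[OF i]
  have b: "lbar n p = q" "lbar n q = p" using lbar_i[OF i] by (auto simp: p_def q_def)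
  have con: "p \<in> A \<Longrightarrow> q \<notin> A" "p \<in> B \<Longrightarrow> q \<notin> B"
    using A B b unfolding lit.ideals_def by auto
  have J: "p \<in> lit.join A B \<longleftrightarrow> (p \<in> A \<or> p \<in> B) \<and> q \<notin> A \<and> q \<notin> B"
    "q \<in> lit.join A B \<longleftrightarrow> (q \<in> A \<or> q \<in> B) \<and> p \<notin> A \<and> p \<notin> B"
    using b by (auto simp: lit.join_def)
  have lb: "labels n x ch S i = (if p \<in> S then ch p else if q \<in> S then ch q else x i)" for S
    by (simp add: labels_def p_def q_def)
  have ex: "p \<in> A \<or> p \<in> B \<Longrightarrow> ex p" "q \<in> A \<or> q \<in> B \<Longrightarrow> ex q"
    using ideal_ex A B by blast+
  have c: "ex p \<Longrightarrow> nonroot (T i) (ch p)" "ex p \<Longrightarrow> parent (T i) (ch p) = x i"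
    "ex q \<Longrightarrow> nonroot (T i) (ch q)" "ex q \<Longrightarrow> parent (T i) (ch q) = x i"
    using child[OF i] by (auto simp: p_def q_def)
  have ne: "ex p \<Longrightarrow> ex q \<Longrightarrow> ch p \<noteq> ch q" using children_distinct[OF i] by (simp add: p_def q_def)
  have xi: "x i \<in> nodes (T i)" using x i by (simp add: lab_def)
  note same = meet_join_same[OF T xi] meet_join_same[OF T, of "ch p"] meet_join_same[OF T, of "ch q"]
  have par: "ex p \<Longrightarrow> tmeet (T i) (x i) (ch p) = x i \<and> tjoin (T i) (x i) (ch p) = ch p \<and>
      tmeet (T i) (ch p) (x i) = x i \<and> tjoin (T i) (ch p) (x i) = ch p"
    "ex q \<Longrightarrow> tmeet (T i) (x i) (ch q) = x i \<and> tjoin (T i) (x i) (ch q) = ch q \<and>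
      tmeet (T i) (ch q) (x i) = x i \<and> tjoin (T i) (ch q) (x i) = ch q"
    using meet_join_parent[OF T, of "ch p"] meet_join_parent[OF T, of "ch q"] c by auto
  have sib: "ex p \<Longrightarrow> ex q \<Longrightarrow> tmeet (T i) (ch p) (ch q) = x i \<and> tjoin (T i) (ch p) (ch q) = x i \<and>
     tmeet (T i) (ch q) (ch p) = x i \<and> tjoin (T i) (ch q) (ch p) = x i"
    using meet_join_siblings[OF T, of "ch p" "ch q"] meet_join_siblings[OF T, of "ch q" "ch p"] c ne by auto
  show "tmeet (T i) (labels n x ch A i) (labels n x ch B i) = labels n x ch (A \<inter> B) i \<and>
    tjoin (T i) (labels n x ch A i) (labels n x ch B i) = labels n x ch (lit.join A B) i"
    unfolding lb J Int_iff
    by (cases "p \<in> A"; cases "q \<in> A"; cases "p \<in> B"; cases "q \<in> B")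
      (use con ex c same par sib in simp_all)
qed

lemma star_machine: "machine n (imp0 n ex) g F x ch"
proof -
  have bb: "lbar n (lbar n a) = a" "lbar n a < nlits n" if "a < nlits n" for a
    using that lit.bar_bar[of a] lbar_less by auto
  have b0: "lbar n 0 = n + 1" "lbar n (n + 1) = 0" "0 < nlits n" "n + 1 < nlits n" by (auto simp: lbar_def nlits_def)
  have "implications {..<nlits n} (lbar n) 0 (imp0 n ex) g"
  proof
    show "imp0 n ex l m \<Longrightarrow> l \<in> {..<nlits n} \<and> m \<in> {..<nlits n}" for l m by (simp add: imp0_def)
    show "l \<in> {..<nlits n} \<Longrightarrow> imp0 n ex l l" for l by (simp add: imp0_def)
    show "l \<in> {..<nlits n} \<Longrightarrow> imp0 n ex l 0" for l using b0 by (simp add: imp0_def)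
    show "imp0 n ex l k" if "imp0 n ex l m" "imp0 n ex m k" for l m k
    proof (cases "l = m \<or> m = k")
      case True
      then show ?thesis using that by metis
    next
      case False
      have N: "l < nlits n" "m < nlits n" "k < nlits n" using that by (simp_all add: imp0_def)
      have lm: "m = 0 \<or> l = n + 1 \<or> m = lbar n l \<and> \<not> ex l" and mk: "k = 0 \<or> m = n + 1 \<or> k = lbar n m \<and> \<not> ex m"
        using that False by (simp_all add: imp0_def)
      \<comment> \<open>The last alternative covers a coordinate with both children missing, whose
        two literals imply each other.\<close>
      have "k = 0 \<or> l = n + 1 \<or> k = l"
      proof (cases "k = 0 \<or> l = n + 1")
        case nt: False
        then have lm': "m = 0 \<or> m = lbar n l" and mk': "m = n + 1 \<or> k = lbar n m \<and> \<not> ex m" using lm mk by auto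
        have "m \<noteq> 0"
        proof
          assume "m = 0"
          then show False using mk' ex0 by simp
        qed
        then have m: "m = lbar n l" using lm' by simp
        show ?thesis
        proof (cases "m = n + 1")
          case True
          then have "lbar n m = 0" using b0 by simp
          then have "l = 0" using m bb(1)[OF N(1)] by simp
          then show ?thesis using lm nt True ex0 by auto
        next
          case False
          then have "k = lbar n m" using mk' by simp
          then show ?thesis using m bb(1)[OF N(1)] by simp
        qed
      qed auto
      then show ?thesis using N by (auto simp: imp0_def)
    qed
    show "imp0 n ex (lbar n m) (lbar n l)" if im: "imp0 n ex l m" for l m
    proof -
      have lm: "l < nlits n" "m < nlits n" using im by (auto simp: imp0_def)
      consider "l = m" | "m = 0" | "l = n + 1" | "m = lbar n l" "\<not> ex l" using im unfolding imp0_def by blast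
      then show ?thesis
      proof cases
        case 4
        then have "lbar n m = l" using bb(1)[OF lm(1)] by simp
        then show ?thesis using im 4 by simp
      qed (use b0 bb(2)[OF lm(1)] bb(2)[OF lm(2)] in \<open>simp_all add: imp0_def\<close>)
    qed
    have "{0} \<in> I0" by (rule idealI) (use b0 ex0 in simp_all)
    then show "I0 \<noteq> {}" by blast
    show "A \<in> I0 \<Longrightarrow> B \<in> I0 \<Longrightarrow> g (A \<inter> B) + g (lit.join A B) \<le> g A + g B" for A B by (rule g_bisubmodular)
  qed
  moreover have "machine_axioms n g F x ch"
  proof (rule machine_axioms.intro)
    fix u A assume "\<And>i. i \<in> {1..n} \<Longrightarrow> u i = labels n x ch A i"
    then show "F u = g A" by (rule F_cong)
  qed
  ultimately show ?thesis by (rule machine.intro)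
qed

text \<open>Inclusion of \<open>S\<close> in every least set becomes the leastness hypothesis of
  \<open>least_outward_below_minimal\<close>: any other best \<open>u\<close> takes the same child
  wherever \<open>S\<close> moves.\<close>

lemma least_step:
  assumes S: "S \<in> lit.least_sets g (imp0 n ex)" and least: "\<And>A. A \<in> lit.least_sets g (imp0 n ex) \<Longrightarrow> S \<subseteq> A"
    and z: "minimal z" "below x z"
  shows "below (labels n x ch S) z"
    and "(\<And>i. i \<in> {1..n} \<Longrightarrow> labels n x ch S i = x i) \<Longrightarrow> minimal x"
proof -
  let ?y = "labels n x ch S"
  have SI: "S \<in> I0" "\<And>A. A \<in> I0 \<Longrightarrow> g S \<le> g A" using S unfolding lit.least_sets_def by blast+
  have y: "outward x ?y" by (rule labels_outward[OF SI(1)])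
  have ymin: "F ?y \<le> F u" if u: "outward x u" for u
  proof -
    obtain A where A: "A \<in> I0" "\<forall>i\<in>{1..n}. labels n x ch A i = u i"
      "\<forall>i\<in>{1..n}. \<forall>l\<in>A. l \<in> {i, lbar n i} \<longrightarrow> u i = ch l"
      using outward_labels[OF u] by (elim bexE conjE)
    have "g A = F u" by (rule F_cong) (rule A(2)[rule_format])
    then show ?thesis using SI(2)[OF A(1)] by simp
  qed
  show "below ?y z"
  proof (rule least_outward_below_minimal[OF x z y ymin])
    fix u i assume u: "outward x u" "F u = F ?y" and i: "i \<in> {1..n}" "?y i \<noteq> x i"
    obtain A where A: "A \<in> I0" "\<forall>i\<in>{1..n}. labels n x ch A i = u i"
      "\<forall>i\<in>{1..n}. \<forall>l\<in>A. l \<in> {i, lbar n i} \<longrightarrow> u i = ch l" using outward_labels[OF u(1)] by (elim bexE conjE)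
    have "g A = F u" by (rule F_cong) (rule A(2)[rule_format])
    then have "g A \<le> g B" if "B \<in> I0" for B using SI(2)[OF that] u(2) by linarith
    then have "A \<in> lit.least_sets g (imp0 n ex)" using A(1) unfolding lit.least_sets_def by blast
    then have "S \<subseteq> A" by (rule least)
    obtain l where l: "l \<in> S" "l \<in> {i, lbar n i}" "?y i = ch l"
    proof (cases "i \<in> S")
      case True
      then show ?thesis using that[of i] by (simp add: labels_def)
    next
      case False
      then have "lbar n i \<in> S" using i(2) by (simp add: labels_def split: if_splits)
      then show ?thesis using that[of "lbar n i"] False by (simp add: labels_def)
    qed
    have "l \<in> A" using l(1) \<open>S \<subseteq> A\<close> by blast
    from A(3)[rule_format, OF i(1) this l(2)] show "u i = ?y i" using l(3) by simp
  qed
  assume "\<And>i. i \<in> {1..n} \<Longrightarrow> ?y i = x i"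
  then have "F ?y = F x" by (rule F_cong)
  then have "F x \<le> F u" if "outward x u" for u using ymin[OF that] by simp
  then show "minimal x" by (rule outward_minimal_is_minimal[OF x _ z])
qed

end

section \<open>The whole program\<close>

abbreviation (input) "eq_exp a b \<equiv> BAnd (BNot (NLess a b)) (BNot (NLess b a))"
abbreviation (input) "or_exp a b \<equiv> BNot (BAnd (BNot a) (BNot b))"

text \<open>Natural number expressions have no product, so \<open>rho n\<close> is assembled with
  real multiplications.\<close>

definition rho_exp :: rexp where
  "rho_exp = (let e2 = RMul size_exp size_exp; e4 = RMul e2 e2; d = ROfNat (NAdd (NAdd (V ''L'') (V ''L'')) (NConst 1))
    in RMul (RMul (RMul (ROfNat (NConst 16)) (ROfNat (V ''L''))) (RMul d d)) (RMul e4 e4))"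

definition setup_com :: com where
  "setup_com = Seq (NAssign ''h'' [] (NAdd (V ''n'') (NConst 1))) (Seq (NAssign ''L'' [] (NAdd (V ''h'') (V ''h'')))
     (Seq (RAssign ''gam'' [] (RDiv (ROfNat (NConst 1)) rho_exp)) (Seq (NAssign ''moved'' [] (NConst 1))
     (For ''i'' (V ''h'') (Seq (NAssign ''bar'' [V ''i''] (NAdd (V ''i'') (V ''h'')))
       (Seq (NAssign ''bar'' [NAdd (V ''i'') (V ''h'')] (V ''i'')) (Seq (NAssign ''var'' [V ''i''] (V ''i''))
       (Seq (NAssign ''var'' [NAdd (V ''i'') (V ''h'')] (V ''i'')) (NAssign ''x'' [V ''i''] (NLoad ''root'' [V ''i'']))))))))))"

text \<open>The loop also visits the dummy index \<open>0\<close>. Its \<open>size\<close> cell is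
  zero, so only the flags of the two constant literals are cleared; \<open>phase_com\<close> then
  sets the flag of truth.\<close>

definition children_com :: com where
  "children_com = For ''i'' (V ''h'') (Seq (NAssign ''ex'' [V ''i''] (NConst 0))
     (Seq (NAssign ''ex'' [NAdd (V ''i'') (V ''h'')] (NConst 0)) (For ''j'' (NLoad ''size'' [V ''i''])
       (Cond (BAnd (BNot (eq_exp (V ''j'') (NLoad ''root'' [V ''i''])))
           (eq_exp (NLoad ''parent'' [V ''i'', V ''j'']) (NLoad ''x'' [V ''i''])))
         (Cond (NLess (NConst 0) (NLoad ''ex'' [V ''i'']))
           (Seq (NAssign ''ch'' [NAdd (V ''i'') (V ''h'')] (V ''j'')) (NAssign ''ex'' [NAdd (V ''i'') (V ''h'')] (NConst 1)))
           (Seq (NAssign ''ch'' [V ''i''] (V ''j'')) (NAssign ''ex'' [V ''i''] (NConst 1)))) Skip))))"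

text \<open>Every entry is written, zeros included, because \<open>imp\<close> still holds the
  relation of the previous phase.\<close>

definition star_imp_com :: com where
  "star_imp_com = For ''i'' (V ''L'') (For ''j'' (V ''L'')
     (Cond (or_exp (eq_exp (V ''i'') (V ''j'')) (or_exp (eq_exp (V ''j'') (NConst 0))
        (or_exp (eq_exp (V ''i'') (V ''h'')) (BAnd (eq_exp (V ''j'') (bar_exp (V ''i''))) (BNot (NLess (NConst 0) (NLoad ''ex'' [V ''i''])))))))
      (NAssign ''imp'' [V ''i'', V ''j''] (NConst 1)) (NAssign ''imp'' [V ''i'', V ''j''] (NConst 0))))"

text \<open>After \<open>close_com\<close> the row of truth is the least minimizer. The literal
  \<open>0\<close> moves nothing and must not set the flag.\<close>

definition move_com :: com where
  "move_com = Seq (NAssign ''moved'' [] (NConst 0)) (For ''k'' (V ''L'')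
     (Cond (BAnd (Imp (NConst 0) (V ''k'')) (NLess (NConst 0) (V ''k'')))
       (Seq (NAssign ''x'' [NLoad ''var'' [V ''k'']] (NLoad ''ch'' [V ''k''])) (NAssign ''moved'' [] (NConst 1))) Skip))"

definition phase_com :: com where
  "phase_com = Seq children_com (Seq (NAssign ''ex'' [NConst 0] (NConst 1)) (Seq star_imp_com (Seq close_com move_com)))"

definition main_com :: com where
  "main_com = Seq setup_com (Seq (While (NLess (NConst 0) (V ''moved'')) phase_com)
     (For ''i'' (V ''h'') (NAssign ''out'' [V ''i''] (NLoad ''x'' [V ''i'']))))"

definition phase_steps :: "nat \<Rightarrow> nat \<Rightarrow> nat" where
  "phase_steps n m = 9 + (n + 1) * (6 + m * 6) + nlits n * (9 + nlits n * 4) + close_steps n"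

text \<open>The phase beyond \<open>n * m\<close> is the last one, in which nothing moves.\<close>

definition main_steps :: "nat \<Rightarrow> nat \<Rightarrow> nat" where
  "main_steps n m = 9 + (n + 1) * 10 + (n * m + 1) * (phase_steps n m + 1)"

locale tree_instance = tree_submodular n T f
  for n :: nat and T :: "nat \<Rightarrow> nat rtree" and f +
  fixes m :: nat
  assumes binary: "i \<in> {1..n} \<Longrightarrow> binary_tree (T i)"
    and numbered: "i \<in> {1..n} \<Longrightarrow> numbered (T i)"
    and size: "i \<in> {1..n} \<Longrightarrow> card (nodes (T i)) \<le> m"
begin

abbreviation "N \<equiv> nlits n"

definition input_ok :: "store \<Rightarrow> bool" where
  "input_ok s \<longleftrightarrow> nmem s ''size'' [0] = 0 \<and> (\<forall>i\<in>{1..n}. nmem s ''size'' [i] = card (nodes (T i)) \<and>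
     nmem s ''root'' [i] = root (T i) \<and> (\<forall>v\<in>nodes (T i). nmem s ''parent'' [i, v] = parent (T i) v))"

definition tables_ok :: "store \<Rightarrow> bool" where
  "tables_ok s \<longleftrightarrow> nmem s ''h'' [] = n + 1 \<and> nmem s ''L'' [] = N \<and> rmem s ''gam'' [] = 1 / real (rho n) \<and>
     (\<forall>l<N. nmem s ''bar'' [l] = lbar n l \<and> nmem s ''var'' [l] = lvar n l)"

lemma node_iff: "i \<in> {1..n} \<Longrightarrow> w \<in> nodes (T i) \<longleftrightarrow> w < card (nodes (T i))"
  using numbered[of i] unfolding numbered_def by blast

lemma runs_setup:
  "runs orac setup_com (input_store n T) (6 + (n + 1) * 7) (\<lambda>s. input_ok s \<and> tables_ok s \<and>
     nmem s ''moved'' [] = 1 \<and> (\<forall>i\<in>{1..n}. nmem s ''x'' [i] = root (T i)))"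
proof -
  let ?s0 = "input_store n T"
  have inp: "input_ok ?s0" by (simp add: input_ok_def input_store_def input_nmem_def)
  have n0: "nmem ?s0 ''n'' [] = n" by (simp add: input_store_def input_nmem_def)
  let ?s1 = "nupdate ''moved'' [] 1 (rupdate ''gam'' [] (1 / real (rho n)) (nupdate ''L'' [] N (nupdate ''h'' [] (n + 1) ?s0)))"
  let ?c = "Seq (NAssign ''bar'' [V ''i''] (NAdd (V ''i'') (V ''h'')))
       (Seq (NAssign ''bar'' [NAdd (V ''i'') (V ''h'')] (V ''i'')) (Seq (NAssign ''var'' [V ''i''] (V ''i''))
       (Seq (NAssign ''var'' [NAdd (V ''i'') (V ''h'')] (V ''i'')) (NAssign ''x'' [V ''i''] (NLoad ''root'' [V ''i''])))))"
  define I where "I j s \<longleftrightarrow> (\<forall>l<j. nmem s ''bar'' [l] = l + (n + 1) \<and> nmem s ''bar'' [l + (n + 1)] = l \<and>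
    nmem s ''var'' [l] = l \<and> nmem s ''var'' [l + (n + 1)] = l \<and> nmem s ''x'' [l] = nmem ?s0 ''root'' [l])" for j and s :: store
  have "runs orac (For ''i'' (V ''h'') ?c) ?s1 (2 + (n + 1) * (5 + 2)) (I (n + 1))"
  proof (rule runs_For)
    fix s assume so: "same_outside (insert ''i'' (writes ?c)) ?s1 s"
    have h: "nmem s ''h'' [] = n + 1" "nmem s ''root'' = nmem ?s0 ''root''" using so by (simp_all add: same_outsideD)
    then show "nval s (V ''h'') = n + 1" by simp
    fix j assume "j < n + 1" "nmem s ''i'' [] = j" "I j s"
    then show "runs orac ?c s 5 (\<lambda>s'. I (Suc j) (nupdate ''i'' [] (Suc j) s'))"
      using h by (auto simp: I_def less_Suc_eq)
  qed (simp_all add: I_def)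
  then have loop: "runs orac (For ''i'' (V ''h'') ?c) ?s1 (2 + (n + 1) * 7) (\<lambda>s. input_ok s \<and> tables_ok s \<and>
     nmem s ''moved'' [] = 1 \<and> (\<forall>i\<in>{1..n}. nmem s ''x'' [i] = root (T i)))"
  proof (rule runs_conseq)
    fix s assume I: "I (n + 1) s" and so: "same_outside (writes (For ''i'' (V ''h'') ?c)) ?s1 s"
    have eq: "nmem s ''size'' = nmem ?s0 ''size''" "nmem s ''root'' = nmem ?s0 ''root''" "nmem s ''parent'' = nmem ?s0 ''parent''"
      "nmem s ''h'' [] = n + 1" "nmem s ''L'' [] = N" "rmem s ''gam'' [] = 1 / real (rho n)" "nmem s ''moved'' [] = 1"
      using so by (simp_all add: same_outsideD)
    have "nmem s ''bar'' [l] = lbar n l \<and> nmem s ''var'' [l] = lvar n l" if "l < N" for l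
    proof (cases "l \<le> n")
      case True
      then show ?thesis using I by (simp add: I_def lbar_def lvar_def)
    next
      case False
      then have "l = (l - (n + 1)) + (n + 1)" "l - (n + 1) < n + 1" using that by (auto simp: nlits_def)
      then have "nmem s ''bar'' [l] = l - (n + 1) \<and> nmem s ''var'' [l] = l - (n + 1)" using I unfolding I_def by metis
      then show ?thesis using False by (simp add: lbar_def lvar_def)
    qed
    then have "tables_ok s" using eq by (simp add: tables_ok_def)
    moreover have "input_ok s" using inp eq by (simp add: input_ok_def)
    moreover have "nmem s ''x'' [i] = root (T i)" if "i \<in> {1..n}" for i
      using I inp that by (auto simp: I_def input_ok_def)
    ultimately show "input_ok s \<and> tables_ok s \<and> nmem s ''moved'' [] = 1 \<and> (\<forall>i\<in>{1..n}. nmem s ''x'' [i] = root (T i))"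
      using eq by blast
  qed simp
  have r: "rval s rho_exp = real (rho n)" if "nmem s ''L'' [] = N" for s
  proof -
    have pw: "16 * c * (b * b) * ((a * a * (a * a)) * (a * a * (a * a))) = 16 * c * b\<^sup>2 * a ^ 8" for a b c :: real
      by (simp add: eval_nat_numeral mult.assoc)
    have "rval s rho_exp = 16 * real N * ((1 + 2 * real N) * (1 + 2 * real N)) *
        (((real N + 1) * (real N + 1) * ((real N + 1) * (real N + 1))) * ((real N + 1) * (real N + 1) * ((real N + 1) * (real N + 1))))"
      using that by (simp add: rho_exp_def size_exp_def Let_def)
    then show ?thesis unfolding pw by (simp add: rho_def add.commute)
  qed
  have L: "Suc (Suc (n + n)) = N" by (simp add: nlits_def)
  show ?thesis unfolding setup_com_def runs_Seq_assign
    using loop n0 r[of "nupdate ''L'' [] N (nupdate ''h'' [] (n + 1) ?s0)"] by (simp add: L)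
qed

lemma image_two: "{h l | l. l \<in> {a, b} \<and> P l} = (if P a then {h a} else {}) \<union> (if P b then {h b} else {})"
  by auto

text \<open>The last clause says that slot \<open>i\<close> is filled first; an empty slot
  \<open>i\<close> then means that no child has been found yet.\<close>

definition kid :: "(nat \<Rightarrow> nat) \<Rightarrow> nat \<Rightarrow> nat \<Rightarrow> store \<Rightarrow> bool" where
  "kid x i j s \<longleftrightarrow> (let ch = (\<lambda>l. nmem s ''ch'' [l]); ex = (\<lambda>l. 0 < nmem s ''ex'' [l]); i' = i + (n + 1) in
     {w. w < j \<and> nonroot (T i) w \<and> parent (T i) w = x i} = {ch l | l. l \<in> {i, i'} \<and> ex l} \<and>
     (ex i \<and> ex i' \<longrightarrow> ch i \<noteq> ch i') \<and> (ex i' \<longrightarrow> ex i))"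

lemma kid_cong:
  assumes "\<And>l. l \<in> {i, i + (n + 1)} \<Longrightarrow> nmem s' ''ch'' [l] = nmem s ''ch'' [l] \<and> nmem s' ''ex'' [l] = nmem s ''ex'' [l]"
  shows "kid x i j s' \<longleftrightarrow> kid x i j s"
proof -
  have "{nmem s' ''ch'' [l] | l. l \<in> {i, i + (n + 1)} \<and> 0 < nmem s' ''ex'' [l]} =
    {nmem s ''ch'' [l] | l. l \<in> {i, i + (n + 1)} \<and> 0 < nmem s ''ex'' [l]}" using assms unfolding image_two by simp
  then show ?thesis using assms unfolding kid_def Let_def by simp
qed

lemma kid_step:
  assumes i: "i \<in> {1..n}" and k: "kid x i j s" and xi: "x i \<in> nodes (T i)"
  shows "\<not> (nonroot (T i) j \<and> parent (T i) j = x i) \<Longrightarrow> kid x i (Suc j) s"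
    and "nonroot (T i) j \<and> parent (T i) j = x i \<Longrightarrow> 0 < nmem s ''ex'' [i] \<Longrightarrow>
      kid x i (Suc j) (nupdate ''ex'' [i + (n + 1)] 1 (nupdate ''ch'' [i + (n + 1)] j s))"
    and "nonroot (T i) j \<and> parent (T i) j = x i \<Longrightarrow> \<not> 0 < nmem s ''ex'' [i] \<Longrightarrow>
      kid x i (Suc j) (nupdate ''ex'' [i] 1 (nupdate ''ch'' [i] j s))"
proof -
  let ?C = "\<lambda>j. {w. w < j \<and> nonroot (T i) w \<and> parent (T i) w = x i}"
  let ?i = "i + (n + 1)"
  have C: "?C j = {nmem s ''ch'' [l] | l. l \<in> {i, ?i} \<and> 0 < nmem s ''ex'' [l]}"
    "0 < nmem s ''ex'' [i] \<and> 0 < nmem s ''ex'' [?i] \<Longrightarrow> nmem s ''ch'' [i] \<noteq> nmem s ''ch'' [?i]"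
    "0 < nmem s ''ex'' [?i] \<Longrightarrow> 0 < nmem s ''ex'' [i]"
    using k unfolding kid_def Let_def by blast+
  show "kid x i (Suc j) s" if "\<not> (nonroot (T i) j \<and> parent (T i) j = x i)"
  proof -
    have "?C (Suc j) = ?C j" using that by (auto simp: less_Suc_eq)
    then show ?thesis using C unfolding kid_def Let_def by simp
  qed
  assume new: "nonroot (T i) j \<and> parent (T i) j = x i"
  then have ins: "?C (Suc j) = insert j (?C j)" "j \<notin> ?C j" by (auto simp: less_Suc_eq)
  show "kid x i (Suc j) (nupdate ''ex'' [?i] 1 (nupdate ''ch'' [?i] j s))" if e: "0 < nmem s ''ex'' [i]"
  proof -
    \<comment> \<open>If the second slot were taken, \<open>j\<close> would be a third child of
      \<open>x i\<close>, against \<open>binary\<close>.\<close>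
    have "\<not> 0 < nmem s ''ex'' [?i]"
    proof
      assume e': "0 < nmem s ''ex'' [?i]"
      then have "?C j = {nmem s ''ch'' [i], nmem s ''ch'' [?i]}" using C(1) e by auto
      then have "card (?C j) = 2" using C(2) e e' by simp
      then have "card (?C (Suc j)) = 3" unfolding ins(1) using ins(2) by simp
      moreover have "card (?C (Suc j)) \<le> card {w. nonroot (T i) w \<and> parent (T i) w = x i}"
        using tree[OF i] by (intro card_mono) (auto simp: rooted_tree_def)
      ultimately show False using card_children_le_2[OF tree[OF i] binary[OF i] xi] by simp
    qed
    then have Cj: "?C j = {nmem s ''ch'' [i]}" unfolding C(1) image_two using e by simp
    then have "j \<noteq> nmem s ''ch'' [i]" using ins(2) by auto
    moreover have "?C (Suc j) = {nmem s ''ch'' [i], j}" unfolding ins(1) Cj by (rule insert_commute)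
    ultimately show ?thesis using e unfolding kid_def Let_def image_two by (simp add: insert_commute)
  qed
  show "kid x i (Suc j) (nupdate ''ex'' [i] 1 (nupdate ''ch'' [i] j s))" if e: "\<not> 0 < nmem s ''ex'' [i]"
  proof -
    have e': "\<not> 0 < nmem s ''ex'' [?i]" using C(3) e by blast
    then have "?C j = {}" unfolding C(1) image_two using e by simp
    then have "?C (Suc j) = {j}" unfolding ins(1) by (rule arg_cong[where f = "insert j"])
    then show ?thesis using e' unfolding kid_def Let_def image_two by simp
  qed
qed

definition kids :: "(nat \<Rightarrow> nat) \<Rightarrow> nat \<Rightarrow> store \<Rightarrow> bool" where
  "kids x k s \<longleftrightarrow> (\<forall>i\<in>{1..n}. i < k \<longrightarrow> kid x i (card (nodes (T i))) s)"

lemma runs_children: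
  assumes inp: "input_ok s0" and tab: "tables_ok s0" and x: "\<And>i. i \<in> {1..n} \<Longrightarrow> nmem s0 ''x'' [i] = x i"
    and labx: "lab x"
  shows "runs orac children_com s0 (2 + (n + 1) * ((4 + m * 6) + 2)) (kids x (n + 1))"
proof -
  let ?g = "BAnd (BNot (eq_exp (V ''j'') (NLoad ''root'' [V ''i''])))
           (eq_exp (NLoad ''parent'' [V ''i'', V ''j'']) (NLoad ''x'' [V ''i'']))"
  let ?c1 = "Seq (NAssign ''ch'' [NAdd (V ''i'') (V ''h'')] (V ''j'')) (NAssign ''ex'' [NAdd (V ''i'') (V ''h'')] (NConst 1))"
  let ?c2 = "Seq (NAssign ''ch'' [V ''i''] (V ''j'')) (NAssign ''ex'' [V ''i''] (NConst 1))"
  let ?body = "Cond ?g (Cond (NLess (NConst 0) (NLoad ''ex'' [V ''i''])) ?c1 ?c2) Skip"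
  let ?inner = "For ''j'' (NLoad ''size'' [V ''i'']) ?body"
  let ?outer = "Seq (NAssign ''ex'' [V ''i''] (NConst 0)) (Seq (NAssign ''ex'' [NAdd (V ''i'') (V ''h'')] (NConst 0)) ?inner)"
  let ?W = "{''i'', ''j'', ''ex'', ''ch'', ''skip''}"
  have W: "insert ''j'' (writes ?body) \<subseteq> ?W" "insert ''i'' (writes ?outer) \<subseteq> ?W" by simp_all
  have pres: "nmem s ''h'' [] = n + 1 \<and> nmem s ''size'' = nmem s0 ''size'' \<and> nmem s ''root'' = nmem s0 ''root'' \<and>
     nmem s ''parent'' = nmem s0 ''parent'' \<and> nmem s ''x'' = nmem s0 ''x''" if "same_outside ?W s0 s" for s
    using tab by (simp add: same_outsideD[OF that] tables_ok_def)
  have sizem: "nmem s0 ''size'' [i] \<le> m" if "i < n + 1" for i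
    using inp size[of i] that by (cases "i = 0") (auto simp: input_ok_def)
  show ?thesis unfolding children_com_def
  proof (rule runs_For[where I = "kids x"])
    show "''i'' \<notin> writes ?outer" by simp
    show "same_outside (insert ''i'' (writes ?outer)) s0 s \<Longrightarrow> nval s (V ''h'') = n + 1" for s
      using pres[OF same_outside_mono[OF _ W(2)]] by simp
    show "kids x 0 (nupdate ''i'' [] 0 s0)" by (simp add: kids_def)
    fix i s assume i: "i < n + 1" "nmem s ''i'' [] = i" and K: "kids x i s"
      and "same_outside (insert ''i'' (writes ?outer)) s0 s"
    then have so: "same_outside ?W s0 s" using same_outside_mono[OF _ W(2)] by blast
    note pr = pres[OF so]
    let ?s1 = "nupdate ''ex'' [i + (n + 1)] 0 (nupdate ''ex'' [i] 0 s)"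
    have so1: "same_outside ?W s0 ?s1" using so by (simp add: same_outside_nupdate)
    have K1: "kids x i ?s1"
      unfolding kids_def
    proof (intro ballI impI)
      fix i' assume i': "i' \<in> {1..n}" "i' < i"
      have "kid x i' (card (nodes (T i'))) ?s1 \<longleftrightarrow> kid x i' (card (nodes (T i'))) s"
        by (rule kid_cong) (use i i' in auto)
      then show "kid x i' (card (nodes (T i'))) ?s1" using K i' by (simp add: kids_def)
    qed
    define J where "J j s \<longleftrightarrow> nmem s ''i'' [] = i \<and> kids x i s \<and> (i \<in> {1..n} \<longrightarrow> kid x i j s)" for j s
    let ?m = "nmem s0 ''size'' [i]"
    have "runs orac ?inner ?s1 (2 + ?m * (4 + 2)) (J ?m)"
    proof (rule runs_For)
      show "''j'' \<notin> writes ?body" by simp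
      have pr1: "nmem s ''h'' [] = n + 1 \<and> nmem s ''size'' = nmem s0 ''size'' \<and> nmem s ''root'' = nmem s0 ''root'' \<and>
        nmem s ''parent'' = nmem s0 ''parent'' \<and> nmem s ''x'' = nmem s0 ''x'' \<and> nmem s ''i'' = nmem ?s1 ''i''"
        if "same_outside (insert ''j'' (writes ?body)) ?s1 s" for s
        using pres[OF same_outside_trans[OF so1 same_outside_mono[OF that W(1)]]] that by (simp add: same_outsideD)
      show "same_outside (insert ''j'' (writes ?body)) ?s1 s \<Longrightarrow> nval s (NLoad ''size'' [V ''i'']) = ?m" for s
        using pr1[of s] i by simp
      have "kid x i 0 ?s1" by (simp add: kid_def)
      then show "J 0 (nupdate ''j'' [] 0 ?s1)" using K1 i kid_cong[of i "nupdate ''j'' [] 0 ?s1" ?s1]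
        kid_cong[of _ "nupdate ''j'' [] 0 ?s1" ?s1] by (simp add: J_def kids_def)
      fix j s' assume j: "j < ?m" "nmem s' ''j'' [] = j" and J: "J j s'"
        and so': "same_outside (insert ''j'' (writes ?body)) ?s1 s'"
      note pr' = pr1[OF so']
      have i1: "i \<in> {1..n}" using j(1) i inp by (cases "i = 0") (auto simp: input_ok_def)
      have i': "nmem s' ''i'' [] = i" and ks: "kids x i s'" and kd: "kid x i j s'" using J i1 by (auto simp: J_def)
      have jn: "j \<in> nodes (T i)" using node_iff[OF i1] j inp i1 by (simp add: input_ok_def)
      have xi: "x i \<in> nodes (T i)" using labx i1 by (simp add: lab_def)
      have guard: "bval s' ?g \<longleftrightarrow> nonroot (T i) j \<and> parent (T i) j = x i"
        using pr' i' j jn inp i1 x[OF i1] by (auto simp: input_ok_def)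
      have other: "kids x i s''" if "\<And>l. l \<notin> {i, i + (n + 1)} \<Longrightarrow> nmem s'' ''ch'' [l] = nmem s' ''ch'' [l] \<and> nmem s'' ''ex'' [l] = nmem s' ''ex'' [l]" for s''
        unfolding kids_def
      proof (intro ballI impI)
        fix i' assume i': "i' \<in> {1..n}" "i' < i"
        have "kid x i' (card (nodes (T i'))) s'' \<longleftrightarrow> kid x i' (card (nodes (T i'))) s'"
          by (rule kid_cong, rule that) (use i i' in auto)
        then show "kid x i' (card (nodes (T i'))) s''" using ks i' by (simp add: kids_def)
      qed
      have J_j: "J k (nupdate y [] v t) = J k t" if "y \<noteq> ''i''" "y \<noteq> ''ch''" "y \<noteq> ''ex''" for k y v t
        using that kid_cong[of _ "nupdate y [] v t" t] by (simp add: J_def kids_def)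
      show "runs orac ?body s' 4 (\<lambda>s''. J (Suc j) (nupdate ''j'' [] (Suc j) s''))"
      proof (cases "nonroot (T i) j \<and> parent (T i) j = x i")
        case False
        then have "J (Suc j) s'" unfolding J_def using i' ks kid_step(1)[OF i1 kd xi] by blast
        then have "J (Suc j) (nupdate ''j'' [] (Suc j) (nupdate ''skip'' [] 0 s'))" by (simp add: J_j)
        then show ?thesis unfolding runs_Cond[of _ ?g] guard if_not_P[OF False] by simp
      next
        case True
        show ?thesis
        proof (cases "0 < nmem s' ''ex'' [i]")
          case e: True
          let ?t = "nupdate ''ex'' [i + (n + 1)] 1 (nupdate ''ch'' [i + (n + 1)] j s')"
          have "kids x i ?t" by (rule other) simp
          then have "J (Suc j) ?t" unfolding J_def using i' kid_step(2)[OF i1 kd xi True e] by simp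
          then have "J (Suc j) (nupdate ''j'' [] (Suc j) ?t)" by (subst J_j) simp_all
          then show ?thesis unfolding runs_Cond[of _ ?g] guard using True e i' pr' j by simp
        next
          case e: False
          let ?t = "nupdate ''ex'' [i] 1 (nupdate ''ch'' [i] j s')"
          have "kids x i ?t" by (rule other) simp
          then have "J (Suc j) ?t" unfolding J_def using i' kid_step(3)[OF i1 kd xi True e] by simp
          then have "J (Suc j) (nupdate ''j'' [] (Suc j) ?t)" by (subst J_j) simp_all
          then show ?thesis unfolding runs_Cond[of _ ?g] guard using True e i' pr' j by simp
        qed
      qed
    qed
    then have "runs orac ?inner ?s1 (2 + m * 6) (\<lambda>s'. kids x (Suc i) (nupdate ''i'' [] (Suc i) s'))"
    proof (rule runs_conseq)
      show "2 + ?m * (4 + 2) \<le> 2 + m * 6" using sizem[OF i(1)] by simp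
      fix s' assume J: "J ?m s'"
      have "kids x (Suc i) s'" using J inp by (auto simp: J_def kids_def less_Suc_eq input_ok_def)
      then show "kids x (Suc i) (nupdate ''i'' [] (Suc i) s')"
        using kid_cong[of _ "nupdate ''i'' [] (Suc i) s'" s'] by (simp add: kids_def)
    qed
    then show "runs orac ?outer s (4 + m * 6) (\<lambda>s'. kids x (Suc i) (nupdate ''i'' [] (Suc i) s'))"
      using i pr by simp
  qed
qed

lemma runs_star_imp:
  assumes tab: "tables_ok s0"
  shows "runs orac star_imp_com s0 (2 + N * (4 + N * 4))
    (\<lambda>s. \<forall>a<N. \<forall>b<N. 0 < nmem s ''imp'' [a, b] \<longleftrightarrow> imp0 n (\<lambda>l. 0 < nmem s0 ''ex'' [l]) a b)"
proof -
  let ?g = "or_exp (eq_exp (V ''i'') (V ''j'')) (or_exp (eq_exp (V ''j'') (NConst 0))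
        (or_exp (eq_exp (V ''i'') (V ''h'')) (BAnd (eq_exp (V ''j'') (bar_exp (V ''i''))) (BNot (NLess (NConst 0) (NLoad ''ex'' [V ''i'']))))))"
  let ?body = "Cond ?g (NAssign ''imp'' [V ''i'', V ''j''] (NConst 1)) (NAssign ''imp'' [V ''i'', V ''j''] (NConst 0))"
  let ?inner = "For ''j'' (V ''L'') ?body"
  let ?W = "{''i'', ''j'', ''imp''}"
  let ?imp = "imp0 n (\<lambda>l. 0 < nmem s0 ''ex'' [l])"
  have W: "insert ''j'' (writes ?body) \<subseteq> ?W" "insert ''i'' (writes ?inner) \<subseteq> ?W" by simp_all
  have pres: "tables_ok s \<and> nmem s ''ex'' = nmem s0 ''ex''" if "same_outside ?W s0 s" for s
    using tab by (simp add: same_outsideD[OF that] tables_ok_def)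
  define ok where "ok i j s \<longleftrightarrow> (\<forall>a<N. \<forall>b<N. a < i \<or> a = i \<and> b < j \<longrightarrow> (0 < nmem s ''imp'' [a, b] \<longleftrightarrow> ?imp a b))"
    for i j and s :: store
  have "runs orac star_imp_com s0 (2 + N * ((2 + N * (2 + 2)) + 2)) (ok N 0)"
    unfolding star_imp_com_def
  proof (rule runs_For[where I = "\<lambda>i. ok i 0"])
    show "same_outside (insert ''i'' (writes ?inner)) s0 s \<Longrightarrow> nval s (V ''L'') = N" for s
      using pres[OF same_outside_mono[OF _ W(2)]] by (simp add: tables_ok_def)
    show "ok 0 0 (nupdate ''i'' [] 0 s0)" by (simp add: ok_def)
    fix i s assume i: "i < N" "nmem s ''i'' [] = i" and ok: "ok i 0 s" and "same_outside (insert ''i'' (writes ?inner)) s0 s"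
    then have so: "same_outside ?W s0 s" using same_outside_mono[OF _ W(2)] by blast
    have "runs orac ?inner s (2 + N * (2 + 2)) (\<lambda>s'. nmem s' ''i'' [] = i \<and> ok i N s')"
    proof (rule runs_For[where I = "\<lambda>j s'. nmem s' ''i'' [] = i \<and> ok i j s'"])
      have pr: "tables_ok s' \<and> nmem s' ''ex'' = nmem s0 ''ex''" if "same_outside (insert ''j'' (writes ?body)) s s'" for s'
        by (rule pres[OF same_outside_trans[OF so same_outside_mono[OF that W(1)]]])
      show "same_outside (insert ''j'' (writes ?body)) s s' \<Longrightarrow> nval s' (V ''L'') = N" for s'
        using pr[of s'] by (simp add: tables_ok_def)
      show "nmem (nupdate ''j'' [] 0 s) ''i'' [] = i \<and> ok i 0 (nupdate ''j'' [] 0 s)" using i ok by (simp add: ok_def)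
      fix j s' assume j: "j < N" "nmem s' ''j'' [] = j" and I: "nmem s' ''i'' [] = i \<and> ok i j s'"
        and so': "same_outside (insert ''j'' (writes ?body)) s s'"
      have g: "bval s' ?g \<longleftrightarrow> ?imp i j"
        using pr[OF so'] i(1) j I by (auto simp: tables_ok_def imp0_def)
      have ok': "ok i (Suc j) (nupdate ''j'' [] (Suc j) (nupdate ''imp'' [i, j] v s'))" if "0 < v \<longleftrightarrow> ?imp i j" for v
        using that I unfolding ok_def by (auto simp: less_Suc_eq)
      show "runs orac ?body s' 2 (\<lambda>s''. nmem (nupdate ''j'' [] (Suc j) s'') ''i'' [] = i \<and> ok i (Suc j) (nupdate ''j'' [] (Suc j) s''))"
        unfolding runs_Cond g using ok'[of 0] ok'[of 1] I j by auto
    qed simp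
    then show "runs orac ?inner s (2 + N * (2 + 2)) (\<lambda>s'. ok (Suc i) 0 (nupdate ''i'' [] (Suc i) s'))"
      by (rule runs_conseq) (auto simp: ok_def less_Suc_eq)
  qed simp
  then show ?thesis by (rule runs_conseq) (auto simp: ok_def algebra_simps)
qed

lemma runs_move:
  assumes lay: "layout n x ch i s0" and S: "{l. i 0 l} \<subseteq> {..<N}" "\<forall>l\<in>{l. i 0 l}. lbar n l \<notin> {l. i 0 l}" "i 0 0"
  shows "runs orac move_com s0 (3 + N * 5) (\<lambda>s. (\<forall>k\<in>{1..n}. nmem s ''x'' [k] = labels n x ch {l. i 0 l} k) \<and>
    (0 < nmem s ''moved'' [] \<longleftrightarrow> (\<exists>l>0. i 0 l)))"
proof -
  let ?c = "Cond (BAnd (Imp (NConst 0) (V ''k'')) (NLess (NConst 0) (V ''k'')))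
       (Seq (NAssign ''x'' [NLoad ''var'' [V ''k'']] (NLoad ''ch'' [V ''k''])) (NAssign ''moved'' [] (NConst 1))) Skip"
  let ?s1 = "nupdate ''moved'' [] 0 s0"
  define I where "I j s \<longleftrightarrow> (\<forall>k\<in>{1..n}. nmem s ''x'' [k] = labels n x ch {l. i 0 l \<and> l < j} k) \<and>
    (0 < nmem s ''moved'' [] \<longleftrightarrow> (\<exists>l>0. l < j \<and> i 0 l))" for j and s :: store
  have N0: "0 < N" by (simp add: nlits_def)
  have "runs orac (For ''k'' (V ''L'') ?c) ?s1 (2 + N * (3 + 2)) (I N)"
  proof (rule runs_For)
    show "I 0 (nupdate ''k'' [] 0 ?s1)" using lay by (simp add: I_def layout_def labels_def)
    fix s assume so: "same_outside (insert ''k'' (writes ?c)) ?s1 s"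
    have eq: "nmem s ''L'' [] = N" "nmem s ''var'' = nmem s0 ''var''" "nmem s ''ch'' = nmem s0 ''ch''" "nmem s ''imp'' = nmem s0 ''imp''"
      using so lay by (simp_all add: same_outsideD layout_def)
    then show "nval s (V ''L'') = N" by simp
    fix j assume j: "j < N" "nmem s ''k'' [] = j" and IJ: "I j s"
    have lj: "nmem s ''var'' [j] = lvar n j" "nmem s ''ch'' [j] = ch j" "0 < nmem s ''imp'' [0, j] \<longleftrightarrow> i 0 j"
      unfolding eq using lay j N0 by (simp_all add: layout_def)
    show "runs orac ?c s 3 (\<lambda>s'. I (Suc j) (nupdate ''k'' [] (Suc j) s'))"
    proof (cases "i 0 j \<and> 0 < j")
      case True
      have ex: "\<exists>l>0. l < Suc j \<and> i 0 l" using True by blast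
      have eqI: "{l. i 0 l \<and> l < Suc j} = insert j {l. i 0 l \<and> l < j}" using True by (auto simp: less_Suc_eq)
      \<comment> \<open>Consistency keeps the write for \<open>j\<close> from overriding an earlier
        one for the same coordinate.\<close>
      have "lbar n j \<notin> {l. i 0 l \<and> l < j}" using S(2) True by auto
      then have ins: "labels n x ch {l. i 0 l \<and> l < Suc j} k = (if k = lvar n j then ch j else labels n x ch {l. i 0 l \<and> l < j} k)" if "k \<le> n" for k
        unfolding eqI by (intro labels_insert j(1) that)
      have "I (Suc j) (nupdate ''moved'' [] 1 (nupdate ''x'' [lvar n j] (ch j) s))"
        using IJ ex unfolding I_def by (simp add: ins)
      then have "I (Suc j) (nupdate ''k'' [] (Suc j) (nupdate ''moved'' [] 1 (nupdate ''x'' [lvar n j] (ch j) s)))"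
        by (simp add: I_def)
      then show ?thesis using True lj j by simp
    next
      case False
      \<comment> \<open>Either truth does not imply \<open>j\<close>, or \<open>j = 0\<close>, which
        names no coordinate in \<open>{1..n}\<close>.\<close>
      have "labels n x ch {l. i 0 l \<and> l < Suc j} k = labels n x ch {l. i 0 l \<and> l < j} k" if "k \<in> {1..n}" for k
        using False that by (auto simp: labels_def less_Suc_eq lbar_def)
      then have "I (Suc j) s" using IJ False unfolding I_def by (auto simp: less_Suc_eq)
      then have "I (Suc j) (nupdate ''k'' [] (Suc j) (nupdate ''skip'' [] 0 s))" by (simp add: I_def)
      then show ?thesis using False lj j by auto
    qed
  qed simp
  then have "runs orac (For ''k'' (V ''L'') ?c) ?s1 (2 + N * (3 + 2)) (\<lambda>s. (\<forall>k\<in>{1..n}. nmem s ''x'' [k] = labels n x ch {l. i 0 l} k) \<and>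
    (0 < nmem s ''moved'' [] \<longleftrightarrow> (\<exists>l>0. i 0 l)))"
  proof (rule runs_conseq)
    fix s assume "I N s"
    moreover have "{l. i 0 l \<and> l < N} = {l. i 0 l}" using S(1) by auto
    moreover have "(\<exists>l>0. l < N \<and> i 0 l) \<longleftrightarrow> (\<exists>l>0. i 0 l)" using S(1) by auto
    ultimately show "(\<forall>k\<in>{1..n}. nmem s ''x'' [k] = labels n x ch {l. i 0 l} k) \<and>
      (0 < nmem s ''moved'' [] \<longleftrightarrow> (\<exists>l>0. i 0 l))" by (simp add: I_def)
  qed simp
  then show ?thesis unfolding move_com_def
    by (intro runs_Seq[of orac _ s0 1 "\<lambda>s. s = ?s1" "2 + N * (3 + 2)"]) simp_all
qed

end

abbreviation "close_vars \<equiv> {''l'', ''l0'', ''R'', ''f0'', ''Lam'', ''K'', ''tau'', ''t2'', ''wb'', ''lb'', ''imp''} \<union> fix_vars"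

lemma writes_close_vars: "writes close_com \<subseteq> close_vars"
proof -
  have a: "writes scale_com \<subseteq> close_vars"
    by (simp add: scale_com_def scan_com_def total_com_def const_com_def clear_com_def oracle_com_def chain_com_def
      set_base_def add_cl_def select_com_def grow_com_def blocking_com_def weight_com_def flow_com_def gap_com_def)
  have b: "writes search_com \<subseteq> close_vars" by (rule subset_trans[OF writes_search]) simp
  have c: "writes arcs_com \<subseteq> close_vars" by (simp add: arcs_com_def add_arc_com_def)
  show ?thesis unfolding close_com_def round_com_def writes.simps Un_subset_iff
    by (intro conjI a b c)
qed

lemma writes_close: "writes close_com \<inter> {''h'', ''L'', ''bar'', ''var'', ''ch'', ''x'', ''gam'', ''size'', ''root'', ''parent''} = {}"
proof -
  have d: "A \<subseteq> B \<Longrightarrow> B \<inter> C = {} \<Longrightarrow> A \<inter> C = {}" for A B C :: "string set" by blast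
  show ?thesis by (rule d[OF writes_close_vars]) simp
qed

lemma writes_phase: "writes phase_com \<inter> {''h'', ''L'', ''bar'', ''var'', ''gam'', ''size'', ''root'', ''parent''} = {}"
  using writes_close by (simp add: phase_com_def children_com_def star_imp_com_def move_com_def Int_Un_distrib2 insert_disjoint)

context tree_instance
begin

lemma tables_ok_same:
  assumes s: "same_outside W s s'" and W: "W \<inter> {''h'', ''L'', ''bar'', ''var'', ''gam'', ''size'', ''root'', ''parent''} = {}"
  shows "tables_ok s \<Longrightarrow> tables_ok s'" and "input_ok s \<Longrightarrow> input_ok s'"
proof -
  have "nmem s' y = nmem s y \<and> rmem s' y = rmem s y"
    if "y \<in> {''h'', ''L'', ''bar'', ''var'', ''gam'', ''size'', ''root'', ''parent''}" for y
  proof -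
    have "y \<notin> W"
    proof
      assume "y \<in> W"
      from IntI[OF this that] show False unfolding W by (rule emptyE)
    qed
    then show ?thesis using same_outsideD[OF s] by simp
  qed
  then show "tables_ok s \<Longrightarrow> tables_ok s'" "input_ok s \<Longrightarrow> input_ok s'"
    unfolding tables_ok_def input_ok_def by simp_all
qed

lemma on_variables:
  assumes "\<forall>i\<in>{1..n}. u i = v i"
  shows "lab u \<longleftrightarrow> lab v" "below u z \<longleftrightarrow> below v z" "outward x u \<longleftrightarrow> outward x v" "minimal u \<longleftrightarrow> minimal v"
proof -
  show l: "lab u \<longleftrightarrow> lab v" using assms by (simp add: lab_def)
  show "below u z \<longleftrightarrow> below v z" using assms by (simp add: below_def)
  show "outward x u \<longleftrightarrow> outward x v" using assms by (simp add: outward_def)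
  have "F u = F v" by (rule F_cong) (use assms in blast)
  then show "minimal u \<longleftrightarrow> minimal v" using l by (simp add: minimal_def)
qed

definition descended :: "(nat \<Rightarrow> nat) \<Rightarrow> (nat \<Rightarrow> nat) \<Rightarrow> bool \<Rightarrow> bool" where
  "descended x y b \<longleftrightarrow> outward x y \<and> (\<forall>z. minimal z \<longrightarrow> below y z) \<and>
     (if b then \<exists>i\<in>{1..n}. y i \<noteq> x i else minimal y)"

lemma star_instance_kids:
  assumes lab: "lab x" and k: "kids x (n + 1) s" and ex: "nmem s' ''ex'' = (nmem s ''ex'')([0] := 1)"
  shows "star_instance n T f x (\<lambda>l. nmem s ''ch'' [l]) (\<lambda>l. 0 < nmem s' ''ex'' [l])"
proof (rule star_instance.intro[OF tree_submodular_axioms star_instance_axioms.intro])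
  show "lab x" by (rule lab)
  show "0 < nmem s' ''ex'' [0]" by (simp add: ex)
  fix i assume i: "i \<in> {1..n}"
  have b: "lbar n i = i + (n + 1)" using i by (simp add: lbar_def)
  have e: "nmem s' ''ex'' [l] = nmem s ''ex'' [l]" if "l \<noteq> 0" for l using that ex by simp
  have i0: "i \<noteq> 0" using i by simp
  have "kid x i (card (nodes (T i))) s" using k i by (simp add: kids_def)
  then have K: "{w. w < card (nodes (T i)) \<and> nonroot (T i) w \<and> parent (T i) w = x i} =
      {nmem s ''ch'' [l] | l. l \<in> {i, i + (n + 1)} \<and> 0 < nmem s ''ex'' [l]}"
    "0 < nmem s ''ex'' [i] \<Longrightarrow> 0 < nmem s ''ex'' [i + (n + 1)] \<Longrightarrow> nmem s ''ch'' [i] \<noteq> nmem s ''ch'' [i + (n + 1)]"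
    unfolding kid_def Let_def by blast+
  have "{w. nonroot (T i) w \<and> parent (T i) w = x i} = {w. w < card (nodes (T i)) \<and> nonroot (T i) w \<and> parent (T i) w = x i}"
    by (rule Collect_cong) (use node_iff[OF i] in blast)
  also have "\<dots> = {nmem s ''ch'' [l] | l. l \<in> {i, lbar n i} \<and> 0 < nmem s' ''ex'' [l]}"
    unfolding K(1) b image_two using e[OF i0] e[of "i + (n + 1)"] by simp
  finally show "{w. nonroot (T i) w \<and> parent (T i) w = x i} =
    {nmem s ''ch'' [l] | l. l \<in> {i, lbar n i} \<and> 0 < nmem s' ''ex'' [l]}" .
  show "0 < nmem s' ''ex'' [i] \<Longrightarrow> 0 < nmem s' ''ex'' [lbar n i] \<Longrightarrow> nmem s ''ch'' [i] \<noteq> nmem s ''ch'' [lbar n i]"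
    unfolding b using K(2) e[OF i0] e[of "i + (n + 1)"] by simp
qed

text \<open>Any literal of \<open>S\<close> besides truth is a real move, since a child differs from
  its parent. If there is none, then \<open>x\<close> is optimal among its outward neighbours and
  hence minimal.\<close>

lemma descendedI:
  assumes st: "star_instance n T f x ch ex"
    and S: "S \<in> literals.least_sets {..<N} (lbar n) 0 (\<lambda>A. F (labels n x ch A)) (imp0 n ex)"
    and least: "\<And>A. A \<in> literals.least_sets {..<N} (lbar n) 0 (\<lambda>A. F (labels n x ch A)) (imp0 n ex) \<Longrightarrow> S \<subseteq> A"
    and inv: "\<And>z. minimal z \<Longrightarrow> below x z" and z: "minimal z"
    and y: "\<And>i. i \<in> {1..n} \<Longrightarrow> y i = labels n x ch S i"
  shows "descended x y (\<exists>l>0. l \<in> S)"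
proof -
  note lits = literals_nat[of n]
  have SI: "S \<in> literals.ideals {..<N} (lbar n) 0 (imp0 n ex)"
    using S unfolding literals.least_sets_def[OF lits] by blast
  then have S': "S \<subseteq> {..<N}" "\<forall>l\<in>S. lbar n l \<notin> S" unfolding literals.ideals_def[OF lits] by blast+
  have y': "\<forall>i\<in>{1..n}. y i = labels n x ch S i" using y by blast
  have "outward x y" using star_instance.labels_outward[OF st SI] on_variables(3)[OF y'] by blast
  moreover have "below y z'" if "minimal z'" for z'
    using star_instance.least_step(1)[OF st S least that inv[OF that]] on_variables(2)[OF y'] by blast
  moreover have "if \<exists>l>0. l \<in> S then \<exists>i\<in>{1..n}. y i \<noteq> x i else minimal y"
  proof (cases "\<exists>l>0. l \<in> S")
    case True
    then obtain l where l: "l > 0" "l \<in> S" by blast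
    note e = star_instance.ideal_ex[OF st SI l(2)]
    have lN: "l < N" using S'(1) l(2) by blast
    define i where "i = lvar n l"
    have i: "i \<in> {1..n}" and li: "l = i \<or> l = lbar n i"
      using l(1) lN e(2) by (auto simp: i_def lvar_def lbar_def nlits_def)
    have c: "nonroot (T i) (ch l) \<and> parent (T i) (ch l) = x i"
      by (rule star_instance.child[OF st i _ e(1)]) (use li in simp)
    have "lbar n (lbar n i) = i" using i by (simp add: lbar_def)
    then have "i \<notin> S" if "l = lbar n i" using S'(2) l(2) that by metis
    then have "labels n x ch S i = ch l" using li l(2) by (auto simp: labels_def)
    moreover have "ch l \<noteq> x i" using parent_neq[OF tree[OF i], of "ch l"] c by metis
    ultimately have "y i \<noteq> x i" using y[OF i] by simp
    then show ?thesis using True i by auto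
  next
    case False
    have nS: "l \<notin> S" if "l \<noteq> 0" for l using False that by blast
    have eq: "labels n x ch S i = x i" if "i \<in> {1..n}" for i
    proof -
      have "i \<notin> S" by (rule nS) (use that in simp)
      moreover have "lbar n i \<notin> S" by (rule nS) (use that in \<open>simp add: lbar_def\<close>)
      ultimately show ?thesis by (simp add: labels_def)
    qed
    have "minimal x" by (rule star_instance.least_step(2)[OF st S least z inv[OF z] eq])
    moreover have yx: "\<forall>i\<in>{1..n}. y i = x i" using y eq by simp
    ultimately have "minimal y" using on_variables(4)[OF yx] by blast
    then show ?thesis unfolding if_not_P[OF False] .
  qed
  ultimately show ?thesis unfolding descended_def by blast
qed

lemma F_value_oracle: "F = value_oracle n f"
  by (simp add: fun_eq_iff F_def value_oracle_def)

lemma runs_phase: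
  assumes inp: "input_ok s0" and tab: "tables_ok s0" and x: "x = (\<lambda>i. nmem s0 ''x'' [i])" and lab: "lab x"
    and inv: "\<And>z. minimal z \<Longrightarrow> below x z" and z: "minimal z"
  shows "runs F phase_com s0 (phase_steps n m) (\<lambda>s. input_ok s \<and> tables_ok s \<and>
    descended x (\<lambda>i. nmem s ''x'' [i]) (0 < nmem s ''moved'' []))"
proof -
  let ?T1 = "2 + (n + 1) * ((4 + m * 6) + 2)" and ?T2 = "2 + N * (4 + N * 4)" and ?T3 = "3 + N * 5"
  let ?Q = "\<lambda>s. descended x (\<lambda>i. nmem s ''x'' [i]) (0 < nmem s ''moved'' [])"
  have "runs F phase_com s0 (?T1 + (1 + (?T2 + (close_steps n + ?T3)))) ?Q"
    unfolding phase_com_def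
  proof (rule runs_Seq[OF runs_children[OF inp tab _ lab] order_refl])
    show "nmem s0 ''x'' [i] = x i" for i by (simp add: x)
    fix s1 assume k: "kids x (n + 1) s1" and so1: "same_outside (writes children_com) s0 s1"
    define s2 where "s2 = nupdate ''ex'' [0] 1 s1"
    define ch where "ch l = nmem s1 ''ch'' [l]" for l
    define ex where "ex l \<longleftrightarrow> 0 < nmem s2 ''ex'' [l]" for l
    have st: "star_instance n T f x ch ex"
      using star_instance_kids[OF lab k, of s2] unfolding ch_def ex_def s2_def by simp
    have x1: "nmem s1 ''x'' = nmem s0 ''x''" by (rule same_outsideD[OF so1]) (simp add: children_com_def)
    have "tables_ok s1" by (rule tables_ok_same(1)[OF so1 _ tab]) (simp add: children_com_def)
    then have tab2: "tables_ok s2" by (simp add: s2_def tables_ok_def)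
    have star: "runs F star_imp_com s2 ?T2 (\<lambda>s. \<forall>a<N. \<forall>b<N. 0 < nmem s ''imp'' [a, b] \<longleftrightarrow> imp0 n ex a b)"
      using runs_star_imp[OF tab2] unfolding ex_def .
    have "runs F (Seq star_imp_com (Seq close_com move_com)) s2 (?T2 + (close_steps n + ?T3)) ?Q"
    proof (rule runs_Seq[OF star order_refl])
      fix s3 assume imp: "\<forall>a<N. \<forall>b<N. 0 < nmem s3 ''imp'' [a, b] \<longleftrightarrow> imp0 n ex a b"
        and so3: "same_outside (writes star_imp_com) s2 s3"
      have tab3: "tables_ok s3" by (rule tables_ok_same(1)[OF so3 _ tab2]) (simp add: star_imp_com_def)
      have "nmem s3 ''x'' = nmem s2 ''x''" "nmem s3 ''ch'' = nmem s2 ''ch''"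
        by (rule same_outsideD[OF so3], simp add: star_imp_com_def)+
      then have "nmem s3 ''x'' [i] = x i" "nmem s3 ''ch'' [i] = ch i" for i
        using x1 by (simp_all add: s2_def ch_def x)
      then have lay: "layout n x ch (imp0 n ex) s3" using tab3 imp unfolding layout_def tables_ok_def by blast
      have gam: "rmem s3 ''gam'' [] = 1 / real (rho n)" using tab3 by (simp add: tables_ok_def)
      show "runs F (Seq close_com move_com) s3 (close_steps n + ?T3) ?Q"
      proof (rule runs_Seq[OF machine.runs_close[OF star_instance.star_machine[OF st] lay gam] order_refl])
        fix s4 assume "\<exists>imp'. layout n x ch imp' s4 \<and>
          {m. imp' 0 m} \<in> literals.least_sets {..<N} (lbar n) 0 (\<lambda>A. F (labels n x ch A)) (imp0 n ex) \<and>
          (\<forall>A\<in>literals.least_sets {..<N} (lbar n) 0 (\<lambda>A. F (labels n x ch A)) (imp0 n ex). {m. imp' 0 m} \<subseteq> A)"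
        then obtain imp' where lay4: "layout n x ch imp' s4"
          and S: "{m. imp' 0 m} \<in> literals.least_sets {..<N} (lbar n) 0 (\<lambda>A. F (labels n x ch A)) (imp0 n ex)"
          and least: "\<forall>A\<in>literals.least_sets {..<N} (lbar n) 0 (\<lambda>A. F (labels n x ch A)) (imp0 n ex). {m. imp' 0 m} \<subseteq> A"
          by blast
        have SI: "{m. imp' 0 m} \<subseteq> {..<N}" "\<forall>l\<in>{m. imp' 0 m}. lbar n l \<notin> {m. imp' 0 m}" "0 \<in> {m. imp' 0 m}"
          using S unfolding literals.least_sets_def[OF literals_nat] literals.ideals_def[OF literals_nat] by blast+
        have i0: "imp' 0 0" using SI(3) by simp
        show "runs F move_com s4 ?T3 ?Q"
        proof (rule runs_conseq[OF runs_move[OF lay4 SI(1,2) i0] order_refl])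
          fix s5 assume s5: "(\<forall>k\<in>{1..n}. nmem s5 ''x'' [k] = labels n x ch {l. imp' 0 l} k) \<and>
            (0 < nmem s5 ''moved'' [] \<longleftrightarrow> (\<exists>l>0. imp' 0 l))"
          have "descended x (\<lambda>i. nmem s5 ''x'' [i]) (\<exists>l>0. l \<in> {m. imp' 0 m})"
          proof (rule descendedI[OF st S _ inv z])
            show "{m. imp' 0 m} \<subseteq> A" if "A \<in> literals.least_sets {..<N} (lbar n) 0 (\<lambda>A. F (labels n x ch A)) (imp0 n ex)" for A
              using least that by blast
            show "nmem s5 ''x'' [i] = labels n x ch {m. imp' 0 m} i" if "i \<in> {1..n}" for i using s5 that by blast
          qed
          then show "?Q s5" using s5 by simp
        qed
      qed
    qed
    then show "runs F (Seq (NAssign ''ex'' [NConst 0] (NConst 1)) (Seq star_imp_com (Seq close_com move_com))) s1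
        (1 + (?T2 + (close_steps n + ?T3))) ?Q" by (simp add: s2_def)
  qed
  then show ?thesis
  proof (rule runs_conseq)
    show "?T1 + (1 + (?T2 + (close_steps n + ?T3))) \<le> phase_steps n m" by (simp add: phase_steps_def algebra_simps)
    show "input_ok s \<and> tables_ok s \<and> ?Q s" if "?Q s" "same_outside (writes phase_com) s0 s" for s
      using tables_ok_same[OF that(2) writes_phase] inp tab that(1) by blast
  qed
qed

section \<open>Counting phases, and from minimal arrays to minimizing labelings\<close>

definition potential :: "(nat \<Rightarrow> nat) \<Rightarrow> nat" where
  "potential u = (\<Sum>i\<in>{1..n}. card {w \<in> nodes (T i). ancestor (T i) (u i) w})"

lemma finite_nodes: "i \<in> {1..n} \<Longrightarrow> finite (nodes (T i))"
  using tree[of i] by (simp add: rooted_tree_def)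

lemma potential_le: "potential u \<le> n * m"
proof -
  have "card {w \<in> nodes (T i). ancestor (T i) (u i) w} \<le> m" if i: "i \<in> {1..n}" for i
    by (rule order_trans[OF card_mono size[OF i]]) (use finite_nodes[OF i] in auto)
  from sum_bounded_above[of "{1..n}", OF this] show ?thesis by (simp add: potential_def)
qed

text \<open>A move to a child drops at least the old label from the set of descendants and adds
  nothing to it.\<close>

lemma potential_less:
  assumes lab: "lab x" and out: "outward x y" and moved: "\<exists>i\<in>{1..n}. y i \<noteq> x i"
  shows "potential y < potential x"
proof -
  let ?A = "\<lambda>u i. {w \<in> nodes (T i). ancestor (T i) (u i) w}"
  have less: "card (?A y i) < card (?A x i)" if i: "i \<in> {1..n}" and ne: "y i \<noteq> x i" for i
  proof (rule psubset_card_mono)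
    note T = tree[OF i]
    have c: "nonroot (T i) (y i)" "parent (T i) (y i) = x i" using out i ne unfolding outward_def by blast+
    have p: "ancestor (T i) (x i) (y i)" using ancestor_parent[OF T c(1)] c(2) by simp
    have xi: "x i \<in> nodes (T i)" using lab i by (simp add: lab_def)
    have "\<not> ancestor (T i) (y i) (x i)" using ancestor_antisym_parent[OF T c(1)] c(2) by simp
    moreover have "ancestor (T i) (x i) (x i)" by (rule ancestor_refl[OF T xi])
    moreover have "ancestor (T i) (x i) w" if "w \<in> nodes (T i)" "ancestor (T i) (y i) w" for w
      by (rule ancestor_trans[OF T that(1) p that(2)])
    ultimately show "?A y i \<subset> ?A x i" using xi by blast
    show "finite (?A x i)" using finite_nodes[OF i] by simp
  qed
  show ?thesis unfolding potential_def
  proof (rule sum_strict_mono_ex1)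
    show "\<forall>i\<in>{1..n}. card (?A y i) \<le> card (?A x i)"
    proof
      fix i assume i: "i \<in> {1..n}"
      show "card (?A y i) \<le> card (?A x i)" using less[OF i] by (cases "y i = x i") simp_all
    qed
    show "\<exists>i\<in>{1..n}. card (?A y i) < card (?A x i)" using moved less by blast
  qed simp
qed

lemma restrict_labelings: "lab u \<Longrightarrow> restrict u {1..n} \<in> labelings n T"
  by (auto simp: labelings_def lab_def)

lemma minimal_is_arg_min:
  assumes "minimal u" shows "is_arg_min f (\<lambda>x. x \<in> labelings n T) (restrict u {1..n})"
proof -
  have "f (restrict u {1..n}) \<le> f v" if v: "v \<in> labelings n T" for v
  proof -
    have "lab v" using v by (auto simp: labelings_def lab_def)
    then have "F u \<le> F v" using assms by (simp add: minimal_def)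
    moreover have "restrict v {1..n} = v" using v unfolding labelings_def by (rule PiE_restrict)
    ultimately show ?thesis by (simp add: F_def)
  qed
  then show ?thesis using restrict_labelings[of u] assms by (simp add: is_arg_min_linorder minimal_def)
qed

lemma ex_minimal: "\<exists>z. minimal z"
proof -
  have "finite (labelings n T)" unfolding labelings_def using finite_nodes by (intro finite_PiE) auto
  moreover have "lab (\<lambda>i. root (T i))" using root_in[OF tree] by (simp add: lab_def)
  then have "labelings n T \<noteq> {}" using restrict_labelings by blast
  ultimately obtain z where z: "is_arg_min f (\<lambda>x. x \<in> labelings n T) z" using ex_is_arg_min_if_finite by blast
  then have z': "z \<in> labelings n T" "\<And>v. v \<in> labelings n T \<Longrightarrow> f z \<le> f v" by (simp_all add: is_arg_min_linorder)
  have "restrict z {1..n} = z" using z'(1) unfolding labelings_def by (rule PiE_restrict)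
  then have "F z \<le> F u" if "lab u" for u using z'(2)[OF restrict_labelings[OF that]] by (simp add: F_def)
  moreover have "lab z" using z'(1) by (auto simp: labelings_def lab_def)
  ultimately show ?thesis unfolding minimal_def by blast
qed

lemma runs_main:
  "runs (value_oracle n f) main_com (input_store n T) (main_steps n m)
    (\<lambda>s. is_arg_min f (\<lambda>x. x \<in> labelings n T) (output_labeling n s))"
proof -
  obtain z where z: "minimal z" using ex_minimal by blast
  let ?Q = "\<lambda>s. is_arg_min f (\<lambda>x. x \<in> labelings n T) (output_labeling n s)"
  let ?x = "\<lambda>s :: store. \<lambda>i. nmem s ''x'' [i]"
  let ?out = "NAssign ''out'' [V ''i''] (NLoad ''x'' [V ''i''])"
  let ?loop = "While (NLess (NConst 0) (V ''moved'')) phase_com"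
  let ?TL = "1 + (n * m + 1) * (phase_steps n m + 1)" and ?TO = "2 + (n + 1) * (1 + 2)"
  \<comment> \<open>While the flag is set, every finished phase has been paid for by a drop of the
    potential; the phase that clears the flag accounts for the extra one in
    \<open>n * m + 1\<close>.\<close>
  define J where "J j s \<longleftrightarrow> input_ok s \<and> tables_ok s \<and> lab (?x s) \<and> (\<forall>z. minimal z \<longrightarrow> below (?x s) z) \<and>
    (if 0 < nmem s ''moved'' [] then j + potential (?x s) \<le> n * m else j \<le> n * m + 1 \<and> minimal (?x s))" for j s
  have loop: "runs F ?loop s ?TL (\<lambda>s. (\<exists>j. J j s) \<and> \<not> bval s (NLess (NConst 0) (V ''moved'')))" if J0: "J 0 s" for s
  proof (rule runs_While[where I = J, OF J0])
    show "j \<le> n * m + 1" if "J j s" for j s using that by (auto simp: J_def split: if_splits)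
    fix j s' assume J: "J j s'" and b: "bval s' (NLess (NConst 0) (V ''moved''))"
    have mv: "j + potential (?x s') \<le> n * m" using J b by (simp add: J_def)
    have I: "input_ok s'" "tables_ok s'" "lab (?x s')" "\<And>z. minimal z \<Longrightarrow> below (?x s') z" using J unfolding J_def by blast+
    show "runs F phase_com s' (phase_steps n m) (J (Suc j))"
    proof (rule runs_conseq[OF runs_phase[OF I(1,2) refl I(3,4) z] order_refl])
      fix s assume s: "input_ok s \<and> tables_ok s \<and> descended (?x s') (?x s) (0 < nmem s ''moved'' [])"
      then have d: "outward (?x s') (?x s)" "\<forall>z. minimal z \<longrightarrow> below (?x s) z"
        "if 0 < nmem s ''moved'' [] then \<exists>i\<in>{1..n}. ?x s i \<noteq> ?x s' i else minimal (?x s)"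
        unfolding descended_def by blast+
      have "lab (?x s)" using I(3) d(1) unfolding outward_def lab_def by metis
      moreover have "if 0 < nmem s ''moved'' [] then Suc j + potential (?x s) \<le> n * m else Suc j \<le> n * m + 1 \<and> minimal (?x s)"
        using d(3) potential_less[OF I(3) d(1)] mv by (cases "0 < nmem s ''moved'' []") auto
      ultimately show "J (Suc j) s" unfolding J_def using s d(2) by blast
    qed
  qed
  have out: "runs F (For ''i'' (V ''h'') ?out) s ?TO ?Q" if tab: "tables_ok s" and min: "minimal (?x s)" for s
  proof -
    have "runs F (For ''i'' (V ''h'') ?out) s ?TO (\<lambda>s'. \<forall>i<n + 1. nmem s' ''out'' [i] = ?x s i)"
    proof (rule runs_For[where I = "\<lambda>j s'. \<forall>i<j. nmem s' ''out'' [i] = ?x s i"])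
      fix s' assume so: "same_outside (insert ''i'' (writes ?out)) s s'"
      have h: "nmem s' ''h'' = nmem s ''h''" "nmem s' ''x'' = nmem s ''x''" by (rule same_outsideD[OF so], simp)+
      then show "nval s' (V ''h'') = n + 1" using tab by (simp add: tables_ok_def)
      fix j assume "nmem s' ''i'' [] = j" "\<forall>i<j. nmem s' ''out'' [i] = ?x s i"
      then show "runs F ?out s' 1 (\<lambda>s'. \<forall>i<Suc j. nmem (nupdate ''i'' [] (Suc j) s') ''out'' [i] = ?x s i)"
        using h by (simp add: less_Suc_eq)
    qed simp_all
    then show ?thesis
    proof (rule runs_conseq)
      fix s' :: store assume "\<forall>i<n + 1. nmem s' ''out'' [i] = ?x s i"
      then have "output_labeling n s' = restrict (?x s) {1..n}" unfolding output_labeling_def by (intro restrict_ext) simp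
      then show "?Q s'" using minimal_is_arg_min[OF min] by simp
    qed simp
  qed
  have "runs F main_com (input_store n T) ((6 + (n + 1) * 7) + (?TL + ?TO)) ?Q"
    unfolding main_com_def
  proof (rule runs_Seq[OF runs_setup order_refl])
    fix s assume s: "input_ok s \<and> tables_ok s \<and> nmem s ''moved'' [] = 1 \<and> (\<forall>i\<in>{1..n}. nmem s ''x'' [i] = root (T i))"
    have "lab (?x s)" using s root_in[OF tree] by (simp add: lab_def)
    moreover have "below (?x s) z'" if "minimal z'" for z'
      using that s ancestor_of_root[OF tree] by (simp add: below_def minimal_def lab_def)
    ultimately have "J 0 s" unfolding J_def using s potential_le[of "?x s"] by simp
    then show "runs F (Seq ?loop (For ''i'' (V ''h'') ?out)) s (?TL + ?TO) ?Q"
    proof (rule runs_Seq[OF loop order_refl])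
      fix s' assume "(\<exists>j. J j s') \<and> \<not> bval s' (NLess (NConst 0) (V ''moved''))"
      then have "tables_ok s'" "minimal (?x s')" by (auto simp: J_def)
      then show "runs F (For ''i'' (V ''h'') ?out) s' ?TO ?Q" by (rule out)
    qed
  qed
  then have "runs F main_com (input_store n T) (main_steps n m) ?Q"
    by (rule runs_conseq) (simp_all add: main_steps_def)
  then show ?thesis by (simp add: F_value_oracle)
qed

end

section \<open>Polynomial time bounds\<close>

definition polynomial :: "(nat \<Rightarrow> nat \<Rightarrow> nat) \<Rightarrow> bool" where
  "polynomial g \<longleftrightarrow> (\<exists>q. \<forall>n m. g n m = poly2 q n m)"

lemma polynomial_const: "polynomial (\<lambda>n m. c)"
  unfolding polynomial_def by (rule exI[of _ "[:[:c:]:]"]) (simp add: poly2_def)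

lemma polynomial_fst: "polynomial (\<lambda>n m. n)"
  unfolding polynomial_def by (rule exI[of _ "[:[:0, 1:]:]"]) (simp add: poly2_def)

lemma polynomial_snd: "polynomial (\<lambda>n m. m)"
  unfolding polynomial_def by (rule exI[of _ "[:0, 1:]"]) (simp add: poly2_def)

lemma polynomial_add:
  assumes "polynomial g" "polynomial h" shows "polynomial (\<lambda>n m. g n m + h n m)"
proof -
  obtain p q where "\<forall>n m. g n m = poly2 p n m" "\<forall>n m. h n m = poly2 q n m" using assms by (auto simp: polynomial_def)
  then show ?thesis unfolding polynomial_def by (intro exI[of _ "p + q"]) (simp add: poly2_def)
qed

lemma polynomial_mult:
  assumes "polynomial g" "polynomial h" shows "polynomial (\<lambda>n m. g n m * h n m)"
proof -
  obtain p q where "\<forall>n m. g n m = poly2 p n m" "\<forall>n m. h n m = poly2 q n m" using assms by (auto simp: polynomial_def)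
  then show ?thesis unfolding polynomial_def by (intro exI[of _ "p * q"]) (simp add: poly2_def)
qed

lemma polynomial_power: "polynomial g \<Longrightarrow> polynomial (\<lambda>n m. g n m ^ k)"
  by (induction k) (simp_all add: polynomial_const polynomial_mult)

text \<open>All step counts are sums, products and powers with numeral exponents, so after unfolding
  the closure rules apply syntactically.\<close>

lemma polynomial_main_steps: "polynomial main_steps"
proof -
  have e: "main_steps = (\<lambda>n m. main_steps n m)" by simp
  show ?thesis by (subst e, unfold main_steps_def phase_steps_def close_steps_def round_steps_def fix_steps_def scale_steps_def
      oracle_steps_def rho_def nlits_def)
    (intro polynomial_add polynomial_mult polynomial_power polynomial_const polynomial_fst polynomial_snd)
qed

theorem theorem1:
  shows "\<exists>(prog :: com) (q :: nat poly poly).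
    \<forall>(n :: nat) (T :: nat \<Rightarrow> nat rtree) (f :: (nat \<Rightarrow> nat) \<Rightarrow> real).
      n \<ge> 1 \<longrightarrow>
      (\<forall>i\<in>{1..n}. rooted_tree (T i) \<and> binary_tree (T i) \<and> numbered (T i)) \<longrightarrow>
      strongly_tree_submodular n T f \<longrightarrow>
      (\<exists>t s. exec (value_oracle n f) prog (input_store n T) t s \<and>
             t \<le> poly2 q n (Max ((\<lambda>i. card (nodes (T i))) ` {1..n})) \<and>
             is_arg_min f (\<lambda>x. x \<in> labelings n T) (output_labeling n s))"
proof -
  obtain q where q: "\<And>n m. main_steps n m = poly2 q n m" using polynomial_main_steps unfolding polynomial_def by blast
  show ?thesis
  proof (rule exI[of _ main_com], rule exI[of _ q], intro allI impI)
    fix n and T :: "nat \<Rightarrow> nat rtree" and f :: "(nat \<Rightarrow> nat) \<Rightarrow> real"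
    assume T: "\<forall>i\<in>{1..n}. rooted_tree (T i) \<and> binary_tree (T i) \<and> numbered (T i)"
      and f: "strongly_tree_submodular n T f"
    let ?m = "Max ((\<lambda>i. card (nodes (T i))) ` {1..n})"
    have "tree_instance n T f ?m"
    proof
      fix i assume i: "i \<in> {1..n}"
      show "rooted_tree (T i)" "binary_tree (T i)" "numbered (T i)" using T i by blast+
      show "card (nodes (T i)) \<le> ?m" using i by (intro Max_ge) auto
    qed (rule f)
    from tree_instance.runs_main[OF this]
    show "\<exists>t s. exec (value_oracle n f) main_com (input_store n T) t s \<and> t \<le> poly2 q n ?m \<and>
        is_arg_min f (\<lambda>x. x \<in> labelings n T) (output_labeling n s)"
      unfolding q runs_def by blast
  qed
qed

end
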